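(* Let $\mathcal{M}$ be a skeletally small $\operatorname{Hom}$-finite $k$-linear $(d+2)$-angulated category with split idempotents, and let $\mathcal{W}$ be an additive subcategory of $\mathcal{M}$ closed under $d$-extensions. Let $W$ be in $\mathcal{W}$ and suppose that there exist $U^0$ in $\mathcal{W}$ and a non-zero morphism $\gamma^{d+1}:W\to\Sigma^d U^0$. Let $$X^0\xrightarrow{\xi^0}X^1\xrightarrow{\xi^1}X^2\to\cdots\to X^d\xrightarrow{\xi^d}W\xrightarrow{\xi^{d+1}}\Sigma^d X^0$$ be an Auslander-Reiten $(d+2)$-angle in $\mathcal{M}$. Then, for an object $W^0$ of $\mathcal{W}$, the following are equivalent: (a) $X^0$ has a $\mathcal{W}$-cover of the form $\varphi:W^0\to X^0$; (b) there is an Auslander-Reiten $(d+2)$-angle in $\mathcal{W}$ of the form $$W^0\xrightarrow{\omega^0}W^1\xrightarrow{\omega^1}W^2\to\cdots\to W^d\xrightarrow{\omega^d}W\xrightarrow{\omega^{d+1}}\Sigma^d W^0.$$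
   Context: Throughout, $k$ is an algebraically closed field and $d\ge 1$ is a fixed integer. A $(d+2)$-angulated category (Geiss–Keller–Oppermann) is an additive category $\mathcal{M}$ with an automorphism $\Sigma^d$ (inverse $\Sigma^{-d}$) and a collection of sequences $X^0\xrightarrow{\xi^0}X^1\to\cdots\to X^{d+1}\xrightarrow{\xi^{d+1}}\Sigma^dX^0$, called $(d+2)$-angles, such that: (N1) the collection is closed under sums and summands, contains $X\xrightarrow{1}X\to0\to\cdots\to0\to\Sigma^dX$ for each $X$, and every morphism $\xi^0:X^0\to X^1$ is the first morphism of some $(d+2)$-angle; (N2) a sequence is a $(d+2)$-angle if and only if its left rotation $X^1\xrightarrow{\xi^1}\cdots\to X^{d+1}\xrightarrow{\xi^{d+1}}\Sigma^dX^0\xrightarrow{(-1)^d\Sigma^d\xi^0}\Sigma^dX^1$ is; (N3) given $(d+2)$-angles $(X^\bullet,\xi)$, $(Y^\bullet,\eta)$ and $\varphi^0,\varphi^1$ with $\varphi^1\xi^0=\eta^0\varphi^0$, there are $\varphi^2,\dots,\varphi^{d+1}$ with $\varphi^{i+1}\xi^i=\eta^i\varphi^i$ for $0\le i\le d$ and $\Sigma^d(\varphi^0)\xi^{d+1}=\eta^{d+1}\varphi^{d+1}$; (N4) in (N3) the $\varphi^i$ can be chosen so that the cone $X^1\oplus Y^0\to X^2\oplus Y^1\to\cdots\to\Sigma^dX^0\oplus Y^{d+1}\to\Sigma^dX^1\oplus\Sigma^dY^0$ is a $(d+2)$-angle, with morphisms $\begin{pmatrix}-\xi^{i+1}&0\\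 \varphi^{i+1}&\eta^i\end{pmatrix}$, where $\xi^{d+2}=\Sigma^d\xi^0$, $\varphi^{d+2}=\Sigma^d\varphi^0$. An additive subcategory is a full subcategory closed under direct sums, direct summands and isomorphisms. $\mathcal{W}$ is closed under $d$-extensions if for every morphism $\delta:W''\to\Sigma^dW'$ in $\mathcal{M}$ with $W',W''\in\mathcal{W}$ there is a $(d+2)$-angle $W'\to W^1\to\cdots\to W^d\to W''\xrightarrow{\delta}\Sigma^dW'$ with $W^1,\dots,W^d\in\mathcal{W}$. Let $\mathcal{X}$ be $\mathcal{M}$ or $\mathcal{W}$. A morphism $\xi:A\to B$ in $\mathcal{X}$ is left almost split in $\mathcal{X}$ if it is not a split monomorphism and every morphism $A\to Y$ in $\mathcal{X}$ that is not a split monomorphism factors through $\xi$; it is right almost split in $\mathcal{X}$ if it is not a split epimorphism and every morphism $Y\to B$ in $\mathcal{X}$ that is not a split epimorphism factors through $\xi$. $\operatorname{rad}_{\mathcal{X}}$ is the Jacobson radical of $\mathcal{X}$. A $(d+2)$-angle $X^0\xrightarrow{\xi^0}X^1\to\cdots\to X^d\xrightarrow{\xi^d}X^{d+1}\to\Sigma^dX^0$ of $\mathcal{M}$ with $X^0,\dots,X^{d+1}\in\mathcal{X}$ is an Auslander-Reiten $(d+2)$-angle in $\mathcal{X}$ if $\xi^0$ is left almost split in $\mathcal{X}$, $\xi^d$ is right almost split in $\mathcal{X}$ and, when $d\ge2$, $\xi^1,\dots,\xi^{d-1}\in\operatorname{rad}_{\mathcal{X}}$. A $\mathcal{W}$-cover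 of $X\in\mathcal{M}$ is a morphism $\omega:V\to X$ with $V\in\mathcal{W}$ such that every morphism $V'\to X$ with $V'\in\mathcal{W}$ factors through $\omega$, and which is right minimal: every $\varphi:V\to V$ with $\omega\varphi=\omega$ is an isomorphism. *)

theory Defs
  imports "HOL-Algebra.Algebraic_Closure" "HOL-Algebra.Module"
begin

text \<open>
  A category enriched in modules: \<open>Hom C A B\<close> is a module in the sense of \<^theory>\<open>HOL-Algebra.Module\<close>
  (its multiplicative ring fields are never used). Hom-sets are required to be disjoint below, so
  composition need not mention the objects; \<open>g \<cdot>\<^bsub>C\<^esub> f\<close> means first \<open>f\<close>, then \<open>g\<close>.
\<close>

record ('o, 'm, 'k) lin_cat =
  Obj :: "'o set"
  Hom :: "'o \<Rightarrow> 'o \<Rightarrow> ('k, 'm) module"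
  Idm :: "'o \<Rightarrow> 'm"
  Cmp :: "'m \<Rightarrow> 'm \<Rightarrow> 'm"  (infixr \<open>\<cdot>\<index>\<close> 75)

abbreviation Mor :: "('o, 'm, 'k, 'x) lin_cat_scheme \<Rightarrow> 'o \<Rightarrow> 'o \<Rightarrow> 'm set"
  where "Mor C A B \<equiv> carrier (Hom C A B)"

locale linear_category =
  fixes k :: "('k, 'r) ring_scheme" and C :: "('o, 'm, 'k, 'x) lin_cat_scheme"
  assumes field: "field k"
    and hom_module: "\<lbrakk> A \<in> Obj C; B \<in> Obj C \<rbrakk> \<Longrightarrow> module k (Hom C A B)"
    and hom_disjoint:
      "\<lbrakk> A \<in> Obj C; B \<in> Obj C; A' \<in> Obj C; B' \<in> Obj C; f \<in> Mor C A B; f \<in> Mor C A' B' \<rbrakk>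
        \<Longrightarrow> A = A' \<and> B = B'"
    and id_closed: "A \<in> Obj C \<Longrightarrow> Idm C A \<in> Mor C A A"
    and comp_closed:
      "\<lbrakk> A \<in> Obj C; B \<in> Obj C; D \<in> Obj C; f \<in> Mor C A B; g \<in> Mor C B D \<rbrakk>
        \<Longrightarrow> g \<cdot>\<^bsub>C\<^esub> f \<in> Mor C A D"
    and comp_assoc:
      "\<lbrakk> A \<in> Obj C; B \<in> Obj C; D \<in> Obj C; E \<in> Obj C;
         f \<in> Mor C A B; g \<in> Mor C B D; h \<in> Mor C D E \<rbrakk>
        \<Longrightarrow> (h \<cdot>\<^bsub>C\<^esub> g) \<cdot>\<^bsub>C\<^esub> f = h \<cdot>\<^bsub>C\<^esub> (g \<cdot>\<^bsub>C\<^esub> f)"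
    and id_left: "\<lbrakk> A \<in> Obj C; B \<in> Obj C; f \<in> Mor C A B \<rbrakk> \<Longrightarrow> Idm C B \<cdot>\<^bsub>C\<^esub> f = f"
    and id_right: "\<lbrakk> A \<in> Obj C; B \<in> Obj C; f \<in> Mor C A B \<rbrakk> \<Longrightarrow> f \<cdot>\<^bsub>C\<^esub> Idm C A = f"
    and comp_add_right:
      "\<lbrakk> A \<in> Obj C; B \<in> Obj C; D \<in> Obj C; f \<in> Mor C A B; f' \<in> Mor C A B; g \<in> Mor C B D \<rbrakk>
        \<Longrightarrow> g \<cdot>\<^bsub>C\<^esub> (f \<oplus>\<^bsub>Hom C A B\<^esub> f') = (g \<cdot>\<^bsub>C\<^esub> f) \<oplus>\<^bsub>Hom C A D\<^esub> (g \<cdot>\<^bsub>C\<^esub> f')"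
    and comp_add_left:
      "\<lbrakk> A \<in> Obj C; B \<in> Obj C; D \<in> Obj C; f \<in> Mor C A B; g \<in> Mor C B D; g' \<in> Mor C B D \<rbrakk>
        \<Longrightarrow> (g \<oplus>\<^bsub>Hom C B D\<^esub> g') \<cdot>\<^bsub>C\<^esub> f = (g \<cdot>\<^bsub>C\<^esub> f) \<oplus>\<^bsub>Hom C A D\<^esub> (g' \<cdot>\<^bsub>C\<^esub> f)"
    and comp_smult_right:
      "\<lbrakk> A \<in> Obj C; B \<in> Obj C; D \<in> Obj C; a \<in> carrier k; f \<in> Mor C A B; g \<in> Mor C B D \<rbrakk>
        \<Longrightarrow> g \<cdot>\<^bsub>C\<^esub> (a \<odot>\<^bsub>Hom C A B\<^esub> f) = a \<odot>\<^bsub>Hom C A D\<^esub> (g \<cdot>\<^bsub>C\<^esub> f)"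
    and comp_smult_left:
      "\<lbrakk> A \<in> Obj C; B \<in> Obj C; D \<in> Obj C; a \<in> carrier k; f \<in> Mor C A B; g \<in> Mor C B D \<rbrakk>
        \<Longrightarrow> (a \<odot>\<^bsub>Hom C B D\<^esub> g) \<cdot>\<^bsub>C\<^esub> f = a \<odot>\<^bsub>Hom C A D\<^esub> (g \<cdot>\<^bsub>C\<^esub> f)"

definition is_iso :: "('o, 'm, 'k, 'x) lin_cat_scheme \<Rightarrow> 'o \<Rightarrow> 'o \<Rightarrow> 'm \<Rightarrow> bool"
  where "is_iso C A B f \<longleftrightarrow> f \<in> Mor C A B \<and>
    (\<exists>g \<in> Mor C B A. g \<cdot>\<^bsub>C\<^esub> f = Idm C A \<and> f \<cdot>\<^bsub>C\<^esub> g = Idm C B)"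

definition isomorphic :: "('o, 'm, 'k, 'x) lin_cat_scheme \<Rightarrow> 'o \<Rightarrow> 'o \<Rightarrow> bool"
  where "isomorphic C A B \<longleftrightarrow> (\<exists>f. is_iso C A B f)"

definition split_mono :: "('o, 'm, 'k, 'x) lin_cat_scheme \<Rightarrow> 'o \<Rightarrow> 'o \<Rightarrow> 'm \<Rightarrow> bool"
  where "split_mono C A B f \<longleftrightarrow> f \<in> Mor C A B \<and> (\<exists>r \<in> Mor C B A. r \<cdot>\<^bsub>C\<^esub> f = Idm C A)"

definition split_epi :: "('o, 'm, 'k, 'x) lin_cat_scheme \<Rightarrow> 'o \<Rightarrow> 'o \<Rightarrow> 'm \<Rightarrow> bool"
  where "split_epi C A B f \<longleftrightarrow> f \<in> Mor C A B \<and> (\<exists>s \<in> Mor C B A. f \<cdot>\<^bsub>C\<^esub> s = Idm C B)"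

definition zero_object :: "('o, 'm, 'k, 'x) lin_cat_scheme \<Rightarrow> 'o \<Rightarrow> bool"
  where "zero_object C Z \<longleftrightarrow> Z \<in> Obj C \<and>
    (\<forall>A \<in> Obj C. Mor C Z A = {\<zero>\<^bsub>Hom C Z A\<^esub>} \<and> Mor C A Z = {\<zero>\<^bsub>Hom C A Z\<^esub>})"

definition direct_sum ::
  "('o, 'm, 'k, 'x) lin_cat_scheme \<Rightarrow> 'o \<Rightarrow> 'o \<Rightarrow> 'o \<Rightarrow> 'm \<Rightarrow> 'm \<Rightarrow> 'm \<Rightarrow> 'm \<Rightarrow> bool"
  where "direct_sum C A B S i j p q \<longleftrightarrow>
    A \<in> Obj C \<and> B \<in> Obj C \<and> S \<in> Obj C \<and>
    i \<in> Mor C A S \<and> j \<in> Mor C B S \<and> p \<in> Mor C S A \<and> q \<in> Mor C S B \<and>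
    p \<cdot>\<^bsub>C\<^esub> i = Idm C A \<and> q \<cdot>\<^bsub>C\<^esub> j = Idm C B \<and>
    p \<cdot>\<^bsub>C\<^esub> j = \<zero>\<^bsub>Hom C B A\<^esub> \<and> q \<cdot>\<^bsub>C\<^esub> i = \<zero>\<^bsub>Hom C A B\<^esub> \<and>
    (i \<cdot>\<^bsub>C\<^esub> p) \<oplus>\<^bsub>Hom C S S\<^esub> (j \<cdot>\<^bsub>C\<^esub> q) = Idm C S"

locale additive_category = linear_category +
  assumes ex_zero_object: "\<exists>Z. zero_object C Z"
    and ex_direct_sum: "\<lbrakk> A \<in> Obj C; B \<in> Obj C \<rbrakk> \<Longrightarrow> \<exists>S i j p q. direct_sum C A B S i j p q"

definition split_idempotents :: "('o, 'm, 'k, 'x) lin_cat_scheme \<Rightarrow> bool"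
  where "split_idempotents C \<longleftrightarrow>
    (\<forall>A \<in> Obj C. \<forall>e \<in> Mor C A A. e \<cdot>\<^bsub>C\<^esub> e = e \<longrightarrow>
      (\<exists>B \<in> Obj C. \<exists>r \<in> Mor C A B. \<exists>s \<in> Mor C B A. s \<cdot>\<^bsub>C\<^esub> r = e \<and> r \<cdot>\<^bsub>C\<^esub> s = Idm C B))"

definition finite_dim :: "('k, 'r) ring_scheme \<Rightarrow> ('k, 'm) module \<Rightarrow> bool"
  where "finite_dim k V \<longleftrightarrow>
    (\<exists>B. finite B \<and> B \<subseteq> carrier V \<and>
      (\<forall>v \<in> carrier V. \<exists>c \<in> B \<rightarrow> carrier k. v = (\<Oplus>\<^bsub>V\<^esub>b \<in> B. c b \<odot>\<^bsub>V\<^esub> b)))"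

definition Hom_finite :: "('k, 'r) ring_scheme \<Rightarrow> ('o, 'm, 'k, 'x) lin_cat_scheme \<Rightarrow> bool"
  where "Hom_finite k C \<longleftrightarrow> (\<forall>A \<in> Obj C. \<forall>B \<in> Obj C. finite_dim k (Hom C A B))"

text \<open>
  The isomorphism classes form a set: there is a set of representatives. Since \<open>Obj C\<close> is itself
  a set, every category considered here satisfies this (take \<open>S = Obj C\<close>); there are no proper
  classes in HOL.
\<close>

definition skeletally_small :: "('o, 'm, 'k, 'x) lin_cat_scheme \<Rightarrow> bool"
  where "skeletally_small C \<longleftrightarrow> (\<exists>S \<subseteq> Obj C. \<forall>A \<in> Obj C. \<exists>B \<in> S. isomorphic C A B)"

definition full_sub :: "('o, 'm, 'k, 'x) lin_cat_scheme \<Rightarrow> 'o set \<Rightarrow> ('o, 'm, 'k, 'x) lin_cat_scheme"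
  where "full_sub C \<W> = C\<lparr>Obj := \<W>\<rparr>"

text \<open>
  A full subcategory is given by its set of objects. As a direct sum is only determined up to
  isomorphism, the predicate \<^const>\<open>direct_sum\<close> covers all representatives.
\<close>

definition additive_subcategory :: "('o, 'm, 'k, 'x) lin_cat_scheme \<Rightarrow> 'o set \<Rightarrow> bool"
  where "additive_subcategory C \<W> \<longleftrightarrow> \<W> \<subseteq> Obj C \<and>
    (\<forall>A B S i j p q. direct_sum C A B S i j p q \<longrightarrow> A \<in> \<W> \<longrightarrow> B \<in> \<W> \<longrightarrow> S \<in> \<W>) \<and>
    (\<forall>A B S i j p q. direct_sum C A B S i j p q \<longrightarrow> S \<in> \<W> \<longrightarrow> A \<in> \<W> \<and> B \<in> \<W>) \<and>
    (\<forall>A \<in> \<W>. \<forall>B \<in> Obj C. isomorphic C A B \<longrightarrow> B \<in> \<W>)"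

definition left_almost_split :: "('o, 'm, 'k, 'x) lin_cat_scheme \<Rightarrow> 'o \<Rightarrow> 'o \<Rightarrow> 'm \<Rightarrow> bool"
  where "left_almost_split C A B f \<longleftrightarrow>
    A \<in> Obj C \<and> B \<in> Obj C \<and> f \<in> Mor C A B \<and> \<not> split_mono C A B f \<and>
    (\<forall>Y \<in> Obj C. \<forall>g \<in> Mor C A Y. \<not> split_mono C A Y g \<longrightarrow> (\<exists>h \<in> Mor C B Y. g = h \<cdot>\<^bsub>C\<^esub> f))"

definition right_almost_split :: "('o, 'm, 'k, 'x) lin_cat_scheme \<Rightarrow> 'o \<Rightarrow> 'o \<Rightarrow> 'm \<Rightarrow> bool"
  where "right_almost_split C A B f \<longleftrightarrow>
    A \<in> Obj C \<and> B \<in> Obj C \<and> f \<in> Mor C A B \<and> \<not> split_epi C A B f \<and>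
    (\<forall>Y \<in> Obj C. \<forall>g \<in> Mor C Y B. \<not> split_epi C Y B g \<longrightarrow> (\<exists>h \<in> Mor C Y A. g = f \<cdot>\<^bsub>C\<^esub> h))"

definition radical :: "('o, 'm, 'k, 'x) lin_cat_scheme \<Rightarrow> 'o \<Rightarrow> 'o \<Rightarrow> 'm set"
  where "radical C A B = {f. A \<in> Obj C \<and> B \<in> Obj C \<and> f \<in> Mor C A B \<and>
    (\<forall>g \<in> Mor C B A. is_iso C A A (Idm C A \<ominus>\<^bsub>Hom C A A\<^esub> (g \<cdot>\<^bsub>C\<^esub> f)))}"

definition is_cover :: "('o, 'm, 'k, 'x) lin_cat_scheme \<Rightarrow> 'o set \<Rightarrow> 'o \<Rightarrow> 'o \<Rightarrow> 'm \<Rightarrow> bool"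
  where "is_cover C \<W> V A w \<longleftrightarrow>
    V \<in> \<W> \<and> A \<in> Obj C \<and> w \<in> Mor C V A \<and>
    (\<forall>V' \<in> \<W>. \<forall>f \<in> Mor C V' A. \<exists>h \<in> Mor C V' V. f = w \<cdot>\<^bsub>C\<^esub> h) \<and>
    (\<forall>h \<in> Mor C V V. w \<cdot>\<^bsub>C\<^esub> h = w \<longrightarrow> is_iso C V V h)"

text \<open>
  \<open>shO\<close> and \<open>shM\<close> are the actions of \<open>\<Sigma>\<^sup>d\<close> on objects and morphisms. A sequence
  \<open>X\<^sup>0 \<rightarrow> \<dots> \<rightarrow> X\<^sup>d\<^sup>+\<^sup>1 \<rightarrow> \<Sigma>\<^sup>d X\<^sup>0\<close> is a pair of functions \<open>Xs\<close>, \<open>\<xi>\<close> of which only the values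
  at \<open>0, \<dots>, d + 1\<close> matter. (That \<open>angles\<close> does not depend on the other values follows from its closure
  under direct sums, because two sequences which agree up to \<open>d + 1\<close> are isomorphic.)
\<close>

record ('o, 'm, 'k) ang_cat = "('o, 'm, 'k) lin_cat" +
  shO :: "'o \<Rightarrow> 'o"
  shM :: "'m \<Rightarrow> 'm"
  angles :: "((nat \<Rightarrow> 'o) \<times> (nat \<Rightarrow> 'm)) set"

text \<open>
  \<open>ext d F x\<close> continues \<open>x\<^sup>0, \<dots>, x\<^sup>d\<^sup>+\<^sup>1\<close> by \<open>x\<^sup>d\<^sup>+\<^sup>2\<^sup>+\<^sup>i = F x\<^sup>i\<close>, where \<open>F\<close> is \<open>shO M\<close> or \<open>shM M\<close>. It is
  only evaluated at indices up to \<open>d + 3\<close>.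
\<close>

definition ext :: "nat \<Rightarrow> ('a \<Rightarrow> 'a) \<Rightarrow> (nat \<Rightarrow> 'a) \<Rightarrow> nat \<Rightarrow> 'a"
  where "ext d F x i = (if i \<le> d + 1 then x i else F (x (i - (d + 2))))"

definition is_seq :: "nat \<Rightarrow> ('o, 'm, 'k, 'x) ang_cat_scheme \<Rightarrow> (nat \<Rightarrow> 'o) \<Rightarrow> (nat \<Rightarrow> 'm) \<Rightarrow> bool"
  where "is_seq d M Xs \<xi> \<longleftrightarrow>
    (\<forall>i \<le> d + 1. Xs i \<in> Obj M \<and> \<xi> i \<in> Mor M (Xs i) (ext d (shO M) Xs (i + 1)))"

definition seq_mor :: "nat \<Rightarrow> ('o, 'm, 'k, 'x) ang_cat_scheme \<Rightarrow>
    (nat \<Rightarrow> 'o) \<Rightarrow> (nat \<Rightarrow> 'm) \<Rightarrow> (nat \<Rightarrow> 'o) \<Rightarrow> (nat \<Rightarrow> 'm) \<Rightarrow> (nat \<Rightarrow> 'm) \<Rightarrow> bool"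
  where "seq_mor d M Xs \<xi> Ys \<eta> \<phi> \<longleftrightarrow>
    (\<forall>i \<le> d + 1. \<phi> i \<in> Mor M (Xs i) (Ys i) \<and>
      ext d (shM M) \<phi> (i + 1) \<cdot>\<^bsub>M\<^esub> \<xi> i = \<eta> i \<cdot>\<^bsub>M\<^esub> \<phi> i)"

definition seq_direct_sum :: "nat \<Rightarrow> ('o, 'm, 'k, 'x) ang_cat_scheme \<Rightarrow>
    (nat \<Rightarrow> 'o) \<Rightarrow> (nat \<Rightarrow> 'm) \<Rightarrow> (nat \<Rightarrow> 'o) \<Rightarrow> (nat \<Rightarrow> 'm) \<Rightarrow> (nat \<Rightarrow> 'o) \<Rightarrow> (nat \<Rightarrow> 'm) \<Rightarrow> bool"
  where "seq_direct_sum d M Xs \<xi> Ys \<eta> S \<sigma> \<longleftrightarrow>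
    is_seq d M Xs \<xi> \<and> is_seq d M Ys \<eta> \<and> is_seq d M S \<sigma> \<and>
    (\<exists>\<iota> \<kappa> \<pi> \<rho>.
      (\<forall>i \<le> d + 1. direct_sum M (Xs i) (Ys i) (S i) (\<iota> i) (\<kappa> i) (\<pi> i) (\<rho> i)) \<and>
      seq_mor d M Xs \<xi> S \<sigma> \<iota> \<and> seq_mor d M Ys \<eta> S \<sigma> \<kappa> \<and>
      seq_mor d M S \<sigma> Xs \<xi> \<pi> \<and> seq_mor d M S \<sigma> Ys \<eta> \<rho>)"

definition rot_obj :: "nat \<Rightarrow> ('o, 'm, 'k, 'x) ang_cat_scheme \<Rightarrow> (nat \<Rightarrow> 'o) \<Rightarrow> nat \<Rightarrow> 'o"
  where "rot_obj d M Xs i = ext d (shO M) Xs (i + 1)"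

definition rot_mor ::
  "nat \<Rightarrow> ('o, 'm, 'k, 'x) ang_cat_scheme \<Rightarrow> (nat \<Rightarrow> 'o) \<Rightarrow> (nat \<Rightarrow> 'm) \<Rightarrow> nat \<Rightarrow> 'm"
  where "rot_mor d M Xs \<xi> i =
    (if i = d + 1
     then (if even d then shM M (\<xi> 0)
           else \<ominus>\<^bsub>Hom M (shO M (Xs 0)) (shO M (Xs 1))\<^esub> shM M (\<xi> 0))
     else \<xi> (i + 1))"

text \<open>
  The cone of \<open>\<phi>\<close>, up to the choice of the direct sums \<open>D\<^sup>i = X\<^sup>i\<^sup>+\<^sup>1 \<oplus> Y\<^sup>i\<close>. The last four conditions
  are the entries of the matrix of \<open>\<zeta>\<^sup>i\<close>. For \<open>i = d + 1\<close> the codomain is \<open>\<Sigma>\<^sup>d D\<^sup>0\<close>, decomposed as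
  \<open>\<Sigma>\<^sup>d X\<^sup>1 \<oplus> \<Sigma>\<^sup>d Y\<^sup>0\<close> by the image under \<open>\<Sigma>\<^sup>d\<close> of the decomposition of \<open>D\<^sup>0\<close>.
\<close>

definition is_cone :: "nat \<Rightarrow> ('o, 'm, 'k, 'x) ang_cat_scheme \<Rightarrow>
    (nat \<Rightarrow> 'o) \<Rightarrow> (nat \<Rightarrow> 'm) \<Rightarrow> (nat \<Rightarrow> 'o) \<Rightarrow> (nat \<Rightarrow> 'm) \<Rightarrow> (nat \<Rightarrow> 'm) \<Rightarrow>
    (nat \<Rightarrow> 'o) \<Rightarrow> (nat \<Rightarrow> 'm) \<Rightarrow> bool"
  where "is_cone d M Xs \<xi> Ys \<eta> \<phi> Ds \<zeta> \<longleftrightarrow>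
    is_seq d M Ds \<zeta> \<and>
    (\<exists>\<iota> \<kappa> \<pi> \<rho>. \<forall>i \<le> d + 1.
      direct_sum M (ext d (shO M) Xs (i + 1)) (Ys i) (Ds i) (\<iota> i) (\<kappa> i) (\<pi> i) (\<rho> i) \<and>
      ext d (shM M) \<pi> (i + 1) \<cdot>\<^bsub>M\<^esub> \<zeta> i \<cdot>\<^bsub>M\<^esub> \<iota> i
        = \<ominus>\<^bsub>Hom M (ext d (shO M) Xs (i + 1)) (ext d (shO M) Xs (i + 2))\<^esub>
            ext d (shM M) \<xi> (i + 1) \<and>
      ext d (shM M) \<pi> (i + 1) \<cdot>\<^bsub>M\<^esub> \<zeta> i \<cdot>\<^bsub>M\<^esub> \<kappa> i
        = \<zero>\<^bsub>Hom M (Ys i) (ext d (shO M) Xs (i + 2))\<^esub> \<and>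
      ext d (shM M) \<rho> (i + 1) \<cdot>\<^bsub>M\<^esub> \<zeta> i \<cdot>\<^bsub>M\<^esub> \<iota> i = ext d (shM M) \<phi> (i + 1) \<and>
      ext d (shM M) \<rho> (i + 1) \<cdot>\<^bsub>M\<^esub> \<zeta> i \<cdot>\<^bsub>M\<^esub> \<kappa> i = \<eta> i)"

text \<open>
  The axioms \<open>sh_obj\<close> to \<open>sh_add\<close> say that \<open>\<Sigma>\<^sup>d\<close> is an automorphism of the additive category \<open>M\<close>;
  it is not required to be linear over \<open>k\<close>.
\<close>

locale angulated_category = additive_category k M
  for k :: "('k, 'r) ring_scheme" and M :: "('o, 'm, 'k, 'x) ang_cat_scheme" +
  fixes d :: nat
  assumes d_pos: "d \<ge> 1"
    and sh_obj: "bij_betw (shO M) (Obj M) (Obj M)"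
    and sh_mor: "\<lbrakk> A \<in> Obj M; B \<in> Obj M \<rbrakk>
        \<Longrightarrow> bij_betw (shM M) (Mor M A B) (Mor M (shO M A) (shO M B))"
    and sh_id: "A \<in> Obj M \<Longrightarrow> shM M (Idm M A) = Idm M (shO M A)"
    and sh_comp: "\<lbrakk> A \<in> Obj M; B \<in> Obj M; D \<in> Obj M; f \<in> Mor M A B; g \<in> Mor M B D \<rbrakk>
        \<Longrightarrow> shM M (g \<cdot>\<^bsub>M\<^esub> f) = shM M g \<cdot>\<^bsub>M\<^esub> shM M f"
    and sh_add: "\<lbrakk> A \<in> Obj M; B \<in> Obj M; f \<in> Mor M A B; g \<in> Mor M A B \<rbrakk>
        \<Longrightarrow> shM M (f \<oplus>\<^bsub>Hom M A B\<^esub> g) = shM M f \<oplus>\<^bsub>Hom M (shO M A) (shO M B)\<^esub> shM M g"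
    and angle_is_seq: "(Xs, \<xi>) \<in> angles M \<Longrightarrow> is_seq d M Xs \<xi>"
    and N1_sum: "\<lbrakk> seq_direct_sum d M Xs \<xi> Ys \<eta> S \<sigma>; (Xs, \<xi>) \<in> angles M; (Ys, \<eta>) \<in> angles M \<rbrakk>
        \<Longrightarrow> (S, \<sigma>) \<in> angles M"
    and N1_summand: "\<lbrakk> seq_direct_sum d M Xs \<xi> Ys \<eta> S \<sigma>; (S, \<sigma>) \<in> angles M \<rbrakk>
        \<Longrightarrow> (Xs, \<xi>) \<in> angles M \<and> (Ys, \<eta>) \<in> angles M"
    and N1_trivial: "\<lbrakk> is_seq d M Xs \<xi>; Xs 1 = Xs 0; \<xi> 0 = Idm M (Xs 0);
          \<forall>i \<in> {2..d + 1}. zero_object M (Xs i) \<rbrakk>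
        \<Longrightarrow> (Xs, \<xi>) \<in> angles M"
    and N1_complete: "\<lbrakk> A \<in> Obj M; B \<in> Obj M; f \<in> Mor M A B \<rbrakk>
        \<Longrightarrow> \<exists>Xs \<xi>. (Xs, \<xi>) \<in> angles M \<and> Xs 0 = A \<and> Xs 1 = B \<and> \<xi> 0 = f"
    and N2: "is_seq d M Xs \<xi>
        \<Longrightarrow> (Xs, \<xi>) \<in> angles M \<longleftrightarrow> (rot_obj d M Xs, rot_mor d M Xs \<xi>) \<in> angles M"
    and N3: "\<lbrakk> (Xs, \<xi>) \<in> angles M; (Ys, \<eta>) \<in> angles M; f \<in> Mor M (Xs 0) (Ys 0); g \<in> Mor M (Xs 1) (Ys 1);
          g \<cdot>\<^bsub>M\<^esub> \<xi> 0 = \<eta> 0 \<cdot>\<^bsub>M\<^esub> f \<rbrakk>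
        \<Longrightarrow> \<exists>\<phi>. \<phi> 0 = f \<and> \<phi> 1 = g \<and> seq_mor d M Xs \<xi> Ys \<eta> \<phi>"
    and N4: "\<lbrakk> (Xs, \<xi>) \<in> angles M; (Ys, \<eta>) \<in> angles M; f \<in> Mor M (Xs 0) (Ys 0); g \<in> Mor M (Xs 1) (Ys 1);
          g \<cdot>\<^bsub>M\<^esub> \<xi> 0 = \<eta> 0 \<cdot>\<^bsub>M\<^esub> f \<rbrakk>
        \<Longrightarrow> \<exists>\<phi> Ds \<zeta>. \<phi> 0 = f \<and> \<phi> 1 = g \<and> seq_mor d M Xs \<xi> Ys \<eta> \<phi> \<and>
              is_cone d M Xs \<xi> Ys \<eta> \<phi> Ds \<zeta> \<and> (Ds, \<zeta>) \<in> angles M"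

definition closed_under_extensions :: "nat \<Rightarrow> ('o, 'm, 'k, 'x) ang_cat_scheme \<Rightarrow> 'o set \<Rightarrow> bool"
  where "closed_under_extensions d M \<W> \<longleftrightarrow>
    (\<forall>W' \<in> \<W>. \<forall>W'' \<in> \<W>. \<forall>\<delta> \<in> Mor M W'' (shO M W').
      \<exists>Xs \<xi>. (Xs, \<xi>) \<in> angles M \<and> Xs 0 = W' \<and> Xs (d + 1) = W'' \<and> \<xi> (d + 1) = \<delta> \<and>
        (\<forall>i \<in> {1..d}. Xs i \<in> \<W>))"

definition AR_angle ::
  "nat \<Rightarrow> ('o, 'm, 'k, 'x) ang_cat_scheme \<Rightarrow> 'o set \<Rightarrow> (nat \<Rightarrow> 'o) \<Rightarrow> (nat \<Rightarrow> 'm) \<Rightarrow> bool"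
  where "AR_angle d M \<W> Xs \<xi> \<longleftrightarrow>
    (Xs, \<xi>) \<in> angles M \<and> (\<forall>i \<le> d + 1. Xs i \<in> \<W>) \<and>
    left_almost_split (full_sub M \<W>) (Xs 0) (Xs 1) (\<xi> 0) \<and>
    right_almost_split (full_sub M \<W>) (Xs d) (Xs (d + 1)) (\<xi> d) \<and>
    (\<forall>i \<in> {1..<d}. \<xi> i \<in> radical (full_sub M \<W>) (Xs i) (Xs (i + 1)))"

end

theory Submission
  imports Defs
begin

text \<open>
  Write the connecting morphisms as \<open>\<Sigma>\<^sup>d \<zeta>\<close> and \<open>\<Sigma>\<^sup>d \<delta>\<close> with \<open>\<zeta> : \<Sigma>\<^sup>-\<^sup>dW \<rightarrow> X\<^sup>0\<close> and
  \<open>\<delta> : \<Sigma>\<^sup>-\<^sup>dW \<rightarrow> W\<^sup>0\<close>. Since \<open>\<xi>\<^sup>0\<close> is left almost split, every \<open>f \<noteq> 0\<close> into \<open>X\<^sup>0\<close> satisfies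
  \<open>f \<epsilon> = \<zeta>\<close> for some \<open>\<epsilon>\<close>; since \<open>\<xi>\<^sup>d\<close> is right almost split and \<open>\<W>\<close> is closed under
  \<open>d\<close>-extensions, every \<open>\<epsilon> \<noteq> 0\<close> from \<open>\<Sigma>\<^sup>-\<^sup>dW\<close> into an object of \<open>\<W>\<close> satisfies \<open>h \<epsilon> = \<zeta>\<close> for
  some \<open>h\<close>.

  Given a cover \<open>\<phi>\<close>, the morphism \<open>\<gamma>\<close> thus produces \<open>\<delta>\<close> with \<open>\<phi> \<delta> = \<zeta>\<close>. Minimality of \<open>\<phi>\<close> makes
  composition with \<open>\<phi>\<close> injective on morphisms from \<open>\<Sigma>\<^sup>-\<^sup>dY\<close> to \<open>W\<^sup>0\<close> for \<open>Y \<in> \<W>\<close>, which implies that the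
  angle over \<open>\<delta>\<close> is almost split on both ends. Its inner morphisms become radical once the
  total dimension of the endomorphism spaces is minimal.

  Conversely, \<open>\<zeta>\<close> factors as \<open>\<phi> \<delta>\<close>. That \<open>\<phi>\<close> is a precover amounts to a nondegenerate pairing of
  finite-dimensional spaces, and right minimality holds because a non-split endomorphism of
  \<open>W\<^sup>0\<close> kills \<open>\<delta>\<close>.
\<close>

section \<open>Finite-dimensional spaces\<close>

text \<open>A list in place of a finite set lets the spanning vectors be removed one at a time by
  induction.\<close>

primrec lin_span :: "('k, 'r) ring_scheme \<Rightarrow> ('k, 'm) module \<Rightarrow> 'm list \<Rightarrow> 'm set"
  where
    "lin_span R V [] = {\<zero>\<^bsub>V\<^esub>}"
  | "lin_span R V (b # bs) = {(a \<odot>\<^bsub>V\<^esub> b) \<oplus>\<^bsub>V\<^esub> w | a w. a \<in> carrier R \<and> w \<in> lin_span R V bs}"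

text \<open>For a subspace \<open>S\<close> of the span of the list this is the dimension of
  \<open>S\<close>: it counts the jumps in the filtration of \<open>S\<close> by the spans of the
  suffixes, and over a field every jump has size one.\<close>

primrec span_rank :: "('k, 'r) ring_scheme \<Rightarrow> ('k, 'm) module \<Rightarrow> 'm list \<Rightarrow> 'm set \<Rightarrow> nat"
  where
    "span_rank R V [] S = 0"
  | "span_rank R V (b # bs) S =
      span_rank R V bs (S \<inter> lin_span R V bs) + (if S \<subseteq> lin_span R V bs then 0 else 1)"

lemma (in module) submodule_zero: "submodule S R M \<Longrightarrow> \<zero>\<^bsub>M\<^esub> \<in> S"
  by (metis submoduleE(1) submoduleE(2) submoduleE(3) submoduleE(5) M.r_neg ex_in_conv subsetD)

lemma (in module) submodule_Int:
  assumes "submodule S R M" and "submodule T R M"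
  shows "submodule (S \<inter> T) R M"
  using assms submoduleE[OF assms(1)] submoduleE[OF assms(2)] submodule_zero
  by (intro submoduleI) auto

lemma (in module) submodule_diff:
  assumes "submodule S R M" and "x \<in> S" and "y \<in> S"
  shows "x \<ominus>\<^bsub>M\<^esub> y \<in> S"
  using submoduleE[OF assms(1)] assms by (simp add: a_minus_def)

lemma lin_span_submodule:
  fixes V :: "('k, 'm) module"
  assumes "module R V" and "set bs \<subseteq> carrier V"
  shows "submodule (lin_span R V bs) R V"
  using assms(2)
proof (induction bs)
  case Nil
  interpret module R V by fact
  show ?case by (rule submoduleI) auto
next
  case (Cons b bs)
  interpret module R V by fact
  have b: "b \<in> carrier V" and IH: "submodule (lin_span R V bs) R V"
    using Cons by auto
  note E = submoduleE[OF IH] and subD = subsetD[OF submoduleE(1)[OF IH]]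
  show ?case
  proof (rule submoduleI)
    show "lin_span R V (b # bs) \<subseteq> carrier V"
      using b subD by auto
    have "\<zero>\<^bsub>V\<^esub> = (\<zero>\<^bsub>R\<^esub> \<odot>\<^bsub>V\<^esub> b) \<oplus>\<^bsub>V\<^esub> \<zero>\<^bsub>V\<^esub>"
      using b by simp
    then show "\<zero>\<^bsub>V\<^esub> \<in> lin_span R V (b # bs)"
      using submodule_zero[OF IH] by force
  next
    fix x assume "x \<in> lin_span R V (b # bs)"
    then obtain a w where x: "x = (a \<odot>\<^bsub>V\<^esub> b) \<oplus>\<^bsub>V\<^esub> w" "a \<in> carrier R" "w \<in> lin_span R V bs"
      by auto
    have "\<ominus>\<^bsub>V\<^esub> x = ((\<ominus>\<^bsub>R\<^esub> a) \<odot>\<^bsub>V\<^esub> b) \<oplus>\<^bsub>V\<^esub> (\<ominus>\<^bsub>V\<^esub> w)"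
      using x b subD by (simp add: smult_l_minus M.minus_add)
    then show "\<ominus>\<^bsub>V\<^esub> x \<in> lin_span R V (b # bs)"
      using x E(3) by force
  next
    fix x y assume "x \<in> lin_span R V (b # bs)" "y \<in> lin_span R V (b # bs)"
    then obtain a w a' w' where x: "x = (a \<odot>\<^bsub>V\<^esub> b) \<oplus>\<^bsub>V\<^esub> w" "a \<in> carrier R" "w \<in> lin_span R V bs"
      and y: "y = (a' \<odot>\<^bsub>V\<^esub> b) \<oplus>\<^bsub>V\<^esub> w'" "a' \<in> carrier R" "w' \<in> lin_span R V bs"
      by auto
    have "x \<oplus>\<^bsub>V\<^esub> y = ((a \<oplus>\<^bsub>R\<^esub> a') \<odot>\<^bsub>V\<^esub> b) \<oplus>\<^bsub>V\<^esub> (w \<oplus>\<^bsub>V\<^esub> w')"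
      using x y b subD by (simp add: smult_l_distr M.a_ac)
    then show "x \<oplus>\<^bsub>V\<^esub> y \<in> lin_span R V (b # bs)"
      using x y E(5) by force
  next
    fix c x assume c: "c \<in> carrier R" and "x \<in> lin_span R V (b # bs)"
    then obtain a w where x: "x = (a \<odot>\<^bsub>V\<^esub> b) \<oplus>\<^bsub>V\<^esub> w" "a \<in> carrier R" "w \<in> lin_span R V bs"
      by auto
    have "c \<odot>\<^bsub>V\<^esub> x = ((c \<otimes>\<^bsub>R\<^esub> a) \<odot>\<^bsub>V\<^esub> b) \<oplus>\<^bsub>V\<^esub> (c \<odot>\<^bsub>V\<^esub> w)"
      using x b c subD by (simp add: smult_r_distr smult_assoc1)
    then show "c \<odot>\<^bsub>V\<^esub> x \<in> lin_span R V (b # bs)"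
      using x c E(4) by force
  qed
qed

text \<open>Compare jump by jump: where \<open>S\<close> jumps, so does the larger \<open>T\<close>.
  Equal ranks therefore force equal jumps and, by induction, equal intersections with the span of
  the tail.\<close>

lemma span_rank_mono:
  fixes V :: "('k, 'm) module"
  assumes "field R" and "module R V" and "set bs \<subseteq> carrier V"
    and "submodule S R V" and "submodule T R V" and "S \<subseteq> T" and "T \<subseteq> lin_span R V bs"
  shows "span_rank R V bs S \<le> span_rank R V bs T \<and>
    (span_rank R V bs S = span_rank R V bs T \<longrightarrow> S = T)"
  using assms(3-)
proof (induction bs arbitrary: S T)
  case Nil
  interpret module R V by fact
  show ?case using Nil submodule_zero by auto
next
  case (Cons b bs)
  interpret module R V by fact
  let ?L = "lin_span R V bs"
  have b: "b \<in> carrier V" and bs: "set bs \<subseteq> carrier V" using Cons.prems by auto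
  have L: "submodule ?L R V" by (rule lin_span_submodule) (fact assms(2), fact bs)
  have IH: "span_rank R V bs (S \<inter> ?L) \<le> span_rank R V bs (T \<inter> ?L) \<and>
    (span_rank R V bs (S \<inter> ?L) = span_rank R V bs (T \<inter> ?L) \<longrightarrow> S \<inter> ?L = T \<inter> ?L)"
    using Cons.prems bs L by (intro Cons.IH submodule_Int) auto
  \<comment> \<open>Some \<open>y\<close> in \<open>S\<close> has a non-zero coefficient
    \<open>c\<close> at \<open>b\<close>, since otherwise it would lie in \<open>?L\<close>.
    Subtracting from \<open>x\<close> in \<open>T\<close> the multiple of \<open>y\<close> by
    \<open>v\<close> = \<open>c'\<close>/\<open>c\<close> leaves an element of
    \<open>T \<inter> ?L\<close>, hence of \<open>S\<close>.\<close>
  have key: "T \<subseteq> S" if eq: "S \<inter> ?L = T \<inter> ?L" and nS: "\<not> S \<subseteq> ?L"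
  proof
    fix x assume xT: "x \<in> T"
    note SE = submoduleE[OF Cons.prems(2)] and TE = submoduleE[OF Cons.prems(3)]
    note LE = submoduleE[OF L] and Lsub = subsetD[OF submoduleE(1)[OF L]]
    obtain y where y: "y \<in> S" "y \<notin> ?L" using nS by auto
    then have "y \<in> lin_span R V (b # bs)" using Cons.prems by auto
    then obtain c w where c: "y = (c \<odot>\<^bsub>V\<^esub> b) \<oplus>\<^bsub>V\<^esub> w" "c \<in> carrier R" "w \<in> ?L" by auto
    have "x \<in> lin_span R V (b # bs)" using xT Cons.prems by auto
    then obtain c' w' where c': "x = (c' \<odot>\<^bsub>V\<^esub> b) \<oplus>\<^bsub>V\<^esub> w'" "c' \<in> carrier R" "w' \<in> ?L" by auto
    have "c \<noteq> \<zero>\<^bsub>R\<^esub>" using y c b Lsub by auto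
    then have "c \<in> Units R" using c field.field_Units[OF assms(1)] by auto
    then obtain u where u: "u \<in> carrier R" "u \<otimes>\<^bsub>R\<^esub> c = \<one>\<^bsub>R\<^esub>"
      using R.Units_l_inv_ex by blast
    define v where "v = c' \<otimes>\<^bsub>R\<^esub> u"
    have v: "v \<in> carrier R" "v \<otimes>\<^bsub>R\<^esub> c = c'"
      using u c c' by (auto simp: v_def R.m_assoc)
    have vy: "v \<odot>\<^bsub>V\<^esub> y = (c' \<odot>\<^bsub>V\<^esub> b) \<oplus>\<^bsub>V\<^esub> (v \<odot>\<^bsub>V\<^esub> w)"
      using v c b Lsub by (simp add: smult_r_distr flip: smult_assoc1)
    have vyS: "v \<odot>\<^bsub>V\<^esub> y \<in> S" using v y SE(4) by blast
    have vyT: "v \<odot>\<^bsub>V\<^esub> y \<in> T" using vyS Cons.prems by blast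
    have carr: "x \<in> carrier V" "v \<odot>\<^bsub>V\<^esub> y \<in> carrier V" "v \<odot>\<^bsub>V\<^esub> w \<in> carrier V" "w' \<in> carrier V"
      "c' \<odot>\<^bsub>V\<^esub> b \<in> carrier V"
      using xT vyT TE(1) v c c' Lsub b by auto
    have "x \<ominus>\<^bsub>V\<^esub> (v \<odot>\<^bsub>V\<^esub> y) = w' \<ominus>\<^bsub>V\<^esub> (v \<odot>\<^bsub>V\<^esub> w)"
      unfolding vy c'(1) using carr
      by (simp add: a_minus_def M.minus_add M.a_ac M.r_neg M.r_neg1 M.r_neg2)
    also have "\<dots> \<in> ?L" using submodule_diff[OF L c'(3)] LE(4)[OF v(1) c(3)] by blast
    finally have "x \<ominus>\<^bsub>V\<^esub> (v \<odot>\<^bsub>V\<^esub> y) \<in> T \<inter> ?L"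
      using submodule_diff[OF Cons.prems(3) xT vyT] by blast
    then have "x \<ominus>\<^bsub>V\<^esub> (v \<odot>\<^bsub>V\<^esub> y) \<in> S" using eq by auto
    then have "(x \<ominus>\<^bsub>V\<^esub> (v \<odot>\<^bsub>V\<^esub> y)) \<oplus>\<^bsub>V\<^esub> (v \<odot>\<^bsub>V\<^esub> y) \<in> S" using SE(5) vyS by blast
    moreover have "(x \<ominus>\<^bsub>V\<^esub> (v \<odot>\<^bsub>V\<^esub> y)) \<oplus>\<^bsub>V\<^esub> (v \<odot>\<^bsub>V\<^esub> y) = x"
      using carr by (simp add: a_minus_def M.a_assoc M.l_neg)
    ultimately show "x \<in> S" by simp
  qed
  show ?case
  proof (cases "S \<subseteq> ?L")
    case True
    then show ?thesis using IH Cons.prems(4)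
      by (cases "T \<subseteq> ?L") (auto simp: Int_absorb2)
  next
    case False
    then have "\<not> T \<subseteq> ?L" using Cons.prems by auto
    then show ?thesis using IH False key Cons.prems(4) by auto
  qed
qed

lemma finsum_in_lin_span:
  fixes V :: "('k, 'm) module"
  assumes "module R V" and "distinct bs" and "set bs \<subseteq> carrier V" and "c \<in> set bs \<rightarrow> carrier R"
  shows "(\<Oplus>\<^bsub>V\<^esub>b \<in> set bs. c b \<odot>\<^bsub>V\<^esub> b) \<in> lin_span R V bs"
  using assms(2-)
proof (induction bs)
  case Nil
  interpret module R V by fact
  show ?case by simp
next
  case (Cons b bs)
  interpret module R V by fact
  have "(\<Oplus>\<^bsub>V\<^esub>x \<in> set (b # bs). c x \<odot>\<^bsub>V\<^esub> x) = (c b \<odot>\<^bsub>V\<^esub> b) \<oplus>\<^bsub>V\<^esub> (\<Oplus>\<^bsub>V\<^esub>x \<in> set bs. c x \<odot>\<^bsub>V\<^esub> x)"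
    using Cons.prems by (simp, intro M.finsum_insert) auto
  moreover have "(\<Oplus>\<^bsub>V\<^esub>x \<in> set bs. c x \<odot>\<^bsub>V\<^esub> x) \<in> lin_span R V bs"
    using Cons by auto
  ultimately show ?case using Cons.prems by force
qed

text \<open>The later choices of maximal or minimal subspaces ask of dimension only that it be a
  strictly monotone function into the natural numbers; \<open>span_rank\<close> along a spanning
  list is one.\<close>

lemma finite_dim_rank:
  fixes V :: "('k, 'm) module"
  assumes "field R" and "module R V" and "finite_dim R V"
  obtains rk :: "'m set \<Rightarrow> nat"
  where "\<And>S T. \<lbrakk> submodule S R V; submodule T R V; S \<subset> T \<rbrakk> \<Longrightarrow> rk S < rk T"
proof -
  interpret module R V by fact
  obtain B where B: "finite B" "B \<subseteq> carrier V"
    and sp: "\<And>v. v \<in> carrier V \<Longrightarrow> \<exists>c \<in> B \<rightarrow> carrier R. v = (\<Oplus>\<^bsub>V\<^esub>b \<in> B. c b \<odot>\<^bsub>V\<^esub> b)"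
    using assms(3) unfolding finite_dim_def by blast
  obtain bs where bs: "set bs = B" "distinct bs" using finite_distinct_list[OF B(1)] by blast
  have "carrier V \<subseteq> lin_span R V bs"
    using sp finsum_in_lin_span[OF assms(2) bs(2)] bs B by blast
  then have "span_rank R V bs S < span_rank R V bs T"
    if "submodule S R V" "submodule T R V" "S \<subset> T" for S T
    using span_rank_mono[OF assms(1,2), of bs S T] that bs B submoduleE(1)[OF that(2)] by fastforce
  then show thesis by (rule that)
qed

text \<open>Unlike \<open>span_rank\<close>, the dimension in terms of chains of subspaces does not refer to a
  spanning list, so it can compare the endomorphism spaces of different objects.\<close>

definition submodule_chain :: "('k, 'r) ring_scheme \<Rightarrow> ('k, 'm) module \<Rightarrow> nat \<Rightarrow> (nat \<Rightarrow> 'm set) \<Rightarrow> bool"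
  where "submodule_chain R V n S \<longleftrightarrow> (\<forall>i \<le> n. submodule (S i) R V) \<and> (\<forall>i < n. S i \<subset> S (Suc i))"

definition chain_length :: "('k, 'r) ring_scheme \<Rightarrow> ('k, 'm) module \<Rightarrow> nat"
  where "chain_length R V = (GREATEST n. \<exists>S. submodule_chain R V n S)"

text \<open>The rank grows by at least one per step of a chain, so the rank of the whole space
  bounds the length.\<close>

lemma submodule_chain_bound:
  fixes V :: "('k, 'm) module"
  assumes "field R" and "module R V" and "finite_dim R V"
  obtains N where "\<And>n S. submodule_chain R V n S \<Longrightarrow> n \<le> N"
proof -
  interpret module R V by fact
  obtain rk :: "'m set \<Rightarrow> nat"
    where rk: "\<And>S T. \<lbrakk> submodule S R V; submodule T R V; S \<subset> T \<rbrakk> \<Longrightarrow> rk S < rk T"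
    using finite_dim_rank[OF assms] by blast
  have "n \<le> rk (carrier V)" if ch: "submodule_chain R V n S" for n S
  proof -
    have "i \<le> n \<Longrightarrow> i \<le> rk (S i)" for i
    proof (induction i)
      case (Suc i)
      then have "rk (S i) < rk (S (Suc i))"
        using ch by (intro rk) (auto simp: submodule_chain_def)
      then show ?case using Suc by simp
    qed simp
    then have "n \<le> rk (S n)" by simp
    also have "\<dots> \<le> rk (carrier V)"
    proof (cases "S n = carrier V")
      case False
      have "submodule (S n) R V" using ch by (simp add: submodule_chain_def)
      then show ?thesis using False submoduleE(1)
        by (intro less_imp_le rk carrier_is_submodule) auto
    qed simp
    finally show ?thesis .
  qed
  then show thesis by (rule that)
qed

lemma chain_length_ge:
  fixes V :: "('k, 'm) module"
  assumes "field R" and "module R V" and "finite_dim R V" and "submodule_chain R V n S"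
  shows "n \<le> chain_length R V"
proof -
  obtain N where "\<And>n S. submodule_chain R V n S \<Longrightarrow> n \<le> N"
    using submodule_chain_bound[OF assms(1-3)] by blast
  then show ?thesis
    unfolding chain_length_def using assms(4) by (intro Greatest_le_nat[where b = N]) auto
qed

lemma chain_length_attained:
  fixes V :: "('k, 'm) module"
  assumes "field R" and "module R V" and "finite_dim R V"
  obtains S where "submodule_chain R V (chain_length R V) S"
proof -
  interpret module R V by fact
  obtain N where N: "\<And>n S. submodule_chain R V n S \<Longrightarrow> n \<le> N"
    using submodule_chain_bound[OF assms] by blast
  \<comment> \<open>The chain with the single term \<open>carrier V\<close> shows that lengths exist
    at all, so that the greatest one is attained.\<close>
  have "submodule_chain R V 0 (\<lambda>_. carrier V)"
    using carrier_is_submodule by (simp add: submodule_chain_def)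
  then have "\<exists>n S. submodule_chain R V n S" by blast
  then have "\<exists>S. submodule_chain R V (chain_length R V) S"
    unfolding chain_length_def
    by (rule GreatestI_ex_nat[where b = N]) (use N in blast)
  then show thesis using that by blast
qed

section \<open>Fitting decomposition\<close>

text \<open>The element \<open>f\<close> = (\<open>b \<otimes> q\<close>)^(\<open>n\<close>+1)
  projects onto the part where \<open>b\<close> is invertible, with inverse \<open>c\<close>, and
  \<open>e\<close> = 1 - \<open>f\<close> onto the part where \<open>b\<close> is nilpotent. There 1
  - \<open>b\<close> is invertible by the geometric series, whence the last equation.\<close>

lemma (in ring) fitting:
  assumes b: "b \<in> carrier R" and q: "q \<in> carrier R" and comm: "q \<otimes> b = b \<otimes> q"
    and stable: "b [^] (n::nat) = b [^] Suc n \<otimes> q"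
  obtains e c s where "e \<in> carrier R" "c \<in> carrier R" "s \<in> carrier R" "e \<otimes> e = e"
    "\<one> \<ominus> e = c \<otimes> b" "\<one> \<ominus> e = b \<otimes> c" "e = s \<otimes> (\<one> \<ominus> b)"
proof -
  \<comment> \<open>The exponent is raised by one so that \<open>c\<close> =
    \<open>t\<close>^\<open>n\<close> \<open>q\<close> satisfies \<open>c \<otimes> b = f\<close>
    even for \<open>n\<close> = 0.\<close>
  have stable': "b [^] Suc n = b [^] Suc (Suc n) \<otimes> q"
    using stable b q comm by (simp add: m_assoc) (metis m_assoc m_closed nat_pow_closed)
  define t where "t = b \<otimes> q"
  have t: "t \<in> carrier R" "t \<otimes> b = b \<otimes> t"
    using b q comm by (auto simp: t_def m_assoc)
  have bt: "b [^] Suc n \<otimes> t = b [^] Suc n"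
    using stable' b q by (metis t_def m_assoc nat_pow_Suc nat_pow_closed)
  have bm: "b [^] Suc n \<otimes> t [^] m = b [^] Suc n" for m :: nat
  proof (induction m)
    case (Suc m)
    have "b [^] Suc n \<otimes> t [^] Suc m = (b [^] Suc n \<otimes> t [^] m) \<otimes> t"
      using b t by (simp add: m_assoc)
    then show ?case using Suc bt by simp
  qed (use b in simp)
  define f where "f = t [^] Suc n"
  have f: "f \<in> carrier R" using t by (simp add: f_def)
  have f_eq: "f = q [^] Suc n \<otimes> b [^] Suc n"
    unfolding f_def t_def using b q comm by (metis pow_mult_distrib)
  \<comment> \<open>By \<open>f_eq\<close>, \<open>f\<close> ends in
    \<open>b\<close>^(\<open>n\<close>+1), which by \<open>bm\<close> absorbs every power of
    \<open>t\<close> on its right, in particular \<open>f\<close>.\<close>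
  have f_idem: "f \<otimes> f = f"
    using bm[of "Suc n"] b q f unfolding f_eq
    by (metis f_def f_eq m_assoc nat_pow_closed)
  have bf: "f \<otimes> b [^] Suc n = b [^] Suc n"
  proof -
    have "f \<otimes> b [^] Suc n = b [^] Suc n \<otimes> f"
      unfolding f_def using b t by (metis nat_pow_comm group_commutes_pow nat_pow_closed)
    then show ?thesis using bm[of "Suc n"] by (simp add: f_def)
  qed
  define c where "c = t [^] n \<otimes> q"
  have c: "c \<in> carrier R" using t q by (simp add: c_def)
  have cb: "c \<otimes> b = f"
    using b q t comm by (simp add: c_def f_def t_def m_assoc)
  have bc: "b \<otimes> c = f"
  proof -
    have "b \<otimes> t [^] n = t [^] n \<otimes> b"
      using b t by (metis group_commutes_pow)
    then show ?thesis
      using b q t by (simp add: c_def f_def) (metis m_assoc nat_pow_closed t_def)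
  qed
  \<comment> \<open>Geometric series by induction, through 1 - \<open>b\<close>^(\<open>m\<close>+1)
    = (1 - \<open>b\<close>^\<open>m\<close>) \<open>b\<close> + (1 - \<open>b\<close>).\<close>
  have geo: "\<exists>g \<in> carrier R. \<one> \<ominus> b [^] m = g \<otimes> (\<one> \<ominus> b)" for m :: nat
  proof (induction m)
    case 0
    show ?case using b by (intro bexI[of _ \<zero>]) (auto simp: r_neg a_minus_def)
  next
    case (Suc m)
    then obtain g where g: "g \<in> carrier R" "\<one> \<ominus> b [^] m = g \<otimes> (\<one> \<ominus> b)" by blast
    have "\<one> \<ominus> b [^] Suc m = (\<one> \<ominus> b [^] m) \<otimes> b \<oplus> (\<one> \<ominus> b)"
      using b by (simp add: a_minus_def l_distr l_minus a_ac) (simp add: a_lcomm[of b] r_neg2)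
    also have "\<dots> = g \<otimes> (\<one> \<ominus> b) \<otimes> b \<oplus> (\<one> \<ominus> b)" by (simp add: g)
    also have "\<dots> = (g \<otimes> b \<oplus> \<one>) \<otimes> (\<one> \<ominus> b)"
      using b g(1) by (simp add: a_minus_def l_distr r_distr m_assoc r_minus l_minus minus_add a_ac)
    finally show ?case using b g(1) by (intro bexI[of _ "g \<otimes> b \<oplus> \<one>"]) auto
  qed
  obtain g where g: "g \<in> carrier R" "\<one> \<ominus> b [^] Suc n = g \<otimes> (\<one> \<ominus> b)" using geo by blast
  define e where "e = \<one> \<ominus> f"
  have e: "e \<in> carrier R" using f by (simp add: e_def)
  have fe: "\<one> \<ominus> e = f"
    using f by (simp add: e_def a_minus_def minus_add r_neg flip: a_assoc)
  have "e \<otimes> b [^] Suc n = \<zero>"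
    using bf b f by (simp add: e_def a_minus_def l_distr l_minus r_neg del: nat_pow_Suc)
  then have "e = e \<otimes> (\<one> \<ominus> b [^] Suc n)"
    using e b by (simp add: a_minus_def r_distr r_minus del: nat_pow_Suc)
  then have es: "e = (e \<otimes> g) \<otimes> (\<one> \<ominus> b)"
    using g e b by (simp add: m_assoc)
  have "e \<otimes> e = e"
    using f f_idem by (simp add: e_def a_minus_def l_distr r_distr l_minus r_minus r_neg r_neg2 minus_add minus_minus a_ac)
  then show thesis
    using that[OF e c _ _ _ _ es] e g fe cb bc by simp
qed

section \<open>Linear categories\<close>

context linear_category
begin

section \<open>Composition and addition of morphisms\<close>

abbreviation cmp :: "'m \<Rightarrow> 'm \<Rightarrow> 'm"  (infixr \<open>\<star>\<close> 75)
  where "g \<star> f \<equiv> g \<cdot>\<^bsub>C\<^esub> f"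

abbreviation nul :: "'o \<Rightarrow> 'o \<Rightarrow> 'm"
  where "nul A B \<equiv> \<zero>\<^bsub>Hom C A B\<^esub>"

text \<open>Nearly all rules about a morphism also ask that its source and target be objects;
  bundling the three memberships leaves a single side condition.\<close>

definition arr :: "'o \<Rightarrow> 'o \<Rightarrow> 'm \<Rightarrow> bool"
  where "arr A B f \<longleftrightarrow> A \<in> Obj C \<and> B \<in> Obj C \<and> f \<in> Mor C A B"

lemma arrD: "arr A B f \<Longrightarrow> A \<in> Obj C" "arr A B f \<Longrightarrow> B \<in> Obj C" "arr A B f \<Longrightarrow> f \<in> Mor C A B"
  by (simp_all add: arr_def)

lemma arr_cmp [intro]: "\<lbrakk> arr A B f; arr B D g \<rbrakk> \<Longrightarrow> arr A D (g \<star> f)"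
  using comp_closed by (auto simp: arr_def)

lemma arr_id [simp, intro]: "A \<in> Obj C \<Longrightarrow> arr A A (Idm C A)"
  using id_closed by (auto simp: arr_def)

lemma cmp_assoc: "\<lbrakk> arr A B f; arr B D g; arr D E h \<rbrakk> \<Longrightarrow> (h \<star> g) \<star> f = h \<star> g \<star> f"
  using comp_assoc by (auto simp: arr_def)

lemma cmp_idl [simp]: "arr A B f \<Longrightarrow> Idm C B \<star> f = f"
  using id_left by (auto simp: arr_def)

lemma cmp_idr [simp]: "arr A B f \<Longrightarrow> f \<star> Idm C A = f"
  using id_right by (auto simp: arr_def)

lemma hom_abelian: "\<lbrakk> A \<in> Obj C; B \<in> Obj C \<rbrakk> \<Longrightarrow> abelian_group (Hom C A B)"
  using hom_module module.axioms(2) by blast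

lemma arr_abelian: "arr A B f \<Longrightarrow> abelian_group (Hom C A B)"
  using hom_abelian by (simp add: arr_def)

lemma arr_nul [simp, intro]: "\<lbrakk> A \<in> Obj C; B \<in> Obj C \<rbrakk> \<Longrightarrow> arr A B (nul A B)"
  using hom_abelian abelian_groupE(2) by (auto simp: arr_def)

lemma arr_add [simp, intro]: "\<lbrakk> arr A B f; arr A B g \<rbrakk> \<Longrightarrow> arr A B (f \<oplus>\<^bsub>Hom C A B\<^esub> g)"
  using hom_abelian abelian_groupE(1) by (fastforce simp: arr_def)

lemma arr_uminus [simp, intro]: "arr A B f \<Longrightarrow> arr A B (\<ominus>\<^bsub>Hom C A B\<^esub> f)"
  using abelian_group.a_inv_closed[OF hom_abelian] by (auto simp: arr_def)

lemma arr_minus [simp, intro]: "\<lbrakk> arr A B f; arr A B g \<rbrakk> \<Longrightarrow> arr A B (f \<ominus>\<^bsub>Hom C A B\<^esub> g)"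
  using abelian_group.minus_closed[OF hom_abelian] by (auto simp: arr_def)

lemma cmp_addl:
  "\<lbrakk> arr A B f; arr B D g; arr B D g' \<rbrakk>
    \<Longrightarrow> (g \<oplus>\<^bsub>Hom C B D\<^esub> g') \<star> f = (g \<star> f) \<oplus>\<^bsub>Hom C A D\<^esub> (g' \<star> f)"
  using comp_add_left by (auto simp: arr_def)

lemma cmp_addr:
  "\<lbrakk> arr A B f; arr A B f'; arr B D g \<rbrakk>
    \<Longrightarrow> g \<star> (f \<oplus>\<^bsub>Hom C A B\<^esub> f') = (g \<star> f) \<oplus>\<^bsub>Hom C A D\<^esub> (g \<star> f')"
  using comp_add_right by (auto simp: arr_def)

text \<open>This is how additivity alone yields that composition and, later, \<Sigma> preserve zero
  morphisms.\<close>

lemma add_idem_nul: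
  assumes "arr A B f" and "f \<oplus>\<^bsub>Hom C A B\<^esub> f = f"
  shows "f = nul A B"
proof -
  interpret abelian_group "Hom C A B" using assms(1) by (rule arr_abelian)
  show ?thesis using assms add.r_cancel_one'[of f f] by (simp add: arr_def)
qed

lemma cmp_nulr [simp]:
  assumes "arr B D g" and "A \<in> Obj C"
  shows "g \<star> nul A B = nul A D"
proof -
  have o: "B \<in> Obj C" "D \<in> Obj C" using assms by (auto simp: arr_def)
  interpret abelian_group "Hom C A B" using assms o hom_abelian by blast
  have "g \<star> nul A B = (g \<star> nul A B) \<oplus>\<^bsub>Hom C A D\<^esub> (g \<star> nul A B)"
    using cmp_addr[of A B "nul A B" "nul A B" D g] assms o by simp
  then show ?thesis using add_idem_nul[of A D "g \<star> nul A B"] assms o by force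
qed

lemma cmp_null [simp]:
  assumes "arr A B f" and "D \<in> Obj C"
  shows "nul B D \<star> f = nul A D"
proof -
  have o: "B \<in> Obj C" "A \<in> Obj C" using assms by (auto simp: arr_def)
  interpret abelian_group "Hom C B D" using assms o hom_abelian by blast
  have "nul B D \<star> f = (nul B D \<star> f) \<oplus>\<^bsub>Hom C A D\<^esub> (nul B D \<star> f)"
    using cmp_addl[of A B f D "nul B D" "nul B D"] assms o by simp
  then show ?thesis using add_idem_nul[of A D "nul B D \<star> f"] assms o by force
qed

lemma cmp_id_nul [simp]:
  "A \<in> Obj C \<Longrightarrow> Idm C A \<star> Idm C A = Idm C A"
  "\<lbrakk> A \<in> Obj C; B \<in> Obj C \<rbrakk> \<Longrightarrow> Idm C B \<star> nul A B = nul A B"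
  "\<lbrakk> A \<in> Obj C; B \<in> Obj C \<rbrakk> \<Longrightarrow> nul A B \<star> Idm C A = nul A B"
  "\<lbrakk> A \<in> Obj C; B \<in> Obj C; D \<in> Obj C \<rbrakk> \<Longrightarrow> nul B D \<star> nul A B = nul A D"
  using cmp_idl[OF arr_id] cmp_idl[OF arr_nul] cmp_idr[OF arr_nul] cmp_nulr[OF arr_nul] by blast+

lemma uminus_unique:
  assumes "arr A B f" and "arr A B g" and "g \<oplus>\<^bsub>Hom C A B\<^esub> f = nul A B"
  shows "g = \<ominus>\<^bsub>Hom C A B\<^esub> f"
proof -
  interpret abelian_group "Hom C A B" using assms(1) by (rule arr_abelian)
  show ?thesis using assms minus_equality[of g f] by (simp add: arr_def)
qed

lemma uminus_add_self: "arr A B f \<Longrightarrow> (\<ominus>\<^bsub>Hom C A B\<^esub> f) \<oplus>\<^bsub>Hom C A B\<^esub> f = nul A B"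
  using abelian_group.l_neg[OF arr_abelian, of A B f] by (simp add: arr_def)

lemma cmp_uminusr:
  assumes "arr A B f" and "arr B D g"
  shows "g \<star> (\<ominus>\<^bsub>Hom C A B\<^esub> f) = \<ominus>\<^bsub>Hom C A D\<^esub> (g \<star> f)"
  using assms arrD[OF assms(1)] cmp_addr[of A B "\<ominus>\<^bsub>Hom C A B\<^esub> f" f D g]
  by (intro uminus_unique) (auto simp: uminus_add_self)

lemma cmp_uminusl:
  assumes "arr A B f" and "arr B D g"
  shows "(\<ominus>\<^bsub>Hom C B D\<^esub> g) \<star> f = \<ominus>\<^bsub>Hom C A D\<^esub> (g \<star> f)"
  using assms arrD[OF assms(2)] cmp_addl[of A B f D "\<ominus>\<^bsub>Hom C B D\<^esub> g" g]
  by (intro uminus_unique) (auto simp: uminus_add_self)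

lemma cmp_minusr:
  assumes "arr A B f" and "arr A B f'" and "arr B D g"
  shows "g \<star> (f \<ominus>\<^bsub>Hom C A B\<^esub> f') = (g \<star> f) \<ominus>\<^bsub>Hom C A D\<^esub> (g \<star> f')"
  unfolding a_minus_def using assms cmp_addr[of A B f "\<ominus>\<^bsub>Hom C A B\<^esub> f'" D g]
  by (simp add: cmp_uminusr arr_uminus)

lemma cmp_minusl:
  assumes "arr A B f" and "arr B D g" and "arr B D g'"
  shows "(g \<ominus>\<^bsub>Hom C B D\<^esub> g') \<star> f = (g \<star> f) \<ominus>\<^bsub>Hom C A D\<^esub> (g' \<star> f)"
  unfolding a_minus_def using assms cmp_addl[of A B f D g "\<ominus>\<^bsub>Hom C B D\<^esub> g'"]
  by (simp add: cmp_uminusl arr_uminus)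

lemma uminus_uminus [simp]: "arr A B f \<Longrightarrow> \<ominus>\<^bsub>Hom C A B\<^esub> (\<ominus>\<^bsub>Hom C A B\<^esub> f) = f"
  using abelian_group.minus_minus[OF arr_abelian, of A B f] by (simp add: arr_def)

lemma add_nulr [simp]: "arr A B f \<Longrightarrow> f \<oplus>\<^bsub>Hom C A B\<^esub> nul A B = f"
  using abelian_monoid.r_zero[OF abelian_group.axioms(1)[OF arr_abelian], of A B f] by (simp add: arr_def)

lemma add_null [simp]: "arr A B f \<Longrightarrow> nul A B \<oplus>\<^bsub>Hom C A B\<^esub> f = f"
  using abelian_groupE(5)[OF arr_abelian, of A B f] by (simp add: arr_def)

lemma uminus_nul [simp]:
  "\<lbrakk> A \<in> Obj C; B \<in> Obj C \<rbrakk> \<Longrightarrow> \<ominus>\<^bsub>Hom C A B\<^esub> (nul A B) = nul A B"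
  by (rule sym, rule uminus_unique) auto

lemma minus_nul [simp]: "arr A B f \<Longrightarrow> f \<ominus>\<^bsub>Hom C A B\<^esub> nul A B = f"
  by (auto simp add: a_minus_def arr_def intro: add_nulr[unfolded arr_def])

lemma minus_self [simp]: "arr A B f \<Longrightarrow> f \<ominus>\<^bsub>Hom C A B\<^esub> f = nul A B"
  unfolding a_minus_def using abelian_group.r_neg[OF arr_abelian, of A B f] by (simp add: arr_def)

lemma minus_eq_nul_iff:
  assumes "arr A B f" and "arr A B g"
  shows "f \<ominus>\<^bsub>Hom C A B\<^esub> g = nul A B \<longleftrightarrow> f = g"
proof
  assume "f \<ominus>\<^bsub>Hom C A B\<^esub> g = nul A B"
  then have "f = \<ominus>\<^bsub>Hom C A B\<^esub> (\<ominus>\<^bsub>Hom C A B\<^esub> g)"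
    unfolding a_minus_def using assms by (intro uminus_unique) auto
  then show "f = g" using assms by simp
qed (use assms in simp)

lemma minus_minus_self:
  assumes "arr A B f" and "arr A B g"
  shows "f \<ominus>\<^bsub>Hom C A B\<^esub> (f \<ominus>\<^bsub>Hom C A B\<^esub> g) = g"
proof -
  interpret abelian_group "Hom C A B" using assms(1) by (rule arr_abelian)
  show ?thesis using assms arrD(3)[OF assms(1)] arrD(3)[OF assms(2)]
    by (simp add: a_minus_def minus_add r_neg flip: a_assoc)
qed

lemma minus_add_cancel:
  assumes "arr A B f" and "arr A B g"
  shows "(f \<ominus>\<^bsub>Hom C A B\<^esub> g) \<oplus>\<^bsub>Hom C A B\<^esub> g = f"
proof -
  interpret abelian_group "Hom C A B" using assms(1) by (rule arr_abelian)
  show ?thesis using assms arrD(3)[OF assms(1)] arrD(3)[OF assms(2)]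
    by (simp add: a_minus_def l_neg a_assoc)
qed

section \<open>Isomorphisms, zero objects and direct sums\<close>

lemma is_isoI:
  "\<lbrakk> arr A B f; arr B A g; g \<star> f = Idm C A; f \<star> g = Idm C B \<rbrakk> \<Longrightarrow> is_iso C A B f"
  by (auto simp: is_iso_def arr_def)

lemma split_mono_iff:
  "arr A B f \<Longrightarrow> split_mono C A B f \<longleftrightarrow> (\<exists>r. arr B A r \<and> r \<star> f = Idm C A)"
  by (auto simp: split_mono_def arr_def)

lemma split_epi_iff:
  "arr A B f \<Longrightarrow> split_epi C A B f \<longleftrightarrow> (\<exists>s. arr B A s \<and> f \<star> s = Idm C B)"
  by (auto simp: split_epi_def arr_def)

lemma zero_object_arr_from: "\<lbrakk> zero_object C Z; arr Z A f \<rbrakk> \<Longrightarrow> f = nul Z A"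
  by (auto simp: zero_object_def arr_def)

lemma zero_objectI:
  assumes "Z \<in> Obj C" and "Idm C Z = nul Z Z"
  shows "zero_object C Z"
proof -
  have "f = nul Z A" if "arr Z A f" for A f
    using cmp_idr[OF that] cmp_nulr[OF that] assms by simp
  moreover have "f = nul A Z" if "arr A Z f" for A f
    using cmp_idl[OF that] cmp_null[OF that] assms by simp
  ultimately show ?thesis
    using assms arr_nul unfolding zero_object_def arr_def by blast
qed

lemma direct_sumD:
  assumes "direct_sum C A B S i j p q"
  shows "arr A S i" "arr B S j" "arr S A p" "arr S B q" "p \<star> i = Idm C A" "q \<star> j = Idm C B"
    "p \<star> j = nul B A" "q \<star> i = nul A B" "(i \<star> p) \<oplus>\<^bsub>Hom C S S\<^esub> (j \<star> q) = Idm C S"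
  using assms by (auto simp: direct_sum_def arr_def)

lemma direct_sumI:
  assumes "arr A S i" "arr B S j" "arr S A p" "arr S B q" "p \<star> i = Idm C A" "q \<star> j = Idm C B"
    "p \<star> j = nul B A" "q \<star> i = nul A B" "(i \<star> p) \<oplus>\<^bsub>Hom C S S\<^esub> (j \<star> q) = Idm C S"
  shows "direct_sum C A B S i j p q"
  using assms by (auto simp: direct_sum_def arr_def)

text \<open>The decomposition used in those places of an angle from which nothing is split
  off.\<close>

lemma direct_sum_zero_object:
  assumes "A \<in> Obj C" and "zero_object C Z"
  shows "direct_sum C A Z A (Idm C A) (nul Z A) (Idm C A) (nul A Z)"
proof -
  have Z: "Z \<in> Obj C" using assms by (simp add: zero_object_def)
  then have "Idm C Z = nul Z Z" using assms zero_object_arr_from arr_id by blast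
  then show ?thesis using assms(1) Z by (intro direct_sumI) auto
qed

text \<open>Both \<open>e\<close> and its complement split, and their orthogonality passes to the
  summands. The image of the complement comes first, being the summand that is kept when the image
  of \<open>e\<close> is discarded.\<close>

lemma direct_sum_of_idempotent:
  assumes "split_idempotents C" and e: "arr A A e" "e \<star> e = e"
  obtains A' Z i j p q where "direct_sum C A' Z A i j p q" "i \<star> p = Idm C A \<ominus>\<^bsub>Hom C A A\<^esub> e" "j \<star> q = e"
proof -
  have A: "A \<in> Obj C" using e arrD by blast
  define f where "f = Idm C A \<ominus>\<^bsub>Hom C A A\<^esub> e"
  have f: "arr A A f" using A e by (auto simp: f_def)
  have ef: "e \<star> f = nul A A" using A e by (simp add: f_def cmp_minusr)
  have fe: "f \<star> e = nul A A" using A e by (simp add: f_def cmp_minusl)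
  have ff: "f \<star> f = f"
    using cmp_minusl[OF f arr_id[OF A] e(1)] f ef by (simp flip: f_def)
  have ef1: "f \<oplus>\<^bsub>Hom C A A\<^esub> e = Idm C A" using A e minus_add_cancel by (simp add: f_def)
  have "\<exists>B r s. arr A B r \<and> arr B A s \<and> s \<star> r = x \<and> r \<star> s = Idm C B" if "arr A A x" "x \<star> x = x" for x
    using assms(1) that A unfolding split_idempotents_def arr_def by blast
  from this[OF e] this[OF f ff] obtain Z q j A' p i where
    q: "arr A Z q" "arr Z A j" "j \<star> q = e" "q \<star> j = Idm C Z" and
    p: "arr A A' p" "arr A' A i" "i \<star> p = f" "p \<star> i = Idm C A'" by blast
  have o: "A' \<in> Obj C" "Z \<in> Obj C" using p q arrD by blast+
  have pf: "p \<star> f = p" and fi: "f \<star> i = i" and qe: "q \<star> e = q" and ej: "e \<star> j = j"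
    using cmp_assoc[OF p(1) p(2) p(1)] cmp_assoc[OF p(2) p(1) p(2)]
      cmp_assoc[OF q(1) q(2) q(1)] cmp_assoc[OF q(2) q(1) q(2)] p q by simp_all
  \<comment> \<open>\<open>p \<star> j\<close> = \<open>p \<star> f \<star> e \<star> j\<close>, and
    \<open>f \<star> e\<close> is zero; symmetrically for \<open>q \<star> i\<close>.\<close>
  have pj: "p \<star> j = nul Z A'"
    using cmp_assoc[OF q(2) e(1) f] cmp_assoc[OF q(2) f p(1)] cmp_assoc[OF q(2) e(1) p(1)]
      cmp_assoc[OF e(1) f p(1)] p q o A pf ej fe by simp
  have qi: "q \<star> i = nul A' Z"
    using cmp_assoc[OF p(2) f e(1)] cmp_assoc[OF p(2) e(1) q(1)] cmp_assoc[OF p(2) f q(1)]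
      cmp_assoc[OF f e(1) q(1)] p q o A qe fi ef by simp
  have "direct_sum C A' Z A i j p q"
    using p q pj qi ef1 by (intro direct_sumI) auto
  then show thesis using that p q by (simp add: f_def)
qed

section \<open>Endomorphism rings and their dimension\<close>

definition end_ring :: "'o \<Rightarrow> 'm ring"
  where "end_ring A = \<lparr>carrier = Mor C A A, monoid.mult = (\<lambda>g f. g \<star> f), one = Idm C A,
    zero = nul A A, add = (\<lambda>f g. f \<oplus>\<^bsub>Hom C A A\<^esub> g)\<rparr>"

lemma end_ring_simps [simp]:
  "carrier (end_ring A) = Mor C A A" "g \<otimes>\<^bsub>end_ring A\<^esub> f = g \<star> f" "\<one>\<^bsub>end_ring A\<^esub> = Idm C A"
  "\<zero>\<^bsub>end_ring A\<^esub> = nul A A" "f \<oplus>\<^bsub>end_ring A\<^esub> g = f \<oplus>\<^bsub>Hom C A A\<^esub> g"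
  "f \<ominus>\<^bsub>end_ring A\<^esub> g = f \<ominus>\<^bsub>Hom C A A\<^esub> g"
  by (simp_all add: end_ring_def a_minus_def a_inv_def m_inv_def)

lemma end_ring:
  assumes A: "A \<in> Obj C"
  shows "ring (end_ring A)"
proof -
  show ?thesis
  proof (rule ringI)
    show "abelian_group (end_ring A)"
      using abelian_groupE[OF hom_abelian[OF A A]] by (intro abelian_groupI) auto
    show "monoid (end_ring A)"
      by (rule monoidI) (use A in \<open>auto intro: comp_closed comp_assoc id_left id_right id_closed\<close>)
  qed (use A in \<open>auto intro: comp_add_left comp_add_right\<close>)
qed

text \<open>In a finite-dimensional endomorphism space the descending subspaces \<open>S n\<close>
  become stationary, which provides the stability relation required by
  \<open>fitting\<close>.\<close>

lemma end_fitting: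
  assumes "Hom_finite k C" and "arr A A b"
  obtains e c s where "arr A A e" "arr A A c" "arr A A s" "e \<star> e = e"
    "Idm C A \<ominus>\<^bsub>Hom C A A\<^esub> e = c \<star> b" "Idm C A \<ominus>\<^bsub>Hom C A A\<^esub> e = b \<star> c"
    "e = s \<star> (Idm C A \<ominus>\<^bsub>Hom C A A\<^esub> b)"
proof -
  have A: "A \<in> Obj C" and b: "b \<in> Mor C A A" using assms(2) arrD by blast+
  interpret R: ring "end_ring A" by (rule end_ring[OF A])
  interpret H: module k "Hom C A A" by (rule hom_module[OF A A])
  obtain rk :: "'m set \<Rightarrow> nat" where
    rk: "\<And>S T. \<lbrakk> submodule S k (Hom C A A); submodule T k (Hom C A A); S \<subset> T \<rbrakk> \<Longrightarrow> rk S < rk T"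
    using finite_dim_rank[OF field hom_module[OF A A]] assms(1) A unfolding Hom_finite_def by blast
  define P where "P n = b [^]\<^bsub>end_ring A\<^esub> (n::nat)" for n
  have P: "arr A A (P n)" "P (Suc n) = P n \<star> b" "P 0 = Idm C A" for n
    using R.nat_pow_closed[of b n] b A by (auto simp: P_def arr_def)
  \<comment> \<open>Only elements of the commutant of \<open>b\<close> are multiplied by
    \<open>P n\<close>, so that the \<open>q\<close> obtained from
    \<open>P n \<in> S (Suc n)\<close> commutes with \<open>b\<close>.\<close>
  define S where "S n = {P n \<star> x | x. arr A A x \<and> x \<star> b = b \<star> x}" for n
  have sub: "submodule (S n) k (Hom C A A)" for n
  proof (rule H.submoduleI)
    show "S n \<subseteq> Mor C A A" using P by (auto simp: S_def intro: arrD(3) arr_cmp)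
    show "nul A A \<in> S n" 
      unfolding S_def using A cmp_nulr[OF P(1) A] cmp_nulr[OF assms(2) A] cmp_null[OF assms(2) A]
      by (intro CollectI exI[of _ "nul A A"]) auto
  next
    fix x assume "x \<in> S n"
    then obtain y where y: "x = P n \<star> y" "arr A A y" "y \<star> b = b \<star> y" by (auto simp: S_def)
    then show "\<ominus>\<^bsub>Hom C A A\<^esub> x \<in> S n" 
      unfolding S_def
      using cmp_uminusr[OF y(2) P(1)] cmp_uminusr[OF y(2) assms(2)] cmp_uminusl[OF assms(2) y(2)]
      by (intro CollectI exI[of _ "\<ominus>\<^bsub>Hom C A A\<^esub> y"]) auto
  next
    fix x x' assume "x \<in> S n" "x' \<in> S n"
    then obtain y y' where y: "x = P n \<star> y" "arr A A y" "y \<star> b = b \<star> y"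
      and y': "x' = P n \<star> y'" "arr A A y'" "y' \<star> b = b \<star> y'" by (auto simp: S_def)
    then show "x \<oplus>\<^bsub>Hom C A A\<^esub> x' \<in> S n" 
      unfolding S_def
      using cmp_addr[OF y(2) y'(2) P(1)] cmp_addr[OF y(2) y'(2) assms(2)] cmp_addl[OF assms(2) y(2) y'(2)]
      by (intro CollectI exI[of _ "y \<oplus>\<^bsub>Hom C A A\<^esub> y'"]) auto
  next
    fix a x assume a: "a \<in> carrier k" and "x \<in> S n"
    then obtain y where y: "x = P n \<star> y" "arr A A y" "y \<star> b = b \<star> y" by (auto simp: S_def)
    have "a \<odot>\<^bsub>Hom C A A\<^esub> (P n \<star> y) = P n \<star> (a \<odot>\<^bsub>Hom C A A\<^esub> y)"
      using comp_smult_right[OF A A A a arrD(3)[OF y(2)] arrD(3)[OF P(1)]] by simp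
    moreover have "(a \<odot>\<^bsub>Hom C A A\<^esub> y) \<star> b = b \<star> (a \<odot>\<^bsub>Hom C A A\<^esub> y)"
      using comp_smult_right[OF A A A a arrD(3)[OF y(2)] b]
        comp_smult_left[OF A A A a b arrD(3)[OF y(2)]] y by simp
    ultimately show "a \<odot>\<^bsub>Hom C A A\<^esub> x \<in> S n"
      unfolding S_def using y a A by (auto simp: arr_def)
  qed
  have mono: "S (Suc n) \<subseteq> S n" for n
  proof
    fix x assume "x \<in> S (Suc n)"
    then obtain y where y: "x = (P n \<star> b) \<star> y" "arr A A y" "y \<star> b = b \<star> y"
      by (auto simp: S_def P)
    have "x = P n \<star> (b \<star> y)" using y cmp_assoc[OF y(2) assms(2) P(1)] by simp
    moreover have "(b \<star> y) \<star> b = b \<star> (b \<star> y)"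
      using y cmp_assoc[OF assms(2) y(2) assms(2)] by simp
    ultimately show "x \<in> S n" using y assms(2) unfolding S_def by blast
  qed
  define n where "n = (ARG_MIN (\<lambda>n. rk (S n)) n. True)"
  \<comment> \<open>At an index of minimal rank a further strict descent is impossible.\<close>
  have "rk (S n) \<le> rk (S (Suc n))"
    unfolding n_def by (rule arg_min_nat_le) simp
  then have "S (Suc n) = S n"
    using rk[OF sub sub] mono by (metis leD psubsetI)
  moreover have "P n \<in> S n"
    unfolding S_def using A cmp_idr[OF P(1)] cmp_idr[OF assms(2)] cmp_idl[OF assms(2)]
    by (intro CollectI exI[of _ "Idm C A"]) auto
  ultimately obtain q where q: "arr A A q" "q \<star> b = b \<star> q" "P n = P (Suc n) \<star> q"
    unfolding S_def by blast
  have "b \<in> carrier (end_ring A)" "q \<in> carrier (end_ring A)"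
    "q \<otimes>\<^bsub>end_ring A\<^esub> b = b \<otimes>\<^bsub>end_ring A\<^esub> q"
    "b [^]\<^bsub>end_ring A\<^esub> n = b [^]\<^bsub>end_ring A\<^esub> Suc n \<otimes>\<^bsub>end_ring A\<^esub> q"
    using b q arrD(3) by (simp_all add: P_def)
  then show thesis
    by (rule R.fitting) (rule that, use A in \<open>simp_all add: arr_def\<close>)
qed

definition end_dim :: "'o \<Rightarrow> nat"
  where "end_dim A = chain_length k (Hom C A A)"

text \<open>The map \<open>f\<close> to \<open>i \<star> f \<star> p\<close> embeds the
  endomorphisms of \<open>A\<close> into those of \<open>S\<close> and carries chains of subspaces
  to chains. If the second summand is non-zero, the image misses the identity, so the whole space
  prolongs the chain.\<close>

lemma end_dim_direct_sum:
  assumes fin: "Hom_finite k C" and ds: "direct_sum C A B S i j p q"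
  shows "end_dim A \<le> end_dim S" and "j \<star> q \<noteq> nul S S \<Longrightarrow> end_dim A < end_dim S"
proof -
  note D = direct_sumD[OF ds]
  have A: "A \<in> Obj C" and S: "S \<in> Obj C" and B: "B \<in> Obj C" using D arrD by blast+
  interpret HA: module k "Hom C A A" by (rule hom_module[OF A A])
  interpret HS: module k "Hom C S S" by (rule hom_module[OF S S])
  define t where "t f = i \<star> f \<star> p" for f
  have t: "arr S S (t f)" if "arr A A f" for f using that D by (auto simp: t_def)
  have tinv: "p \<star> t f \<star> i = f" if f: "arr A A f" for f
  proof -
    have "p \<star> t f \<star> i = (p \<star> i) \<star> f \<star> (p \<star> i)"
      unfolding t_def
      using f D(1,3) arr_cmp[OF D(3) f] arr_cmp[OF D(1) D(3)] arr_cmp[OF arr_cmp[OF D(1) D(3)] f]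
      by (simp add: cmp_assoc)
    then show ?thesis using f D(5) by simp
  qed
  have t_inj: "inj_on t (Mor C A A)"
    by (rule inj_on_inverseI[where g = "\<lambda>h. p \<star> h \<star> i"]) (use tinv A in \<open>simp add: arr_def\<close>)
  have t_sub: "submodule (t ` N) k (Hom C S S)" if N: "submodule N k (Hom C A A)" for N
  proof (rule HS.submoduleI)
    note E = HA.submoduleE[OF N]
    have NA: "arr A A f" if "f \<in> N" for f using that E(1) A by (auto simp: arr_def)
    show "t ` N \<subseteq> Mor C S S" using NA t arrD(3) by blast
    have "t (nul A A) = nul S S"
      using cmp_null[OF D(3) A] cmp_nulr[OF D(1) S] by (simp add: t_def)
    then show "nul S S \<in> t ` N" using HA.submodule_zero[OF N] by force
  next
    note E = HA.submoduleE[OF N]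
    have NA: "arr A A f" if "f \<in> N" for f using that E(1) A by (auto simp: arr_def)
    { fix x assume "x \<in> t ` N"
      then obtain f where f: "f \<in> N" "x = t f" by blast
      have "t (\<ominus>\<^bsub>Hom C A A\<^esub> f) = \<ominus>\<^bsub>Hom C S S\<^esub> t f"
        using cmp_uminusl[OF D(3) NA[OF f(1)]] cmp_uminusr[OF arr_cmp[OF D(3) NA[OF f(1)]] D(1)]
        by (simp add: t_def)
      then show "\<ominus>\<^bsub>Hom C S S\<^esub> x \<in> t ` N" using f E(3) by force }
    { fix x y assume "x \<in> t ` N" "y \<in> t ` N"
      then obtain f g where f: "f \<in> N" "x = t f" "g \<in> N" "y = t g" by blast
      have "t (f \<oplus>\<^bsub>Hom C A A\<^esub> g) = t f \<oplus>\<^bsub>Hom C S S\<^esub> t g"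
        using cmp_addl[OF D(3) NA[OF f(1)] NA[OF f(3)]]
          cmp_addr[OF arr_cmp[OF D(3) NA[OF f(1)]] arr_cmp[OF D(3) NA[OF f(3)]] D(1)]
        by (simp add: t_def)
      then show "x \<oplus>\<^bsub>Hom C S S\<^esub> y \<in> t ` N" using f E(5) by force }
    { fix a x assume a: "a \<in> carrier k" and "x \<in> t ` N"
      then obtain f where f: "f \<in> N" "x = t f" by blast
      have "t (a \<odot>\<^bsub>Hom C A A\<^esub> f) = a \<odot>\<^bsub>Hom C S S\<^esub> t f"
        using comp_smult_left[OF S A A a arrD(3)[OF D(3)] arrD(3)[OF NA[OF f(1)]]]
          comp_smult_right[OF S A S a arrD(3)[OF arr_cmp[OF D(3) NA[OF f(1)]]] arrD(3)[OF D(1)]]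
        by (simp add: t_def)
      then show "a \<odot>\<^bsub>Hom C S S\<^esub> x \<in> t ` N" using f E(4)[OF a] by force }
  qed
  have finA: "finite_dim k (Hom C A A)" and finS: "finite_dim k (Hom C S S)"
    using fin A S by (auto simp: Hom_finite_def)
  obtain N where N: "submodule_chain k (Hom C A A) (end_dim A) N"
    unfolding end_dim_def by (rule chain_length_attained[OF field hom_module[OF A A] finA])
  have N_sub: "submodule (N l) k (Hom C A A)" "N l \<subseteq> Mor C A A" if "l \<le> end_dim A" for l
    using N that HA.submoduleE(1) by (auto simp: submodule_chain_def)
  have strict: "t ` N l \<subset> t ` N (Suc l)" if l: "l < end_dim A" for l
  proof -
    have "N l \<subset> N (Suc l)" using N l by (simp add: submodule_chain_def)
    moreover have "N (Suc l) \<subseteq> Mor C A A" using N_sub(2) l by simp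
    ultimately show ?thesis using image_strict_mono[OF inj_on_subset[OF t_inj]] by simp
  qed
  have ch: "submodule_chain k (Hom C S S) (end_dim A) (\<lambda>l. t ` N l)"
    using strict t_sub N_sub by (auto simp: submodule_chain_def)
  show "end_dim A \<le> end_dim S"
    unfolding end_dim_def[of S]
    by (rule chain_length_ge[OF field hom_module[OF S S] finS ch])
  assume nz: "j \<star> q \<noteq> nul S S"
  \<comment> \<open>Every \<open>t f\<close> is annihilated by \<open>q\<close> on the left because
    \<open>q \<star> i\<close> is zero; for the identity this would give \<open>q\<close> =
    0.\<close>
  have "Idm C S \<notin> t ` N (end_dim A)"
  proof
    assume "Idm C S \<in> t ` N (end_dim A)"
    then obtain f where f: "arr A A f" "t f = Idm C S"
      using N_sub(2)[OF order_refl] A by (auto simp: arr_def)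
    have "q = q \<star> t f" using f cmp_idr[OF D(4)] by simp
    also have "\<dots> = (q \<star> i) \<star> f \<star> p" unfolding t_def
      using cmp_assoc[OF arr_cmp[OF D(3) f(1)] D(1) D(4)] by simp
    also have "\<dots> = nul S B" using D(8) cmp_null[OF arr_cmp[OF D(3) f(1)] B] by simp
    finally have "q = nul S B" .
    then show False using nz cmp_nulr[OF D(2) S] by simp
  qed
  then have "t ` N (end_dim A) \<subset> Mor C S S"
    using HS.submoduleE(1)[OF t_sub[OF N_sub(1)[OF order_refl]]] id_closed[OF S] by auto
  then have "submodule_chain k (Hom C S S) (Suc (end_dim A))
      (\<lambda>l. if l \<le> end_dim A then t ` N l else Mor C S S)"
    using ch HS.carrier_is_submodule by (auto simp: submodule_chain_def less_Suc_eq)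
  then have "Suc (end_dim A) \<le> end_dim S"
    unfolding end_dim_def[of S]
    by (rule chain_length_ge[OF field hom_module[OF S S] finS])
  then show "end_dim A < end_dim S" by simp
qed

end

section \<open>Angulated categories\<close>

context angulated_category
begin

notation cmp (infixr \<open>\<star>\<close> 75)

section \<open>The shift as an additive automorphism\<close>

abbreviation sO :: "'o \<Rightarrow> 'o" where "sO \<equiv> shO M"
abbreviation sM :: "'m \<Rightarrow> 'm" where "sM \<equiv> shM M"

lemma sO_closed [simp]: "A \<in> Obj M \<Longrightarrow> sO A \<in> Obj M"
  using sh_obj by (metis bij_betwE)

lemma sO_surj: "B \<in> Obj M \<Longrightarrow> \<exists>A. A \<in> Obj M \<and> sO A = B"
  using sh_obj by (metis bij_betw_imp_surj_on imageE)

lemma arr_sM [intro]: "arr A B f \<Longrightarrow> arr (sO A) (sO B) (sM f)"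
  using sh_mor bij_betwE unfolding arr_def by fastforce

lemma sM_cmp: "\<lbrakk> arr A B f; arr B D g \<rbrakk> \<Longrightarrow> sM (g \<star> f) = sM g \<star> sM f"
  using sh_comp by (auto simp: arr_def)

lemma sM_inj: "\<lbrakk> arr A B f; arr A B g; sM f = sM g \<rbrakk> \<Longrightarrow> f = g"
  using bij_betw_imp_inj_on[OF sh_mor, of A B] unfolding arr_def by (auto dest: inj_onD)

lemma sM_surj:
  assumes "A \<in> Obj M" and "B \<in> Obj M" and "arr (sO A) (sO B) h"
  obtains f where "arr A B f" "sM f = h"
proof -
  have "h \<in> sM ` Mor M A B"
    using bij_betw_imp_surj_on[OF sh_mor[OF assms(1,2)]] assms(3) by (simp add: arr_def)
  then show thesis using that assms(1,2) by (auto simp: arr_def)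
qed

lemma sM_nul [simp]:
  assumes "A \<in> Obj M" and "B \<in> Obj M"
  shows "sM (nul A B) = nul (sO A) (sO B)"
proof (rule add_idem_nul)
  show "arr (sO A) (sO B) (sM (nul A B))" using assms by auto
  show "sM (nul A B) \<oplus>\<^bsub>Hom M (sO A) (sO B)\<^esub> sM (nul A B) = sM (nul A B)"
    using sh_add[OF assms, of "nul A B" "nul A B"] assms arr_nul[OF assms] by (simp add: arr_def)
qed

lemma sM_eq_nul_iff:
  assumes "arr A B f"
  shows "sM f = nul (sO A) (sO B) \<longleftrightarrow> f = nul A B"
  using assms sM_inj[OF assms arr_nul] by (auto simp: arr_def)

lemma sM_add:
  "\<lbrakk> arr A B f; arr A B g \<rbrakk> \<Longrightarrow> sM (f \<oplus>\<^bsub>Hom M A B\<^esub> g) = sM f \<oplus>\<^bsub>Hom M (sO A) (sO B)\<^esub> sM g"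
  using sh_add by (auto simp: arr_def)

lemma zero_object_sO: "zero_object M Z \<Longrightarrow> zero_object M (sO Z)"
  using zero_objectI[of "sO Z"] zero_object_arr_from[of Z Z "Idm M Z"] sh_id[of Z]
  by (simp add: zero_object_def)

lemma direct_sum_sM:
  assumes "direct_sum M A B S i j p q"
  shows "direct_sum M (sO A) (sO B) (sO S) (sM i) (sM j) (sM p) (sM q)"
proof -
  note D = direct_sumD[OF assms]
  have o: "A \<in> Obj M" "B \<in> Obj M" "S \<in> Obj M" using D arrD by blast+
  show ?thesis
    using D o sM_add[OF arr_cmp[OF D(3,1)] arr_cmp[OF D(4,2)]]
      sM_cmp[OF D(1,3)] sM_cmp[OF D(2,4)] sM_cmp[OF D(1,4)] sM_cmp[OF D(2,3)]
      sM_cmp[OF D(3,1)] sM_cmp[OF D(4,2)]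
    by (intro direct_sumI) (auto simp: sh_id)
qed

text \<open>Signs enter only through rotations and never matter, so they are not tracked.\<close>

definition pm :: "'o \<Rightarrow> 'o \<Rightarrow> 'm \<Rightarrow> 'm \<Rightarrow> bool"
  where "pm A B f g \<longleftrightarrow> g = f \<or> g = \<ominus>\<^bsub>Hom M A B\<^esub> f"

lemma pm_arr: "\<lbrakk> pm A B f g; arr A B f \<rbrakk> \<Longrightarrow> arr A B g"
  by (auto simp: pm_def)

lemma pm_cmpl:
  assumes "pm B D g g'" and "arr A B f" and "arr B D g"
  obtains f' where "arr A B f'" "g' \<star> f = g \<star> f'"
  using assms cmp_uminusl[OF assms(2,3)] cmp_uminusr[OF assms(2,3)]
  unfolding pm_def by (metis arr_uminus)

lemma pm_cmpr:
  assumes "pm A B f f'" and "arr A B f" and "arr B D g"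
  obtains g' where "arr B D g'" "g \<star> f' = g' \<star> f"
  using assms cmp_uminusl[OF assms(2,3)] cmp_uminusr[OF assms(2,3)]
  unfolding pm_def by (metis arr_uminus)

lemma pm_cmpl_nul:
  assumes "pm B D g g'" and "arr A B f" and "arr B D g" and "g' \<star> f = nul A D"
  shows "g \<star> f = nul A D"
  using assms cmp_uminusl[OF assms(2,3)] uminus_uminus[OF arr_cmp[OF assms(2,3)]] arrD
  unfolding pm_def by (metis uminus_nul)

section \<open>Sequences, angles and rotation\<close>

abbreviation angle :: "(nat \<Rightarrow> 'o) \<Rightarrow> (nat \<Rightarrow> 'm) \<Rightarrow> bool"
  where "angle Xs \<xi> \<equiv> (Xs, \<xi>) \<in> angles M"

lemma is_seqI:
  assumes "\<And>i. i \<le> d \<Longrightarrow> arr (Xs i) (Xs (Suc i)) (\<xi> i)" and "arr (Xs (d + 1)) (sO (Xs 0)) (\<xi> (d + 1))"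
  shows "is_seq d M Xs \<xi>"
  unfolding is_seq_def
proof (intro allI impI)
  fix i assume "i \<le> d + 1"
  then consider "i \<le> d" | "i = d + 1" by linarith
  then show "Xs i \<in> Obj M \<and> \<xi> i \<in> Mor M (Xs i) (ext d sO Xs (i + 1))"
    using assms by cases (auto simp: ext_def arr_def)
qed

lemma is_seq_obj: "is_seq d M Xs \<xi> \<Longrightarrow> i \<le> d + 1 \<Longrightarrow> Xs i \<in> Obj M"
  by (simp add: is_seq_def)

lemma is_seq_arr:
  assumes "is_seq d M Xs \<xi>" and "i \<le> d"
  shows "arr (Xs i) (Xs (Suc i)) (\<xi> i)"
  using assms(1)[unfolded is_seq_def, rule_format, of i] is_seq_obj[OF assms(1), of "Suc i"] assms(2)
  by (simp add: ext_def arr_def)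

lemma is_seq_arr_last:
  assumes "is_seq d M Xs \<xi>"
  shows "arr (Xs (d + 1)) (sO (Xs 0)) (\<xi> (d + 1))"
  using assms(1)[unfolded is_seq_def, rule_format, of "d + 1"] is_seq_obj[OF assms(1), of 0]
  by (simp add: ext_def arr_def)

lemmas angle_obj = is_seq_obj[OF angle_is_seq]
lemmas angle_arr = is_seq_arr[OF angle_is_seq]
lemmas angle_arr_last = is_seq_arr_last[OF angle_is_seq]

lemma seq_mor_arr: "seq_mor d M Xs \<xi> Ys \<eta> \<phi> \<Longrightarrow> is_seq d M Xs \<xi> \<Longrightarrow> is_seq d M Ys \<eta> \<Longrightarrow>
    i \<le> d + 1 \<Longrightarrow> arr (Xs i) (Ys i) (\<phi> i)"
  by (simp add: seq_mor_def arr_def is_seq_obj)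

lemma seq_mor_square: "seq_mor d M Xs \<xi> Ys \<eta> \<phi> \<Longrightarrow> i \<le> d \<Longrightarrow> \<phi> (Suc i) \<star> \<xi> i = \<eta> i \<star> \<phi> i"
  unfolding seq_mor_def ext_def by (auto dest!: spec[of _ i])

lemma seq_mor_square_last:
  "seq_mor d M Xs \<xi> Ys \<eta> \<phi> \<Longrightarrow> sM (\<phi> 0) \<star> \<xi> (d + 1) = \<eta> (d + 1) \<star> \<phi> (d + 1)"
  unfolding seq_mor_def ext_def by (auto dest!: spec[of _ "d + 1"])

lemma rot_simps:
  "i \<le> d \<Longrightarrow> rot_obj d M Xs i = Xs (Suc i)" "rot_obj d M Xs (d + 1) = sO (Xs 0)"
  "i \<le> d \<Longrightarrow> rot_mor d M Xs \<xi> i = \<xi> (Suc i)"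
  "pm (sO (Xs 0)) (sO (Xs 1)) (sM (\<xi> 0)) (rot_mor d M Xs \<xi> (d + 1))"
  by (simp_all add: rot_obj_def rot_mor_def ext_def pm_def)

lemma rot_is_seq:
  assumes "is_seq d M Xs \<xi>"
  shows "is_seq d M (rot_obj d M Xs) (rot_mor d M Xs \<xi>)"
proof (rule is_seqI)
  fix i assume "i \<le> d"
  then show "arr (rot_obj d M Xs i) (rot_obj d M Xs (Suc i)) (rot_mor d M Xs \<xi> i)"
    using is_seq_arr[OF assms, of "Suc i"] is_seq_arr_last[OF assms]
    by (cases "i = d") (auto simp: rot_simps rot_simps[simplified])
next
  show "arr (rot_obj d M Xs (d + 1)) (sO (rot_obj d M Xs 0)) (rot_mor d M Xs \<xi> (d + 1))"
    using pm_arr[OF rot_simps(4)[of Xs \<xi>]] arr_sM[OF is_seq_arr[OF assms, of 0]]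
      rot_simps(2)[of Xs] rot_simps(1)[OF le0, of Xs] by simp
qed

lemma angle_rot: "angle Xs \<xi> \<Longrightarrow> angle (rot_obj d M Xs) (rot_mor d M Xs \<xi>)"
  using N2 angle_is_seq by blast

text \<open>The terms before place \<open>n\<close> reappear, shifted, from place
  \<open>d + 2 - n\<close> on. Statements about consecutive morphisms thus reduce to the beginning
  of an angle; \<open>n \<le> d + 1\<close> stays below a full turn.\<close>

lemma angle_rotate:
  assumes "angle Xs \<xi>" and "n \<le> d + 1"
  shows "\<exists>Ys \<eta>. angle Ys \<eta> \<and> (\<forall>j. n + j \<le> d + 1 \<longrightarrow> Ys j = Xs (n + j) \<and> \<eta> j = \<xi> (n + j)) \<and>
    (\<forall>j<n. Ys (d + 2 - n + j) = sO (Xs j) \<and>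
      pm (sO (Xs j)) (sO (Xs (Suc j))) (sM (\<xi> j)) (\<eta> (d + 2 - n + j)))"
  using assms(2)
proof (induction n)
  case 0
  show ?case using assms(1) by (intro exI[of _ Xs] exI[of _ \<xi>]) simp
  next
  case (Suc n)
  then obtain Ys \<eta> where Y: "angle Ys \<eta>"
    and Y1: "\<And>j. n + j \<le> d + 1 \<Longrightarrow> Ys j = Xs (n + j) \<and> \<eta> j = \<xi> (n + j)"
    and Y2: "\<And>j. j < n \<Longrightarrow> Ys (d + 2 - n + j) = sO (Xs j) \<and>
      pm (sO (Xs j)) (sO (Xs (Suc j))) (sM (\<xi> j)) (\<eta> (d + 2 - n + j))"
    by auto
  let ?Z = "rot_obj d M Ys" and ?z = "rot_mor d M Ys \<eta>"
  have n: "n \<le> d" using Suc by simp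
  have "?Z j = Xs (Suc n + j) \<and> ?z j = \<xi> (Suc n + j)" if "Suc n + j \<le> d + 1" for j
    using Y1[of "Suc j"] that by (simp add: rot_simps)
  moreover have "?Z (d + 2 - Suc n + j) = sO (Xs j) \<and>
      pm (sO (Xs j)) (sO (Xs (Suc j))) (sM (\<xi> j)) (?z (d + 2 - Suc n + j))" if j: "j < Suc n" for j
  proof (cases "j = n")
    case True
    then have "d + 2 - Suc n + j = d + 1" using n by simp
    then show ?thesis
      using True Y1[of 0] Y1[of 1] n rot_simps(4)[of Ys \<eta>] rot_simps(2)[of Ys] by simp
  next
    case False
    then have "d + 2 - Suc n + j \<le> d" "d + 2 - n + j = Suc (d + 2 - Suc n + j)" "j < n"
      using n j by auto
    then show ?thesis using Y2[of j] by (simp only: rot_simps)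
  qed
  ultimately show ?case using angle_rot[OF Y] by blast
qed

section \<open>Trivial angles and the exactness they force\<close>

definition triv_obj :: "'o \<Rightarrow> 'o \<Rightarrow> nat \<Rightarrow> nat \<Rightarrow> 'o"
  where "triv_obj A Z n i = (if i = n \<or> i = Suc n then A else Z)"

text \<open>The identity of \<open>A\<close> from place \<open>n\<close> to place
  \<open>n + 1\<close>, padded by \<open>Z\<close>. The target is read off from \<open>ext\<close>
  because the last morphism ends at the shift of place 0.\<close>

definition triv_mor :: "'o \<Rightarrow> 'o \<Rightarrow> nat \<Rightarrow> nat \<Rightarrow> 'm"
  where "triv_mor A Z n i = (if i = n then Idm M A
    else nul (triv_obj A Z n i) (ext d sO (triv_obj A Z n) (i + 1)))"

lemma triv_is_seq:
  assumes "A \<in> Obj M" and "Z \<in> Obj M" and "n \<le> d"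
  shows "is_seq d M (triv_obj A Z n) (triv_mor A Z n)"
  using assms by (intro is_seqI) (auto simp: triv_obj_def triv_mor_def ext_def)

lemma triv_angle0:
  assumes "A \<in> Obj M" and "zero_object M Z"
  shows "angle (triv_obj A Z 0) (triv_mor A Z 0)"
proof (rule N1_trivial)
  show "is_seq d M (triv_obj A Z 0) (triv_mor A Z 0)"
    using assms triv_is_seq by (simp add: zero_object_def)
qed (use assms in \<open>auto simp: triv_obj_def triv_mor_def\<close>)

text \<open>Its left rotation has the identity in front and zero objects behind, the last one being
  the shift of \<open>Z\<close>; N2 is then used backwards.\<close>

lemma triv_angle1:
  assumes "A \<in> Obj M" and "zero_object M Z"
  shows "angle (triv_obj A Z 1) (triv_mor A Z 1)"
proof -
  have seq: "is_seq d M (triv_obj A Z 1) (triv_mor A Z 1)"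
    using assms triv_is_seq d_pos by (simp add: zero_object_def)
  have "angle (rot_obj d M (triv_obj A Z 1)) (rot_mor d M (triv_obj A Z 1) (triv_mor A Z 1))"
  proof (rule N1_trivial)
    show "\<forall>i\<in>{2..d + 1}. zero_object M (rot_obj d M (triv_obj A Z 1) i)"
    proof
      fix i assume "i \<in> {2..d + 1}"
      then consider "2 \<le> i" "i \<le> d" | "i = d + 1" by force
      then show "zero_object M (rot_obj d M (triv_obj A Z 1) i)"
        using assms(2) zero_object_sO
        by cases (auto simp: rot_simps rot_simps[simplified] triv_obj_def)
    qed
  qed (use rot_is_seq[OF seq] d_pos in \<open>simp_all add: rot_simps triv_obj_def triv_mor_def\<close>)
  then show ?thesis using N2[OF seq] by blast
qed

text \<open>The trivial angle on \<open>Xs 0\<close> maps to the given one by the identity and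
  \<open>\<xi> 0\<close>. In place 2 the completed morphism starts at a zero object, so
  \<open>\<xi> 1 \<star> \<xi> 0\<close> factors through zero.\<close>

lemma angle_cmp_first:
  assumes "angle Xs \<xi>"
  shows "\<xi> 1 \<star> \<xi> 0 = nul (Xs 0) (Xs 2)"
proof -
  obtain Z where Z: "zero_object M Z" using ex_zero_object by blast
  then have Z': "Z \<in> Obj M" by (simp add: zero_object_def)
  let ?T = "triv_obj (Xs 0) Z 0" and ?t = "triv_mor (Xs 0) Z 0"
  have o: "Xs 0 \<in> Obj M" "Xs 2 \<in> Obj M" using angle_obj[OF assms] d_pos by simp_all
  have \<xi>0: "arr (Xs 0) (Xs 1) (\<xi> 0)" using angle_arr[OF assms, of 0] by simp
  have T: "angle ?T ?t" by (rule triv_angle0[OF o(1) Z])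
  have t: "?T 0 = Xs 0" "?T 1 = Xs 0" "?t 0 = Idm M (Xs 0)" "?T 2 = Z" "?t 1 = nul (Xs 0) Z"
    using d_pos by (auto simp: triv_obj_def triv_mor_def ext_def)
  obtain \<phi> where \<phi>: "\<phi> 1 = \<xi> 0" "seq_mor d M ?T ?t Xs \<xi> \<phi>"
    using N3[OF T assms, of "Idm M (Xs 0)" "\<xi> 0"] \<xi>0 o t by (auto simp: arr_def id_closed)
  have "arr Z (Xs 2) (\<phi> 2)"
    using seq_mor_arr[OF \<phi>(2) angle_is_seq[OF T] angle_is_seq[OF assms], of 2] t d_pos by simp
  then show ?thesis
    using seq_mor_square[OF \<phi>(2) d_pos] \<phi>(1) t o cmp_nulr[of Z "Xs 2" "\<phi> 2" "Xs 0"]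
    by (simp add: numeral_2_eq_2)
qed

lemma angle_cmp:
  assumes "angle Xs \<xi>" and "i < d"
  shows "\<xi> (Suc i) \<star> \<xi> i = nul (Xs i) (Xs (Suc (Suc i)))"
proof -
  obtain Ys \<eta> where "angle Ys \<eta>" "\<And>j. i + j \<le> d + 1 \<Longrightarrow> Ys j = Xs (i + j) \<and> \<eta> j = \<xi> (i + j)"
    using angle_rotate[OF assms(1), of i] assms(2) by (metis less_imp_le_nat trans_le_add1)
  then show ?thesis using angle_cmp_first[of Ys \<eta>] assms(2) by simp
qed

text \<open>The last composition is treated apart from \<open>angle_cmp\<close> because it ends at
  \<open>sO (Xs 0)\<close>, which is not a term of the indexed family.\<close>

lemma angle_cmp_d:
  assumes "angle Xs \<xi>"
  shows "\<xi> (d + 1) \<star> \<xi> d = nul (Xs d) (sO (Xs 0))"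
proof -
  obtain Ys \<eta> where Y: "angle Ys \<eta>" "\<And>j. d + j \<le> d + 1 \<Longrightarrow> Ys j = Xs (d + j) \<and> \<eta> j = \<xi> (d + j)"
    "\<And>j. j < d \<Longrightarrow> Ys (d + 2 - d + j) = sO (Xs j)"
    using angle_rotate[OF assms, of d] by auto
  then show ?thesis using angle_cmp_first[OF Y(1)] Y(2)[of 0] Y(2)[of 1] Y(3)[of 0] d_pos by simp
qed

text \<open>The last morphism is written as \<open>\<Sigma>\<^sup>d \<delta>\<close>, so that all objects stay in reach of the
  \<open>k\<close>-bilinear composition; \<open>\<Sigma>\<^sup>d\<close> itself is only additive.\<close>

definition tail :: "(nat \<Rightarrow> 'o) \<Rightarrow> (nat \<Rightarrow> 'm) \<Rightarrow> 'o \<Rightarrow> 'm \<Rightarrow> bool"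
  where "tail Xs \<xi> W \<delta> \<longleftrightarrow> angle Xs \<xi> \<and> sO W = Xs (d + 1) \<and> arr W (Xs 0) \<delta> \<and> sM \<delta> = \<xi> (d + 1)"

lemma ex_tail:
  assumes "angle Xs \<xi>" and "W \<in> Obj M" and "sO W = Xs (d + 1)"
  obtains \<delta> where "tail Xs \<xi> W \<delta>"
proof -
  have "arr (sO W) (sO (Xs 0)) (\<xi> (d + 1))" using angle_arr_last[OF assms(1)] assms(3) by simp
  then obtain \<delta> where "arr W (Xs 0) \<delta>" "sM \<delta> = \<xi> (d + 1)"
    by (rule sM_surj[OF assms(2) angle_obj[OF assms(1) le0]])
  then show thesis using that assms unfolding tail_def by blast
qed

lemma rotate_to_last:
  assumes "angle Xs \<xi>"
  obtains Ys \<eta> where "angle Ys \<eta>" "Ys 0 = Xs (d + 1)" "\<eta> 0 = \<xi> (d + 1)"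
    "Ys 1 = sO (Xs 0)" "pm (sO (Xs 0)) (sO (Xs 1)) (sM (\<xi> 0)) (\<eta> 1)" "Ys 2 = sO (Xs 1)"
proof -
  obtain Ys \<eta> where Y: "angle Ys \<eta>" "\<And>j. d + 1 + j \<le> d + 1 \<Longrightarrow> Ys j = Xs (d + 1 + j) \<and> \<eta> j = \<xi> (d + 1 + j)"
    "\<And>j. j < d + 1 \<Longrightarrow> Ys (d + 2 - (d + 1) + j) = sO (Xs j) \<and>
      pm (sO (Xs j)) (sO (Xs (Suc j))) (sM (\<xi> j)) (\<eta> (d + 2 - (d + 1) + j))"
    using angle_rotate[OF assms order_refl] by blast
  show thesis using Y(2)[of 0] Y(3)[of 0] Y(3)[of 1] d_pos
    by (intro that[OF Y(1)]) (auto simp: numeral_2_eq_2)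
qed

text \<open>After \<open>d + 1\<close> rotations this is, up to sign and shift, the first
  composition of an angle; \<Sigma> is faithful.\<close>

lemma tail_cmp:
  assumes "tail Xs \<xi> W \<delta>"
  shows "\<xi> 0 \<star> \<delta> = nul W (Xs 1)"
proof -
  have X: "angle Xs \<xi>" and W: "sO W = Xs (d + 1)" and \<delta>: "arr W (Xs 0) \<delta>" "sM \<delta> = \<xi> (d + 1)"
    using assms by (auto simp: tail_def)
  have \<xi>0: "arr (Xs 0) (Xs 1) (\<xi> 0)" using angle_arr[OF X, of 0] by simp
  obtain Ys \<eta> where Y: "angle Ys \<eta>" "Ys 0 = Xs (d + 1)" "\<eta> 0 = \<xi> (d + 1)"
    "Ys 1 = sO (Xs 0)" "pm (sO (Xs 0)) (sO (Xs 1)) (sM (\<xi> 0)) (\<eta> 1)" "Ys 2 = sO (Xs 1)"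
    by (rule rotate_to_last[OF X])
  have "\<eta> 1 \<star> sM \<delta> = nul (sO W) (sO (Xs 1))" using angle_cmp_first[OF Y(1)] Y W \<delta> by simp
  then have "sM (\<xi> 0) \<star> sM \<delta> = nul (sO W) (sO (Xs 1))"
    using pm_cmpl_nul[OF Y(5) arr_sM[OF \<delta>(1)] arr_sM[OF \<xi>0]] by simp
  then show ?thesis using sM_eq_nul_iff[OF arr_cmp[OF \<delta>(1) \<xi>0]] sM_cmp[OF \<delta>(1) \<xi>0] by simp
qed

text \<open>Rotate until \<open>sM \<delta>\<close> is the first morphism. The hypothesis gives a
  commutative square to the trivial angle on \<open>sO A\<close> in places 1 and 2; its completion
  at place 2 extends \<open>sM f\<close> along \<open>sM (\<xi> 0)\<close> up to sign, and \<Sigma>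
  is full and faithful.\<close>

lemma weak_cokernel:
  assumes "tail Xs \<xi> W \<delta>" and f: "arr (Xs 0) A f" and "f \<star> \<delta> = nul W A"
  obtains g where "arr (Xs 1) A g" "f = g \<star> \<xi> 0"
proof -
  have X: "angle Xs \<xi>" and W: "sO W = Xs (d + 1)" and \<delta>: "arr W (Xs 0) \<delta>" "sM \<delta> = \<xi> (d + 1)"
    using assms by (auto simp: tail_def)
  have \<xi>0: "arr (Xs 0) (Xs 1) (\<xi> 0)" using angle_arr[OF X, of 0] by simp
  have A: "A \<in> Obj M" and WO: "W \<in> Obj M" and X1: "Xs 1 \<in> Obj M" using f \<delta> \<xi>0 arrD by blast+
  obtain Z where Z: "zero_object M Z" using ex_zero_object by blast
  then have Z': "Z \<in> Obj M" by (simp add: zero_object_def)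
  let ?T = "triv_obj (sO A) Z 1" and ?t = "triv_mor (sO A) Z 1"
  have T: "angle ?T ?t" using triv_angle1[OF _ Z] A by simp
  have t: "?T 0 = Z" "?T 1 = sO A" "?T 2 = sO A" "?t 0 = nul Z (sO A)" "?t 1 = Idm M (sO A)"
    by (auto simp: triv_obj_def triv_mor_def ext_def)
  obtain Ys \<eta> where Y: "angle Ys \<eta>" "Ys 0 = Xs (d + 1)" "\<eta> 0 = \<xi> (d + 1)"
    "Ys 1 = sO (Xs 0)" "pm (sO (Xs 0)) (sO (Xs 1)) (sM (\<xi> 0)) (\<eta> 1)" "Ys 2 = sO (Xs 1)"
    by (rule rotate_to_last[OF X])
  have sf: "arr (sO (Xs 0)) (sO A) (sM f)" by (rule arr_sM[OF f])
  have s\<xi>0: "arr (sO (Xs 0)) (sO (Xs 1)) (sM (\<xi> 0))" by (rule arr_sM[OF \<xi>0])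
  have "sM f \<star> \<eta> 0 = ?t 0 \<star> nul (sO W) Z"
    using sM_cmp[OF \<delta>(1) f] assms(3) Y(3) \<delta>(2) t Z' A WO by simp
  then obtain \<phi> where \<phi>: "\<phi> 1 = sM f" "seq_mor d M Ys \<eta> ?T ?t \<phi>"
    using N3[OF Y(1) T, of "nul (sO W) Z" "sM f"] sf Y W t Z' WO arr_nul[of "sO W" Z] angle_obj[OF X, of "d + 1"]
    by (auto simp: arr_def)
  have \<phi>2: "arr (sO (Xs 1)) (sO A) (\<phi> 2)"
    using seq_mor_arr[OF \<phi>(2) angle_is_seq[OF Y(1)] angle_is_seq[OF T], of 2] t Y d_pos by simp
  have "\<phi> 2 \<star> \<eta> 1 = sM f"
    using seq_mor_square[OF \<phi>(2) d_pos] \<phi>(1) t sf by (simp add: numeral_2_eq_2)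
  then obtain h where h: "arr (sO (Xs 1)) (sO A) h" "sM f = h \<star> sM (\<xi> 0)"
    using pm_cmpr[OF Y(5) s\<xi>0 \<phi>2] by metis
  obtain g where g: "arr (Xs 1) A g" "sM g = h" by (rule sM_surj[OF X1 A h(1)])
  show thesis
    using that[OF g(1)] sM_inj[OF f arr_cmp[OF \<xi>0 g(1)]] sM_cmp[OF \<xi>0 g(1)] g h by simp
qed

text \<open>The rotated trivial angle on \<open>Y\<close> reads \<open>Y\<close>, zeros,
  \<open>sO Y\<close>. It maps to the given angle with \<open>g\<close> in place 0, and the last
  square expresses \<open>sM g\<close> through \<open>\<xi> (d + 1)\<close>.\<close>

lemma weak_kernel_last:
  assumes "angle Xs \<xi>" and g: "arr Y (Xs 0) g" and "\<xi> 0 \<star> g = nul Y (Xs 1)"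
  obtains h where "arr (sO Y) (Xs (d + 1)) h" "sM g = \<xi> (d + 1) \<star> h"
proof -
  have \<xi>0: "arr (Xs 0) (Xs 1) (\<xi> 0)" using angle_arr[OF assms(1), of 0] by simp
  have Y: "Y \<in> Obj M" and X1: "Xs 1 \<in> Obj M" using g \<xi>0 arrD by blast+
  obtain Z where Z: "zero_object M Z" using ex_zero_object by blast
  then have Z': "Z \<in> Obj M" by (simp add: zero_object_def)
  let ?T = "triv_obj Y Z 0" and ?t = "triv_mor Y Z 0"
  have T: "angle (rot_obj d M ?T) (rot_mor d M ?T ?t)" (is "angle ?R ?r")
    by (rule angle_rot[OF triv_angle0[OF Y Z]])
  have r: "?R 0 = Y" "?R 1 = Z" "?R (d + 1) = sO Y" "?r 0 = nul Y Z"
    "pm (sO Y) (sO Y) (Idm M (sO Y)) (?r (d + 1))"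
    using d_pos Y rot_simps(2)[of ?T] rot_simps(4)[of ?T ?t]
    by (auto simp: rot_simps triv_obj_def triv_mor_def ext_def sh_id)
  have sq: "nul Z (Xs 1) \<star> ?r 0 = \<xi> 0 \<star> g"
    using assms(3) r Z' X1 Y by simp
  obtain \<phi> where \<phi>: "\<phi> 0 = g" "seq_mor d M ?R ?r Xs \<xi> \<phi>"
    using N3[OF T assms(1), of g "nul Z (Xs 1)"] sq g Z' X1 r arr_nul[of Z "Xs 1"]
    by (auto simp: arr_def)
  have \<phi>': "arr (sO Y) (Xs (d + 1)) (\<phi> (d + 1))"
    using seq_mor_arr[OF \<phi>(2) angle_is_seq[OF T] angle_is_seq[OF assms(1)], of "d + 1"] r by simp
  have sg: "arr (sO Y) (sO (Xs 0)) (sM g)" by (rule arr_sM[OF g])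
  have last: "arr (Xs (d + 1)) (sO (Xs 0)) (\<xi> (d + 1))" by (rule angle_arr_last[OF assms(1)])
  have "sM g \<star> ?r (d + 1) = \<xi> (d + 1) \<star> \<phi> (d + 1)"
    using seq_mor_square_last[OF \<phi>(2)] \<phi>(1) by simp
  \<comment> \<open>Rotation may have put a sign on this identity; then the negative of
    \<open>\<phi> (d + 1)\<close> is the factor.\<close>
  moreover have "?r (d + 1) = Idm M (sO Y) \<or> ?r (d + 1) = \<ominus>\<^bsub>Hom M (sO Y) (sO Y)\<^esub> Idm M (sO Y)"
    using r(5) unfolding pm_def by simp
  moreover have "sM g \<star> (\<ominus>\<^bsub>Hom M (sO Y) (sO Y)\<^esub> Idm M (sO Y)) = \<ominus>\<^bsub>Hom M (sO Y) (sO (Xs 0))\<^esub> sM g"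
    using cmp_uminusr[OF arr_id sg] Y sg by simp
  moreover have "\<xi> (d + 1) \<star> (\<ominus>\<^bsub>Hom M (sO Y) (Xs (d + 1))\<^esub> \<phi> (d + 1))
      = \<ominus>\<^bsub>Hom M (sO Y) (sO (Xs 0))\<^esub> (\<xi> (d + 1) \<star> \<phi> (d + 1))"
    by (rule cmp_uminusr[OF \<phi>' last])
  ultimately show thesis
    using that[OF \<phi>'] that[OF arr_uminus[OF \<phi>']] sg uminus_uminus[OF sg] cmp_idr[OF sg] by metis
qed

text \<open>Rotating \<open>Suc i\<close> times makes \<open>\<xi> (Suc i)\<close> first and the
  shift of \<open>\<xi> i\<close> last, up to sign. Quantifying over the target \<open>D\<close>
  covers at once the inner places and \<open>i = d\<close>, where the target is
  \<open>sO (Xs 0)\<close>.\<close>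

lemma weak_kernel:
  assumes "angle Xs \<xi>" and "i \<le> d" and g: "arr Y (Xs (Suc i)) g"
    and nul: "\<And>D. arr (Xs (Suc i)) D (\<xi> (Suc i)) \<Longrightarrow> \<xi> (Suc i) \<star> g = nul Y D"
  obtains h where "arr Y (Xs i) h" "g = \<xi> i \<star> h"
proof -
  obtain Ys \<eta> where Y: "angle Ys \<eta>"
    "\<And>j. Suc i + j \<le> d + 1 \<Longrightarrow> Ys j = Xs (Suc i + j) \<and> \<eta> j = \<xi> (Suc i + j)"
    "\<And>j. j < Suc i \<Longrightarrow> Ys (d + 2 - Suc i + j) = sO (Xs j) \<and>
      pm (sO (Xs j)) (sO (Xs (Suc j))) (sM (\<xi> j)) (\<eta> (d + 2 - Suc i + j))"
    using angle_rotate[OF assms(1), of "Suc i"] assms(2) by auto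
  have idx: "d + 2 - Suc i + i = d + 1" using assms(2) by simp
  have Y0: "Ys 0 = Xs (Suc i)" "\<eta> 0 = \<xi> (Suc i)" using Y(2)[of 0] assms(2) by simp_all
  have Yl: "Ys (d + 1) = sO (Xs i)" "pm (sO (Xs i)) (sO (Xs (Suc i))) (sM (\<xi> i)) (\<eta> (d + 1))"
    using Y(3)[of i] unfolding idx by simp_all
  have \<xi>i: "arr (Xs i) (Xs (Suc i)) (\<xi> i)" by (rule angle_arr[OF assms(1,2)])
  have YO: "Y \<in> Obj M" using g arrD by blast
  have "\<eta> 0 \<star> g = nul Y (Ys 1)"
    using nul angle_arr[OF Y(1), of 0] Y0 by simp
  then obtain h where h: "arr (sO Y) (sO (Xs i)) h" "sM g = \<eta> (d + 1) \<star> h"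
    using weak_kernel_last[OF Y(1), of Y g] g Y0 Yl by metis
  obtain h' where h': "arr (sO Y) (sO (Xs i)) h'" "sM g = sM (\<xi> i) \<star> h'"
    using pm_cmpl[OF Yl(2) h(1) arr_sM[OF \<xi>i]] h(2) by metis
  obtain g' where g': "arr Y (Xs i) g'" "sM g' = h'"
    using sM_surj[OF YO _ h'(1)] \<xi>i arrD by blast
  show thesis
    using that[OF g'(1)] sM_inj[OF g arr_cmp[OF g'(1) \<xi>i]] sM_cmp[OF g'(1) \<xi>i] g' h' by simp
qed

lemma weak_kernel_d:
  assumes "angle Xs \<xi>" and "arr Y (Xs (d + 1)) g" and "\<xi> (d + 1) \<star> g = nul Y (sO (Xs 0))"
  obtains h where "arr Y (Xs d) h" "g = \<xi> d \<star> h"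
proof (rule weak_kernel[OF assms(1), of d Y g])
  fix D assume "arr (Xs (Suc d)) D (\<xi> (Suc d))"
  then have "D = sO (Xs 0)"
    using angle_arr_last[OF assms(1)] hom_disjoint unfolding arr_def by fastforce
  then show "\<xi> (Suc d) \<star> g = nul Y D" using assms by simp
qed (use assms that in auto)

text \<open>Complete \<open>f\<close> to an angle and take the next morphism. The property recorded
  for \<open>c\<close> is that \<open>f\<close> is a weak kernel of it.\<close>

lemma ex_weak_cokernel:
  assumes f: "arr A B f"
  obtains D c where "arr B D c" "c \<star> f = nul A D"
    "\<And>Y g. \<lbrakk> arr Y B g; c \<star> g = nul Y D \<rbrakk> \<Longrightarrow> \<exists>h. arr Y A h \<and> g = f \<star> h"
proof -
  obtain Xs \<xi> where X: "angle Xs \<xi>" "Xs 0 = A" "Xs 1 = B" "\<xi> 0 = f"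
    using N1_complete f by (metis arr_def)
  have \<xi>1: "arr B (Xs 2) (\<xi> 1)" using angle_arr[OF X(1) d_pos] X by (simp add: numeral_2_eq_2)
  show thesis
  proof (rule that[OF \<xi>1])
    show "\<xi> 1 \<star> f = nul A (Xs 2)" using angle_cmp_first[OF X(1)] X by simp
    fix Y g assume g: "arr Y B g" "\<xi> 1 \<star> g = nul Y (Xs 2)"
    have "\<xi> (Suc 0) \<star> g = nul Y D" if "arr (Xs (Suc 0)) D (\<xi> (Suc 0))" for D
    proof -
      have "D = Xs 2" using that \<xi>1 X hom_disjoint unfolding arr_def by fastforce
      then show ?thesis using g by simp
    qed
    then show "\<exists>h. arr Y A h \<and> g = f \<star> h"
      using weak_kernel[OF X(1), of 0 Y g] g X by (metis One_nat_def le0)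
  qed
qed

text \<open>After \<open>d\<close> rotations \<open>\<xi> d\<close> and \<open>\<eta> d\<close> come
  first; the square formed by \<open>\<theta>\<close> and the identity of \<open>sO W\<close> is
  completed, and place 2 holds the shift of \<open>t\<close>.\<close>

lemma tail_morphism:
  assumes "tail Xs \<xi> W \<delta>" and "tail Ys \<eta> W \<epsilon>" and \<theta>: "arr (Xs d) (Ys d) \<theta>" and "\<eta> d \<star> \<theta> = \<xi> d"
  obtains t where "arr (Xs 0) (Ys 0) t" "t \<star> \<delta> = \<epsilon>"
proof -
  have X: "angle Xs \<xi>" and W: "sO W = Xs (d + 1)" and \<delta>: "arr W (Xs 0) \<delta>" "sM \<delta> = \<xi> (d + 1)"
    using assms by (auto simp: tail_def)
  have Y: "angle Ys \<eta>" and W': "sO W = Ys (d + 1)" and \<epsilon>: "arr W (Ys 0) \<epsilon>" "sM \<epsilon> = \<eta> (d + 1)"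
    using assms by (auto simp: tail_def)
  have WO: "W \<in> Obj M" using \<delta> arrD by blast
  obtain X' \<xi>' where X': "angle X' \<xi>'" "\<And>j. d + j \<le> d + 1 \<Longrightarrow> X' j = Xs (d + j) \<and> \<xi>' j = \<xi> (d + j)"
    "\<And>j. j < d \<Longrightarrow> X' (d + 2 - d + j) = sO (Xs j)"
    using angle_rotate[OF X, of d] by auto
  obtain Y' \<eta>' where Y': "angle Y' \<eta>'" "\<And>j. d + j \<le> d + 1 \<Longrightarrow> Y' j = Ys (d + j) \<and> \<eta>' j = \<eta> (d + j)"
    "\<And>j. j < d \<Longrightarrow> Y' (d + 2 - d + j) = sO (Ys j)"
    using angle_rotate[OF Y, of d] by auto
  have x: "X' 0 = Xs d" "X' 1 = sO W" "X' 2 = sO (Xs 0)" "\<xi>' 0 = \<xi> d" "\<xi>' 1 = sM \<delta>"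
    using X'(2)[of 0] X'(2)[of 1] X'(3)[of 0] d_pos W \<delta> by simp_all
  have y: "Y' 0 = Ys d" "Y' 1 = sO W" "Y' 2 = sO (Ys 0)" "\<eta>' 0 = \<eta> d" "\<eta>' 1 = sM \<epsilon>"
    using Y'(2)[of 0] Y'(2)[of 1] Y'(3)[of 0] d_pos W' \<epsilon> by simp_all
  have \<xi>d: "arr (Xs d) (sO W) (\<xi> d)" using angle_arr[OF X, of d] W by simp
  obtain \<phi> where \<phi>: "\<phi> 1 = Idm M (sO W)" "seq_mor d M X' \<xi>' Y' \<eta>' \<phi>"
    using N3[OF X'(1) Y'(1), of \<theta> "Idm M (sO W)"] x y \<theta> assms(4) cmp_idl[OF \<xi>d] id_closed WO
    by (auto simp: arr_def)
  have \<phi>2: "arr (sO (Xs 0)) (sO (Ys 0)) (\<phi> 2)"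
    using seq_mor_arr[OF \<phi>(2) angle_is_seq[OF X'(1)] angle_is_seq[OF Y'(1)], of 2] x y d_pos by simp
  obtain t where t: "arr (Xs 0) (Ys 0) t" "sM t = \<phi> 2"
    using sM_surj[OF _ _ \<phi>2] \<delta> \<epsilon> arrD by blast
  have "\<phi> 2 \<star> sM \<delta> = sM \<epsilon>"
    using seq_mor_square[OF \<phi>(2) d_pos] \<phi>(1) x y cmp_idr[OF arr_sM[OF \<epsilon>(1)]]
    by (simp add: numeral_2_eq_2)
  then show thesis
    using that[OF t(1)] sM_inj[OF arr_cmp[OF \<delta>(1) t(1)] \<epsilon>(1)] sM_cmp[OF \<delta>(1) t(1)] t by simp
qed

end

section \<open>Splitting off trivial summands\<close>

text \<open>Compatibility with the projections onto the first summands makes \<sigma> diagonal: the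
  entries \<open>p' \<star> \<sigma> \<star> j\<close> and
  \<open>q' \<star> \<sigma> \<star> i\<close> vanish.\<close>

lemma (in linear_category) square_split:
  assumes D: "direct_sum C A B S i j p q" and D': "direct_sum C A' B' S' i' j' p' q'"
    and \<sigma>: "arr S S' \<sigma>" and comm: "\<sigma> \<star> i \<star> p = (i' \<star> p') \<star> \<sigma>"
  shows "arr A A' (p' \<star> \<sigma> \<star> i)" "arr B B' (q' \<star> \<sigma> \<star> j)"
    "i' \<star> p' \<star> \<sigma> \<star> i = \<sigma> \<star> i" "j' \<star> q' \<star> \<sigma> \<star> j = \<sigma> \<star> j"
    "p' \<star> \<sigma> = (p' \<star> \<sigma> \<star> i) \<star> p" "q' \<star> \<sigma> = (q' \<star> \<sigma> \<star> j) \<star> q"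
proof -
  note D = direct_sumD[OF D] and D' = direct_sumD[OF D']
  have o: "A \<in> Obj C" "B \<in> Obj C" "S \<in> Obj C" "A' \<in> Obj C" "B' \<in> Obj C" "S' \<in> Obj C"
    using D D' arrD by blast+
  have \<sigma>i: "arr A S' (\<sigma> \<star> i)" and \<sigma>j: "arr B S' (\<sigma> \<star> j)" using \<sigma> D by blast+
  have p\<sigma>: "arr S A' (p' \<star> \<sigma>)" and q\<sigma>: "arr S B' (q' \<star> \<sigma>)" using \<sigma> D' by blast+
  show pi: "arr A A' (p' \<star> \<sigma> \<star> i)" and qj: "arr B B' (q' \<star> \<sigma> \<star> j)"
    using \<sigma>i \<sigma>j D' by blast+
  have ip: "arr S S (i \<star> p)" and jq: "arr S S (j \<star> q)" using D by blast+
  have ip': "arr S' S' (i' \<star> p')" and jq': "arr S' S' (j' \<star> q')" using D' by blast+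
  have comm': "(\<sigma> \<star> i) \<star> p = i' \<star> p' \<star> \<sigma>"
    using comm cmp_assoc[OF D(3) D(1) \<sigma>] cmp_assoc[OF \<sigma> D'(3) D'(1)] by simp
  have "(p' \<star> \<sigma>) \<star> j = nul B A'"
  proof -
    have "p' \<star> \<sigma> = (p' \<star> i') \<star> p' \<star> \<sigma>" using D' p\<sigma> by simp
    also have "\<dots> = p' \<star> (\<sigma> \<star> i) \<star> p"
      using cmp_assoc[OF p\<sigma> D'(1) D'(3)] comm' by simp
    also have "\<dots> = (p' \<star> \<sigma> \<star> i) \<star> p" using cmp_assoc[OF D(3) \<sigma>i D'(3)] by simp
    finally show ?thesis using cmp_assoc[OF D(2) D(3) pi] D(7) pi o by simp
  qed
  then have p\<sigma>j: "p' \<star> \<sigma> \<star> j = nul B A'" using cmp_assoc[OF D(2) \<sigma> D'(3)] by simp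
  have q\<sigma>i: "q' \<star> \<sigma> \<star> i = nul A B'"
  proof -
    have "\<sigma> \<star> i = ((\<sigma> \<star> i) \<star> p) \<star> i" using cmp_assoc[OF D(1) D(3) \<sigma>i] D \<sigma>i by simp
    also have "\<dots> = i' \<star> (p' \<star> \<sigma>) \<star> i" using comm' cmp_assoc[OF D(1) p\<sigma> D'(1)] by simp
    finally have "q' \<star> \<sigma> \<star> i = (q' \<star> i') \<star> (p' \<star> \<sigma>) \<star> i"
      using cmp_assoc[OF arr_cmp[OF D(1) p\<sigma>] D'(1) D'(4)] by simp
    then show ?thesis using D'(8) cmp_null[OF arr_cmp[OF D(1) p\<sigma>] o(5)] by simp
  qed
  have expand: "f = ((i' \<star> p') \<star> f) \<oplus>\<^bsub>Hom C Y S'\<^esub> ((j' \<star> q') \<star> f)" if f: "arr Y S' f" for Y f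
    using cmp_addl[OF f ip' jq'] D'(9) f by simp
  show "i' \<star> p' \<star> \<sigma> \<star> i = \<sigma> \<star> i"
    using expand[OF \<sigma>i] cmp_assoc[OF \<sigma>i D'(3) D'(1)] cmp_assoc[OF \<sigma>i D'(4) D'(2)] q\<sigma>i
      cmp_nulr[OF D'(2) o(1)] arr_cmp[OF pi D'(1)] by simp
  show "j' \<star> q' \<star> \<sigma> \<star> j = \<sigma> \<star> j"
    using expand[OF \<sigma>j] cmp_assoc[OF \<sigma>j D'(3) D'(1)] cmp_assoc[OF \<sigma>j D'(4) D'(2)] p\<sigma>j
      cmp_nulr[OF D'(1) o(2)] arr_cmp[OF qj D'(2)] by simp
  have expand': "f = ((f \<star> i) \<star> p) \<oplus>\<^bsub>Hom C S Y\<^esub> ((f \<star> j) \<star> q)" if f: "arr S Y f" for Y f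
    using cmp_addr[OF ip jq f] D(9) f cmp_assoc[OF D(3) D(1) f] cmp_assoc[OF D(4) D(2) f] by simp
  show "p' \<star> \<sigma> = (p' \<star> \<sigma> \<star> i) \<star> p"
    using expand'[OF p\<sigma>] cmp_assoc[OF D(1) \<sigma> D'(3)] cmp_assoc[OF D(2) \<sigma> D'(3)] p\<sigma>j
      cmp_null[OF D(4) o(4)] arr_cmp[OF D(3) pi] by simp
  show "q' \<star> \<sigma> = (q' \<star> \<sigma> \<star> j) \<star> q"
    using expand'[OF q\<sigma>] cmp_assoc[OF D(1) \<sigma> D'(4)] cmp_assoc[OF D(2) \<sigma> D'(4)] q\<sigma>i
      cmp_null[OF D(3) o(5)] arr_cmp[OF D(4) qj] by simp
qed

context angulated_category
begin

lemma is_seq_ext_arr: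
  assumes "is_seq d M Xs \<xi>" and "i \<le> d + 1"
  shows "arr (Xs i) (ext d sO Xs (i + 1)) (\<xi> i)"
  using is_seq_arr[OF assms(1), of i] is_seq_arr_last[OF assms(1)] assms(2)
  by (cases "i = d + 1") (auto simp: ext_def)

text \<open>All morphisms being diagonal by \<open>square_split\<close>, the angle is a direct sum
  of two sequences, and N1 passes to the first.\<close>

lemma angle_summand:
  assumes S: "angle S \<sigma>"
    and ds: "\<And>i. i \<le> d + 1 \<Longrightarrow> direct_sum M (A i) (B i) (S i) (\<iota> i) (\<kappa> i) (\<pi> i) (\<rho> i)"
    and comm: "\<And>i. i \<le> d \<Longrightarrow> \<sigma> i \<star> \<iota> i \<star> \<pi> i = (\<iota> (Suc i) \<star> \<pi> (Suc i)) \<star> \<sigma> i"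
    and last: "\<sigma> (d + 1) \<star> \<iota> (d + 1) \<star> \<pi> (d + 1) = (sM (\<iota> 0) \<star> sM (\<pi> 0)) \<star> \<sigma> (d + 1)"
  shows "angle A (\<lambda>i. ext d sM \<pi> (i + 1) \<star> \<sigma> i \<star> \<iota> i)"
proof -
  \<comment> \<open>Past the last place the target is decomposed by the shift of the decomposition
    at place 0.\<close>
  have ds': "direct_sum M (ext d sO A (i + 1)) (ext d sO B (i + 1)) (ext d sO S (i + 1))
      (ext d sM \<iota> (i + 1)) (ext d sM \<kappa> (i + 1)) (ext d sM \<pi> (i + 1)) (ext d sM \<rho> (i + 1))"
    if "i \<le> d + 1" for i
    using that ds[of "i + 1"] direct_sum_sM[OF ds[of 0]] by (cases "i = d + 1") (auto simp: ext_def)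
  have comm': "\<sigma> i \<star> \<iota> i \<star> \<pi> i = (ext d sM \<iota> (i + 1) \<star> ext d sM \<pi> (i + 1)) \<star> \<sigma> i"
    if "i \<le> d + 1" for i
    using that comm[of i] last by (cases "i = d + 1") (auto simp: ext_def)
  note sp = square_split[OF ds ds' is_seq_ext_arr[OF angle_is_seq[OF S]] comm']
  let ?\<alpha> = "\<lambda>i. ext d sM \<pi> (i + 1) \<star> \<sigma> i \<star> \<iota> i" and ?\<beta> = "\<lambda>i. ext d sM \<rho> (i + 1) \<star> \<sigma> i \<star> \<kappa> i"
  have "seq_direct_sum d M A ?\<alpha> B ?\<beta> S \<sigma>"
    unfolding seq_direct_sum_def
  proof (intro conjI exI)
    show "is_seq d M A ?\<alpha>" "is_seq d M B ?\<beta>"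
      unfolding is_seq_def using sp(1,2) by (auto simp: arr_def)
    show "is_seq d M S \<sigma>" by (rule angle_is_seq[OF S])
    show "\<forall>i\<le>d + 1. direct_sum M (A i) (B i) (S i) (\<iota> i) (\<kappa> i) (\<pi> i) (\<rho> i)"
      using ds by blast
    show "seq_mor d M A ?\<alpha> S \<sigma> \<iota>" "seq_mor d M B ?\<beta> S \<sigma> \<kappa>"
      "seq_mor d M S \<sigma> A ?\<alpha> \<pi>" "seq_mor d M S \<sigma> B ?\<beta> \<rho>"
      unfolding seq_mor_def using sp(3-6) direct_sumD(1-4)[OF ds] by (auto simp: arr_def)
  qed
  then show ?thesis using N1_summand S by blast
qed

text \<open>If \<open>\<xi>\<^sup>n\<close> is not in the radical, Fitting's lemma yields an idempotent \<open>e \<noteq> 0\<close> that factors as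
  \<open>e = t \<xi>\<^sup>n\<close>; the images of \<open>e\<close> and of \<open>\<xi>\<^sup>n t\<close> form a trivial direct summand of the angle.\<close>

lemma split_off:
  assumes fin: "Hom_finite k M" and si: "split_idempotents M" and sub: "additive_subcategory M \<W>"
    and X: "angle Xs \<xi>" and XW: "\<And>i. i \<le> d + 1 \<Longrightarrow> Xs i \<in> \<W>"
    and n: "1 \<le> n" "n < d" and nrad: "\<xi> n \<notin> radical (full_sub M \<W>) (Xs n) (Xs (n + 1))"
  obtains Ys \<eta> where "angle Ys \<eta>" "\<And>i. i \<le> d + 1 \<Longrightarrow> Ys i \<in> \<W>" "Ys 0 = Xs 0"
    "Ys (d + 1) = Xs (d + 1)" "\<eta> (d + 1) = \<xi> (d + 1)"
    "(\<Sum>i = 1..d. end_dim (Ys i)) < (\<Sum>i = 1..d. end_dim (Xs i))"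
proof -
  let ?A = "Xs n" and ?B = "Xs (Suc n)"
  have x: "arr ?A ?B (\<xi> n)" using angle_arr[OF X, of n] n by simp
  have A: "?A \<in> Obj M" and B: "?B \<in> Obj M" using x arrD by blast+
  obtain g where g: "arr ?B ?A g" and ni: "\<not> is_iso M ?A ?A (Idm M ?A \<ominus>\<^bsub>Hom M ?A ?A\<^esub> (g \<star> \<xi> n))"
    using nrad XW[of n] XW[of "Suc n"] n x A B
    by (auto simp: radical_def full_sub_def is_iso_def arr_def)
  have gx: "arr ?A ?A (g \<star> \<xi> n)" using g x by blast
  define b where "b = Idm M ?A \<ominus>\<^bsub>Hom M ?A ?A\<^esub> (g \<star> \<xi> n)"
  have b: "arr ?A ?A b" using A gx by (simp add: b_def)
  obtain e c s where e: "arr ?A ?A e" "arr ?A ?A c" "arr ?A ?A s" "e \<star> e = e"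
    and ec: "Idm M ?A \<ominus>\<^bsub>Hom M ?A ?A\<^esub> e = c \<star> b" "Idm M ?A \<ominus>\<^bsub>Hom M ?A ?A\<^esub> e = b \<star> c"
    and es: "e = s \<star> (Idm M ?A \<ominus>\<^bsub>Hom M ?A ?A\<^esub> b)"
    by (rule end_fitting[OF fin b])
  \<comment> \<open>Were \<open>e\<close> zero, \<open>c\<close> would be an inverse of
    \<open>b\<close>, which is not invertible by the choice of \<open>g\<close>.\<close>
  have e_nz: "e \<noteq> nul ?A ?A"
  proof
    assume "e = nul ?A ?A"
    then have "c \<star> b = Idm M ?A" "b \<star> c = Idm M ?A" using ec minus_nul[OF arr_id[OF A]] by simp_all
    then show False using is_isoI[OF b e(2)] ni by (simp add: b_def)
  qed
  \<comment> \<open>The factor \<open>e\<close> on the left secures \<open>e \<star> t = t\<close>,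
    which makes \<open>e'\<close> idempotent.\<close>
  define t where "t = (e \<star> s) \<star> g"
  have eS: "arr ?A ?A (e \<star> s)" using e by blast
  have t: "arr ?B ?A t" using eS g unfolding t_def by blast
  have tx: "t \<star> \<xi> n = e"
  proof -
    have "Idm M ?A \<ominus>\<^bsub>Hom M ?A ?A\<^esub> b = g \<star> \<xi> n"
      unfolding b_def by (rule minus_minus_self[OF arr_id[OF A] gx])
    then have "e = s \<star> g \<star> \<xi> n" using es by simp
    then have "e \<star> e = e \<star> s \<star> g \<star> \<xi> n" by simp
    also have "\<dots> = t \<star> \<xi> n"
      unfolding t_def using cmp_assoc[OF gx e(3) e(1)] cmp_assoc[OF x g eS] by simp
    finally show ?thesis using e(4) by simp
  qed
  have et: "e \<star> t = t"
    unfolding t_def using cmp_assoc[OF g eS e(1)] cmp_assoc[OF e(3) e(1) e(1)] e(4) by simp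
  define e' where "e' = \<xi> n \<star> t"
  have e': "arr ?B ?B e'" using x t unfolding e'_def by blast
  have e'x: "e' \<star> \<xi> n = \<xi> n \<star> e" unfolding e'_def using cmp_assoc[OF x t x] tx by simp
  have e'e': "e' \<star> e' = e'"
    using cmp_assoc[OF t x e'] e'x cmp_assoc[OF t e(1) x] et by (simp add: e'_def)
  obtain A1 Z1 i1 j1 p1 q1 where D1: "direct_sum M A1 Z1 ?A i1 j1 p1 q1"
    "i1 \<star> p1 = Idm M ?A \<ominus>\<^bsub>Hom M ?A ?A\<^esub> e" "j1 \<star> q1 = e"
    by (rule direct_sum_of_idempotent[OF si e(1,4)])
  obtain A2 Z2 i2 j2 p2 q2 where D2: "direct_sum M A2 Z2 ?B i2 j2 p2 q2"
    "i2 \<star> p2 = Idm M ?B \<ominus>\<^bsub>Hom M ?B ?B\<^esub> e'" "j2 \<star> q2 = e'"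
    by (rule direct_sum_of_idempotent[OF si e' e'e'])
  obtain Z where Z: "zero_object M Z" using ex_zero_object by blast
  \<comment> \<open>Only places \<open>n\<close> and \<open>Suc n\<close> are genuinely decomposed;
    elsewhere the second summand is a zero object.\<close>
  define A' where "A' = Xs(n := A1, Suc n := A2)"
  define B' where "B' = (\<lambda>_::nat. Z)(n := Z1, Suc n := Z2)"
  define \<iota> where "\<iota> = (\<lambda>i. Idm M (Xs i))(n := i1, Suc n := i2)"
  define \<kappa> where "\<kappa> = (\<lambda>i. nul Z (Xs i))(n := j1, Suc n := j2)"
  define \<pi> where "\<pi> = (\<lambda>i. Idm M (Xs i))(n := p1, Suc n := p2)"
  define \<rho> where "\<rho> = (\<lambda>i. nul (Xs i) Z)(n := q1, Suc n := q2)"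
  have XO: "Xs i \<in> Obj M" if "i \<le> d + 1" for i using angle_obj[OF X that] .
  have ds: "direct_sum M (A' i) (B' i) (Xs i) (\<iota> i) (\<kappa> i) (\<pi> i) (\<rho> i)" if "i \<le> d + 1" for i
    using D1(1) D2(1) direct_sum_zero_object[OF XO[OF that] Z]
    by (simp add: A'_def B'_def \<iota>_def \<kappa>_def \<pi>_def \<rho>_def)
  have comm: "\<xi> i \<star> \<iota> i \<star> \<pi> i = (\<iota> (Suc i) \<star> \<pi> (Suc i)) \<star> \<xi> i" if i: "i \<le> d" for i
  proof -
    have \<xi>i: "arr (Xs i) (Xs (Suc i)) (\<xi> i)" by (rule angle_arr[OF X i])
    consider "i = n" | "Suc i = n" | "i = Suc n" | "i \<noteq> n" "Suc i \<noteq> n" "i \<noteq> Suc n" by blast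
    then show ?thesis
    proof cases
      case 1
      then show ?thesis
        using D1(2) D2(2) e'x cmp_minusr[OF arr_id[OF A] e(1) x] cmp_minusl[OF x arr_id[OF B] e'] x
        by (simp add: \<iota>_def \<pi>_def)
    next
      case 2
      then have \<xi>': "arr (Xs i) ?A (\<xi> i)" and "i < d" using \<xi>i n by auto
      \<comment> \<open>As \<open>e = t \<star> \<xi> n\<close>, the preceding morphism is
        annihilated by the composition law of angles; dually \<open>e'\<close> is annihilated by the
        following one.\<close>
      then have "e \<star> \<xi> i = nul (Xs i) ?A"
        using angle_cmp[OF X, of i] 2 cmp_assoc[OF \<xi>' x t] tx cmp_nulr[OF t, of "Xs i"] XO[of i] i by simp
      then show ?thesis
        using 2 D1(2) cmp_minusl[OF \<xi>' arr_id[OF A] e(1)] \<xi>' XO[of i] i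
        by (simp add: \<iota>_def \<pi>_def)
    next
      case 3
      then have \<xi>': "arr ?B (Xs (Suc i)) (\<xi> i)" using \<xi>i by simp
      have "(\<xi> i \<star> \<xi> n) \<star> t = nul ?B (Xs (Suc i))"
        using angle_cmp[OF X, of n] 3 n cmp_null[OF t, of "Xs (Suc i)"] XO[of "Suc i"] i by simp
      then have "\<xi> i \<star> e' = nul ?B (Xs (Suc i))"
        using cmp_assoc[OF t x \<xi>'] by (simp add: e'_def)
      then show ?thesis
        using 3 D2(2) cmp_minusr[OF arr_id[OF B] e' \<xi>'] \<xi>' XO[of "Suc i"] i
        by (simp add: \<iota>_def \<pi>_def)
    next
      case 4
      then show ?thesis using \<xi>i XO[of i] XO[of "Suc i"] i by (simp add: \<iota>_def \<pi>_def)
    qed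
  qed
  have last: "arr (Xs (d + 1)) (sO (Xs 0)) (\<xi> (d + 1))" by (rule angle_arr_last[OF X])
  \<comment> \<open>The bounds on \<open>n\<close> keep places \<open>n\<close> and
    \<open>Suc n\<close> away from 0 and \<open>d + 1\<close>, so the end terms and the connecting
    morphism stay as they are.\<close>
  have ends: "\<iota> 0 = Idm M (Xs 0)" "\<pi> 0 = Idm M (Xs 0)" "\<iota> (d + 1) = Idm M (Xs (d + 1))"
    "\<pi> (d + 1) = Idm M (Xs (d + 1))"
    using n by (auto simp: \<iota>_def \<pi>_def)
  have id0: "sM (Idm M (Xs 0)) = Idm M (sO (Xs 0))" using sh_id[OF XO] by simp
  let ?\<eta> = "\<lambda>i. ext d sM \<pi> (i + 1) \<star> \<xi> i \<star> \<iota> i"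
  show thesis
  proof (rule that)
    show "angle A' ?\<eta>"
    proof (rule angle_summand[OF X ds comm])
      show "\<xi> (d + 1) \<star> \<iota> (d + 1) \<star> \<pi> (d + 1) = (sM (\<iota> 0) \<star> sM (\<pi> 0)) \<star> \<xi> (d + 1)"
        unfolding ends id0 using last XO[of "d + 1"] XO[of 0] by simp
    qed
    have W12: "A1 \<in> \<W>" "A2 \<in> \<W>"
      using sub D1(1) D2(1) XW[of n] XW[of "Suc n"] n unfolding additive_subcategory_def
      by (meson less_imp_le_nat order_less_le_trans le_add1 Suc_leI trans_le_add1)+
    then show "A' i \<in> \<W>" if "i \<le> d + 1" for i using XW[OF that] by (simp add: A'_def)
    show "A' 0 = Xs 0" "A' (d + 1) = Xs (d + 1)" using n by (auto simp: A'_def)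
    show "?\<eta> (d + 1) = \<xi> (d + 1)"
      using ends id0 last by (simp add: ext_def)
    have le: "end_dim (A' i) \<le> end_dim (Xs i)" for i
      using end_dim_direct_sum(1)[OF fin D1(1)] end_dim_direct_sum(1)[OF fin D2(1)]
      by (simp add: A'_def)
    have "end_dim (A' n) < end_dim (Xs n)"
      using end_dim_direct_sum(2)[OF fin D1(1)] D1(3) e_nz by (simp add: A'_def)
    then show "(\<Sum>i = 1..d. end_dim (A' i)) < (\<Sum>i = 1..d. end_dim (Xs i))"
      using le n by (intro sum_strict_mono_ex1) auto
  qed
qed

text \<open>Among the angles in \<open>\<W>\<close> with the given ends and connecting morphism,
  take one whose middle terms have minimal total \<open>end_dim\<close>; a non-radical inner
  morphism would allow \<open>split_off\<close> to lower it.\<close>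

lemma ex_radical_angle:
  assumes fin: "Hom_finite k M" and si: "split_idempotents M" and sub: "additive_subcategory M \<W>"
    and X: "angle Xs \<xi>" and XW: "\<And>i. i \<le> d + 1 \<Longrightarrow> Xs i \<in> \<W>"
  obtains Ys \<eta> where "angle Ys \<eta>" "\<And>i. i \<le> d + 1 \<Longrightarrow> Ys i \<in> \<W>" "Ys 0 = Xs 0"
    "Ys (d + 1) = Xs (d + 1)" "\<eta> (d + 1) = \<xi> (d + 1)"
    "\<And>i. i \<in> {1..<d} \<Longrightarrow> \<eta> i \<in> radical (full_sub M \<W>) (Ys i) (Ys (i + 1))"
proof -
  define P where "P y \<longleftrightarrow> angle (fst y) (snd y) \<and> (\<forall>i \<le> d + 1. fst y i \<in> \<W>) \<and> fst y 0 = Xs 0 \<and>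
    fst y (d + 1) = Xs (d + 1) \<and> snd y (d + 1) = \<xi> (d + 1)" for y
  define m where "m y = (\<Sum>i = 1..d. end_dim (fst y i))" for y :: "(nat \<Rightarrow> 'o) \<times> (nat \<Rightarrow> 'm)"
  have "P (Xs, \<xi>)" using X XW by (simp add: P_def)
  then obtain y where y: "P y" "\<And>z. P z \<Longrightarrow> m y \<le> m z"
    using ex_has_least_nat[of P "(Xs, \<xi>)" m] by blast
  have "snd y i \<in> radical (full_sub M \<W>) (fst y i) (fst y (i + 1))" if i: "i \<in> {1..<d}" for i
  proof (rule ccontr)
    assume "snd y i \<notin> radical (full_sub M \<W>) (fst y i) (fst y (i + 1))"
    then obtain Ys \<eta> where "angle Ys \<eta>" "\<And>i. i \<le> d + 1 \<Longrightarrow> Ys i \<in> \<W>" "Ys 0 = fst y 0"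
      "Ys (d + 1) = fst y (d + 1)" "\<eta> (d + 1) = snd y (d + 1)"
      "(\<Sum>i = 1..d. end_dim (Ys i)) < (\<Sum>i = 1..d. end_dim (fst y i))"
      using split_off[OF fin si sub, of "fst y" "snd y" i] y(1) i unfolding P_def by auto
    then have "P (Ys, \<eta>)" "m (Ys, \<eta>) < m y" using y(1) by (auto simp: P_def m_def)
    then show False using y(2) leD by blast
  qed
  then show thesis using that[of "fst y" "snd y"] y(1) unfolding P_def by auto
qed

end

section \<open>Auslander-Reiten angles and covers\<close>

lemma full_sub_simps [simp]:
  "Obj (full_sub C \<W>) = \<W>" "Hom (full_sub C \<W>) = Hom C" "Idm (full_sub C \<W>) = Idm C"
  "Cmp (full_sub C \<W>) = Cmp C"
  by (simp_all add: full_sub_def)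

lemma full_sub_split [simp]:
  "split_mono (full_sub C \<W>) = split_mono C" "split_epi (full_sub C \<W>) = split_epi C"
  "is_iso (full_sub C \<W>) = is_iso C"
  by (auto simp: fun_eq_iff split_mono_def split_epi_def is_iso_def)

section \<open>Factorisation through maximal kernels\<close>

text \<open>The surjectivity of \<open>Hom(V, W0) \<rightarrow> Hom(V, X0)\<close> is dual to the injectivity of
  \<open>Hom(W, V) \<rightarrow> Hom(Hom(V, W0), k)\<close>. Instead of dualising, one approximates a
  morphism \<open>V \<rightarrow> X0\<close> with ever larger kernels on the finite-dimensional space \<open>Hom(W, V)\<close>.\<close>

context linear_category
begin

definition ker_on :: "'o \<Rightarrow> 'o \<Rightarrow> 'o \<Rightarrow> 'm \<Rightarrow> 'm set"
  where "ker_on W V A f = {e \<in> Mor C W V. f \<star> e = nul W A}"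

lemma ker_on_submodule:
  assumes f: "arr V A f" and W: "W \<in> Obj C"
  shows "submodule (ker_on W V A f) k (Hom C W V)"
proof -
  have V: "V \<in> Obj C" and A: "A \<in> Obj C" using f arrD by blast+
  interpret H: module k "Hom C W V" by (rule hom_module[OF W V])
  interpret HA: module k "Hom C W A" by (rule hom_module[OF W A])
  have K: "e \<in> ker_on W V A f \<longleftrightarrow> arr W V e \<and> f \<star> e = nul W A" for e
    using V W by (auto simp: ker_on_def arr_def)
  show ?thesis
  proof (rule H.submoduleI)
    show "ker_on W V A f \<subseteq> Mor C W V" by (auto simp: ker_on_def)
    show "nul W V \<in> ker_on W V A f" using cmp_nulr[OF f W] V W by (simp add: K)
    show "\<ominus>\<^bsub>Hom C W V\<^esub> e \<in> ker_on W V A f" if "e \<in> ker_on W V A f" for e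
      using that cmp_uminusr[OF _ f, of W e] A W by (simp add: K)
    show "e \<oplus>\<^bsub>Hom C W V\<^esub> e' \<in> ker_on W V A f" if "e \<in> ker_on W V A f" "e' \<in> ker_on W V A f" for e e'
      using that cmp_addr[OF _ _ f, of W e e'] A W by (simp add: K)
    show "a \<odot>\<^bsub>Hom C W V\<^esub> e \<in> ker_on W V A f" if "a \<in> carrier k" "e \<in> ker_on W V A f" for a e
      using that comp_smult_right[OF W V A that(1) _ arrD(3)[OF f], of e] V W
      by (simp add: K arr_def)
  qed
qed

text \<open>Kernel ranks are bounded by the rank of the whole Hom space. The parameter
  \<open>a\<close> lets the target \<open>F a\<close> vary with the morphism: \<open>F\<close> is
  the identity in \<open>factor_same_kernel\<close> and constant in
  \<open>factor_through\<close>.\<close>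

lemma ex_max_kernel:
  assumes fin: "Hom_finite k C" and W: "W \<in> Obj C" and "P a0 f0"
    and P: "\<And>a f. P a f \<Longrightarrow> arr V (F a) f"
  obtains a f where "P a f" "\<And>b g. P b g \<Longrightarrow> \<not> ker_on W V (F a) f \<subset> ker_on W V (F b) g"
proof -
  have V: "V \<in> Obj C" using P assms(3) arrD by blast
  interpret H: module k "Hom C W V" by (rule hom_module[OF W V])
  obtain rk :: "'m set \<Rightarrow> nat" where
    rk: "\<And>S T. \<lbrakk> submodule S k (Hom C W V); submodule T k (Hom C W V); S \<subset> T \<rbrakk> \<Longrightarrow> rk S < rk T"
    using finite_dim_rank[OF field hom_module[OF W V]] fin W V unfolding Hom_finite_def by blast
  define m where "m y = rk (ker_on W V (F (fst y)) (snd y))" for y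
  have "m y \<le> rk (Mor C W V)" if "P (fst y) (snd y)" for y
  proof (cases "ker_on W V (F (fst y)) (snd y) = Mor C W V")
    case False
    then have "ker_on W V (F (fst y)) (snd y) \<subset> Mor C W V" by (auto simp: ker_on_def)
    then show ?thesis
      using rk[OF ker_on_submodule[OF P[OF that] W] H.carrier_is_submodule] by (simp add: m_def)
  qed (simp add: m_def)
  then obtain y where y: "P (fst y) (snd y)" "\<And>z. P (fst z) (snd z) \<Longrightarrow> m z \<le> m y"
    using ex_has_greatest_nat[of "\<lambda>y. P (fst y) (snd y)" "(a0, f0)" m "Suc (rk (Mor C W V))"] assms(3)
    by (auto simp: less_Suc_eq_le)
  show thesis
  proof (rule that[OF y(1)])
    fix b g assume Q: "P b g"
    show "\<not> ker_on W V (F (fst y)) (snd y) \<subset> ker_on W V (F b) g"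
      using rk[OF ker_on_submodule[OF P[OF y(1)] W] ker_on_submodule[OF P[OF Q] W]] y(2)[of "(b, g)"] Q
      by (auto simp: m_def)
  qed
qed

text \<open>Among the factorisations of \<open>f\<close> over objects of \<open>\<W>\<close> choose
  one with \<open>ker_on W V A v\<close> maximal. If \<open>f\<close> killed some \<open>e\<close>
  that \<open>v\<close> does not, composing \<open>v\<close> with a weak cokernel of
  \<open>v \<star> e\<close> would enlarge the kernel. The result moves questions about the target
  \<open>X0\<close> into \<open>\<W>\<close>.\<close>

lemma factor_same_kernel:
  assumes fin: "Hom_finite k C" and W: "W \<in> Obj C" and V: "V \<in> \<W>" and f: "arr V X0 f"
    and coker: "\<And>A \<epsilon>. \<lbrakk> A \<in> \<W>; arr W A \<epsilon> \<rbrakk> \<Longrightarrow> \<exists>B v. B \<in> \<W> \<and> arr A B v \<and> v \<star> \<epsilon> = nul W B \<and>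
      (\<forall>g. arr A X0 g \<longrightarrow> g \<star> \<epsilon> = nul W X0 \<longrightarrow> (\<exists>h. arr B X0 h \<and> g = h \<star> v))"
  obtains A v f' where "A \<in> \<W>" "arr V A v" "arr A X0 f'" "f = f' \<star> v"
    "ker_on W V A v = ker_on W V X0 f"
proof -
  define P where "P A v \<longleftrightarrow> A \<in> \<W> \<and> arr V A v \<and> (\<exists>f'. arr A X0 f' \<and> f = f' \<star> v)" for A v
  have VO: "V \<in> Obj C" and X0: "X0 \<in> Obj C" using f arrD by blast+
  have "P V (Idm C V)" using V VO f cmp_idr[OF f] unfolding P_def by force
  then obtain A v where A: "P A v" and max: "\<And>B u. P B u \<Longrightarrow> \<not> ker_on W V A v \<subset> ker_on W V B u"
    by (rule ex_max_kernel[OF fin W, of P V "Idm C V" V "\<lambda>A. A"]) (auto simp: P_def)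
  obtain f' where v: "A \<in> \<W>" "arr V A v" and f': "arr A X0 f'" "f = f' \<star> v"
    using A by (auto simp: P_def)
  have "e \<in> ker_on W V A v" if e: "e \<in> ker_on W V X0 f" for e
  proof (rule ccontr)
    assume ne: "e \<notin> ker_on W V A v"
    have eW: "arr W V e" and fe: "f \<star> e = nul W X0" using e W VO by (auto simp: ker_on_def arr_def)
    have ve: "arr W A (v \<star> e)" using eW v by blast
    obtain B u where u: "B \<in> \<W>" "arr A B u" "u \<star> v \<star> e = nul W B"
      and fac: "\<And>g. arr A X0 g \<Longrightarrow> g \<star> v \<star> e = nul W X0 \<Longrightarrow> \<exists>h. arr B X0 h \<and> g = h \<star> u"
      using coker[OF v(1) ve] by blast
    have "f' \<star> v \<star> e = nul W X0" using fe f' cmp_assoc[OF eW v(2) f'(1)] by simp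
    then obtain h where h: "arr B X0 h" "f' = h \<star> u" using fac f' by blast
    have uv: "arr V B (u \<star> v)" using u v by blast
    have "f = h \<star> u \<star> v" using f' h cmp_assoc[OF v(2) u(2) h(1)] by simp
    then have "P B (u \<star> v)" using u uv h by (auto simp: P_def)
    moreover have "ker_on W V A v \<subset> ker_on W V B (u \<star> v)"
    proof
      show "ker_on W V A v \<subseteq> ker_on W V B (u \<star> v)"
      proof
        fix x assume "x \<in> ker_on W V A v"
        then have x: "arr W V x" "v \<star> x = nul W A" using W VO by (auto simp: ker_on_def arr_def)
        then show "x \<in> ker_on W V B (u \<star> v)"
          using cmp_assoc[OF x(1) v(2) u(2)] cmp_nulr[OF u(2) W] by (simp add: ker_on_def arr_def)
      qed
      have "e \<in> ker_on W V B (u \<star> v)"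
        using cmp_assoc[OF eW v(2) u(2)] u(3) eW by (simp add: ker_on_def arr_def)
      then show "ker_on W V A v \<noteq> ker_on W V B (u \<star> v)" using ne by blast
    qed
    ultimately show False using max by blast
  qed
  moreover have "e \<in> ker_on W V X0 f" if "e \<in> ker_on W V A v" for e
  proof -
    have x: "arr W V e" "v \<star> e = nul W A" using that W VO v(2) by (auto simp: ker_on_def arr_def)
    then show ?thesis
      using cmp_assoc[OF x(1) v(2) f'(1)] cmp_nulr[OF f'(1) W] f'(2) by (simp add: ker_on_def arr_def)
  qed
  ultimately show thesis using that[OF v f'] by blast
qed

text \<open>Among the morphisms that differ from \<open>f\<close> by some
  \<open>\<phi> \<star> p\<close>, choose \<open>g\<close> with maximal kernel. If \<open>g\<close>
  were non-zero, subtracting a suitable \<open>\<phi> \<star> h \<star> v\<close> would preserve the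
  kernel and add the element \<open>q\<close> with \<open>g \<star> q = \<zeta>\<close>.\<close>

lemma factor_through:
  assumes fin: "Hom_finite k C" and W: "W \<in> Obj C" and V: "V \<in> \<W>" and f: "arr V X0 f"
    and coker: "\<And>A \<epsilon>. \<lbrakk> A \<in> \<W>; arr W A \<epsilon> \<rbrakk> \<Longrightarrow> \<exists>B v. B \<in> \<W> \<and> arr A B v \<and> v \<star> \<epsilon> = nul W B \<and>
      (\<forall>g. arr A X0 g \<longrightarrow> g \<star> \<epsilon> = nul W X0 \<longrightarrow> (\<exists>h. arr B X0 h \<and> g = h \<star> v))"
    and \<phi>: "arr W0 X0 \<phi>" and \<delta>: "arr W W0 \<delta>" and \<zeta>: "\<phi> \<star> \<delta> = \<zeta>" "\<zeta> \<noteq> nul W X0"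
    and reach: "\<And>A g. \<lbrakk> A \<in> \<W>; arr A X0 g; g \<noteq> nul A X0 \<rbrakk> \<Longrightarrow> \<exists>\<epsilon>. arr W A \<epsilon> \<and> g \<star> \<epsilon> = \<zeta>"
    and gen: "\<And>A \<epsilon>. \<lbrakk> A \<in> \<W>; arr W A \<epsilon>; \<epsilon> \<noteq> nul W A \<rbrakk> \<Longrightarrow> \<exists>h. arr A W0 h \<and> h \<star> \<epsilon> = \<delta>"
  shows "\<exists>p. arr V W0 p \<and> f = \<phi> \<star> p"
proof -
  have VO: "V \<in> Obj C" and X0: "X0 \<in> Obj C" and W0: "W0 \<in> Obj C" using f \<phi> arrD by blast+
  interpret H: abelian_group "Hom C V X0" by (rule hom_abelian[OF VO X0])
  define P where "P (u::unit) g \<longleftrightarrow> arr V X0 g \<and> (\<exists>p. arr V W0 p \<and> f = g \<oplus>\<^bsub>Hom C V X0\<^esub> (\<phi> \<star> p))" for u g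
  have "P () f"
    using f cmp_nulr[OF \<phi> VO] arr_nul[OF VO W0] add_nulr[OF f] unfolding P_def by force
  then obtain u g where g: "P u g"
    and max: "\<And>u' g'. P u' g' \<Longrightarrow> \<not> ker_on W V X0 g \<subset> ker_on W V X0 g'"
    by (rule ex_max_kernel[OF fin W, of P "()" f V "\<lambda>_. X0"]) (auto simp: P_def)
  obtain p where gX: "arr V X0 g" and p: "arr V W0 p" "f = g \<oplus>\<^bsub>Hom C V X0\<^esub> (\<phi> \<star> p)"
    using g by (auto simp: P_def)
  have \<phi>p: "arr V X0 (\<phi> \<star> p)" using p \<phi> by blast
  have "g = nul V X0"
  proof (rule ccontr)
    assume nz: "g \<noteq> nul V X0"
    obtain A v g' where v: "A \<in> \<W>" "arr V A v" "arr A X0 g'" "g = g' \<star> v"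
      and ker: "ker_on W V A v = ker_on W V X0 g"
      by (rule factor_same_kernel[OF fin W V gX coker])
    obtain q where q: "arr W V q" "g \<star> q = \<zeta>" using reach[OF V gX nz] by blast
    have vq: "arr W A (v \<star> q)" using v q by blast
    have AO: "A \<in> Obj C" using v arrD by blast
    have qn: "q \<notin> ker_on W V X0 g" using q \<zeta> by (simp add: ker_on_def)
    \<comment> \<open>Because \<open>v\<close> has the same kernel as \<open>g\<close>, it does not
      kill \<open>q\<close>; unlike \<open>X0\<close>, the target of \<open>v\<close> lies in
      \<open>\<W>\<close>, so \<open>gen\<close> applies.\<close>
    then have "v \<star> q \<noteq> nul W A" using ker q(1) by (auto simp: ker_on_def arr_def)
    then obtain h where h: "arr A W0 h" "h \<star> v \<star> q = \<delta>" using gen[OF v(1) vq] by blast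
    have hv: "arr V W0 (h \<star> v)" using h v by blast
    have \<phi>hv: "arr V X0 (\<phi> \<star> h \<star> v)" using hv \<phi> by blast
    define g2 where "g2 = g \<ominus>\<^bsub>Hom C V X0\<^esub> (\<phi> \<star> h \<star> v)"
    have g2: "arr V X0 g2" using gX \<phi>hv by (simp add: g2_def)
    have g2_cmp: "g2 \<star> x = (g \<star> x) \<ominus>\<^bsub>Hom C W X0\<^esub> (\<phi> \<star> h \<star> v \<star> x)" if x: "arr W V x" for x
      using cmp_minusl[OF x gX \<phi>hv] cmp_assoc[OF x hv \<phi>] cmp_assoc[OF x v(2) h(1)]
      by (simp add: g2_def)
    have "f = (g2 \<oplus>\<^bsub>Hom C V X0\<^esub> (\<phi> \<star> h \<star> v)) \<oplus>\<^bsub>Hom C V X0\<^esub> (\<phi> \<star> p)"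
      using minus_add_cancel[OF gX \<phi>hv] p(2) by (simp add: g2_def)
    also have "\<dots> = g2 \<oplus>\<^bsub>Hom C V X0\<^esub> (\<phi> \<star> ((h \<star> v) \<oplus>\<^bsub>Hom C V W0\<^esub> p))"
      using H.a_assoc[OF arrD(3)[OF g2] arrD(3)[OF \<phi>hv] arrD(3)[OF \<phi>p]] cmp_addr[OF hv p(1) \<phi>] by simp
    finally have "P () g2" using g2 hv p(1) unfolding P_def by blast
    moreover have "ker_on W V X0 g \<subset> ker_on W V X0 g2"
    proof
      show "ker_on W V X0 g \<subseteq> ker_on W V X0 g2"
      proof
        fix x assume x: "x \<in> ker_on W V X0 g"
        then have "x \<in> ker_on W V A v" using ker by simp
        then have x': "arr W V x" "v \<star> x = nul W A" "g \<star> x = nul W X0"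
          using x W VO by (auto simp: ker_on_def arr_def)
        then show "x \<in> ker_on W V X0 g2"
          using g2_cmp[OF x'(1)] cmp_nulr[OF h(1) W] cmp_nulr[OF \<phi> W] minus_self[OF arr_nul[OF W X0]]
          by (simp add: ker_on_def arr_def)
      qed
      have "q \<in> ker_on W V X0 g2"
        using g2_cmp[OF q(1)] q h \<zeta> minus_self[OF arr_cmp[OF \<delta> \<phi>]] by (simp add: ker_on_def arr_def)
      then show "ker_on W V X0 g \<noteq> ker_on W V X0 g2" using qn by blast
    qed
    ultimately show False using max by blast
  qed
  then show ?thesis using p add_null[OF \<phi>p] by auto
qed

end

section \<open>Almost split morphisms and extension angles\<close>

context angulated_category
begin

lemma extension_angle:
  assumes ext: "closed_under_extensions d M \<W>" and "V \<in> \<W>" and "sO W \<in> \<W>" and "arr W V \<epsilon>"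
  obtains U \<upsilon> where "tail U \<upsilon> W \<epsilon>" "U 0 = V" "U (d + 1) = sO W" "\<upsilon> (d + 1) = sM \<epsilon>"
    "\<And>i. i \<le> d + 1 \<Longrightarrow> U i \<in> \<W>"
proof -
  have "sM \<epsilon> \<in> Mor M (sO W) (sO V)" using arr_sM[OF assms(4)] by (simp add: arr_def)
  then obtain U \<upsilon> where U: "angle U \<upsilon>" "U 0 = V" "U (d + 1) = sO W" "\<upsilon> (d + 1) = sM \<epsilon>"
    "\<forall>i \<in> {1..d}. U i \<in> \<W>"
    using ext assms(2,3) unfolding closed_under_extensions_def by blast
  have "U i \<in> \<W>" if i: "i \<le> d + 1" for i
  proof -
    consider "i = 0" | "i \<in> {1..d}" | "i = d + 1" using i by force
    then show ?thesis using U assms(2,3) by cases auto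
  qed
  then show thesis using that[of U \<upsilon>] U assms(4) by (simp add: tail_def)
qed

text \<open>A section \<open>s\<close> of \<open>\<xi> d\<close> would give
  \<open>\<xi> (d + 1)\<close> = \<open>\<xi> (d + 1) \<star> \<xi> d \<star> s\<close> = 0.\<close>

lemma not_split_epi_if_tail:
  assumes "tail Xs \<xi> W \<delta>" and "\<delta> \<noteq> nul W (Xs 0)"
  shows "\<not> split_epi M (Xs d) (Xs (d + 1)) (\<xi> d)"
proof
  have X: "angle Xs \<xi>" and W: "sO W = Xs (d + 1)" and \<delta>: "arr W (Xs 0) \<delta>" "sM \<delta> = \<xi> (d + 1)"
    using assms by (auto simp: tail_def)
  have \<xi>d: "arr (Xs d) (Xs (d + 1)) (\<xi> d)" using angle_arr[OF X order_refl] by simp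
  have l: "arr (Xs (d + 1)) (sO (Xs 0)) (\<xi> (d + 1))" by (rule angle_arr_last[OF X])
  assume "split_epi M (Xs d) (Xs (d + 1)) (\<xi> d)"
  then obtain s where s: "arr (Xs (d + 1)) (Xs d) s" "\<xi> d \<star> s = Idm M (Xs (d + 1))"
    using split_epi_iff[OF \<xi>d] by blast
  have "\<xi> (d + 1) = (\<xi> (d + 1) \<star> \<xi> d) \<star> s" using cmp_assoc[OF s(1) \<xi>d l] s(2) l by simp
  also have "\<dots> = nul (sO W) (sO (Xs 0))"
    using angle_cmp_d[OF X] cmp_null[OF s(1), of "sO (Xs 0)"] l W arrD by simp
  finally show False using \<delta> sM_eq_nul_iff[OF \<delta>(1)] assms(2) by simp
qed

text \<open>If \<delta> vanished, the identity of the last term would lie in the kernel of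
  \<open>\<xi> (d + 1)\<close> and hence factor through \<open>\<xi> d\<close>.\<close>

lemma tail_nonzero:
  assumes "tail Xs \<xi> W \<delta>" and "\<not> split_epi M (Xs d) (Xs (d + 1)) (\<xi> d)"
  shows "\<delta> \<noteq> nul W (Xs 0)"
proof
  have X: "angle Xs \<xi>" and W: "sO W = Xs (d + 1)" and \<delta>: "arr W (Xs 0) \<delta>" "sM \<delta> = \<xi> (d + 1)"
    using assms by (auto simp: tail_def)
  have \<xi>d: "arr (Xs d) (Xs (d + 1)) (\<xi> d)" using angle_arr[OF X order_refl] by simp
  have o: "Xs (d + 1) \<in> Obj M" "Xs 0 \<in> Obj M" "W \<in> Obj M" using \<xi>d \<delta> arrD by blast+
  assume "\<delta> = nul W (Xs 0)"
  then have "\<xi> (d + 1) = nul (Xs (d + 1)) (sO (Xs 0))" using \<delta>(2) W o by simp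
  then have "\<xi> (d + 1) \<star> Idm M (Xs (d + 1)) = nul (Xs (d + 1)) (sO (Xs 0))" using o by simp
  then obtain h where "arr (Xs (d + 1)) (Xs d) h" "Idm M (Xs (d + 1)) = \<xi> d \<star> h"
    using weak_kernel_d[OF X arr_id[OF o(1)]] by blast
  then show False using assms(2) split_epi_iff[OF \<xi>d] by metis
qed

lemma tail_not_split_mono:
  assumes "tail Xs \<xi> W \<delta>" and "\<delta> \<noteq> nul W (Xs 0)"
  shows "\<not> split_mono M (Xs 0) (Xs 1) (\<xi> 0)"
proof
  have X: "angle Xs \<xi>" and \<delta>: "arr W (Xs 0) \<delta>" using assms by (auto simp: tail_def)
  have \<xi>0: "arr (Xs 0) (Xs 1) (\<xi> 0)" using angle_arr[OF X, of 0] by simp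
  assume "split_mono M (Xs 0) (Xs 1) (\<xi> 0)"
  then obtain r where r: "arr (Xs 1) (Xs 0) r" "r \<star> \<xi> 0 = Idm M (Xs 0)"
    using split_mono_iff[OF \<xi>0] by blast
  have "\<delta> = r \<star> \<xi> 0 \<star> \<delta>" using cmp_assoc[OF \<delta> \<xi>0 r(1)] r(2) \<delta> by simp
  then show False using tail_cmp[OF assms(1)] cmp_nulr[OF r(1) arrD(1)[OF \<delta>]] assms(2) by simp
qed

text \<open>Take \<open>c\<close> of which \<open>f\<close> is a weak kernel. It is no split
  monomorphism since \<open>f\<close> is non-zero, so it factors through \<open>\<xi> 0\<close> and
  kills \<zeta>; therefore \<zeta> factors through \<open>f\<close>.\<close>

lemma left_almost_split_reach:
  assumes X: "tail Xs \<xi> W \<zeta>" and las: "left_almost_split M (Xs 0) (Xs 1) (\<xi> 0)"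
    and f: "arr V (Xs 0) f" "f \<noteq> nul V (Xs 0)"
  shows "\<exists>\<epsilon>. arr W V \<epsilon> \<and> f \<star> \<epsilon> = \<zeta>"
proof -
  have \<zeta>: "arr W (Xs 0) \<zeta>" and \<xi>0: "arr (Xs 0) (Xs 1) (\<xi> 0)"
    using X angle_arr[of Xs \<xi> 0] by (auto simp: tail_def)
  have V: "V \<in> Obj M" using f arrD by blast
  obtain D c where c: "arr (Xs 0) D c" "c \<star> f = nul V D"
    and fac: "\<And>Y g. \<lbrakk> arr Y (Xs 0) g; c \<star> g = nul Y D \<rbrakk> \<Longrightarrow> \<exists>h. arr Y V h \<and> g = f \<star> h"
    using ex_weak_cokernel[OF f(1)] by blast
  have "\<not> split_mono M (Xs 0) D c"
  proof
    assume "split_mono M (Xs 0) D c"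
    then obtain r where r: "arr D (Xs 0) r" "r \<star> c = Idm M (Xs 0)"
      using split_mono_iff[OF c(1)] by blast
    have "f = r \<star> c \<star> f" using cmp_assoc[OF f(1) c(1) r(1)] r(2) f(1) by simp
    then show False using c(2) cmp_nulr[OF r(1) V] f(2) by simp
  qed
  then obtain h where h: "arr (Xs 1) D h" "c = h \<star> \<xi> 0"
    using las c(1) \<xi>0 unfolding left_almost_split_def arr_def by blast
  have "c \<star> \<zeta> = nul W D"
    using h cmp_assoc[OF \<zeta> \<xi>0 h(1)] tail_cmp[OF X] cmp_nulr[OF h(1) arrD(1)[OF \<zeta>]] by simp
  then show ?thesis using fac[OF \<zeta>] by metis
qed

text \<open>The last inner morphism of an extension angle over \<epsilon> is not a split
  epimorphism, hence factors through \<open>\<omega> d\<close>; the induced morphism of angles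
  yields \<open>h\<close>. The set \<open>\<T>\<close> is separate so that the angle may be almost
  split in all of \<open>M\<close> or only in \<open>\<W>\<close>.\<close>

lemma right_almost_split_generates:
  assumes Y: "tail Ys \<omega> W \<delta>" and ras: "right_almost_split (full_sub M \<T>) (Ys d) (Ys (d + 1)) (\<omega> d)"
    and "\<W> \<subseteq> \<T>" and ext: "closed_under_extensions d M \<W>" and W: "Ys (d + 1) \<in> \<W>"
    and V: "V \<in> \<W>" and \<epsilon>: "arr W V \<epsilon>" "\<epsilon> \<noteq> nul W V"
  shows "\<exists>h. arr V (Ys 0) h \<and> h \<star> \<epsilon> = \<delta>"
proof -
  have YW: "sO W = Ys (d + 1)" and Ya: "angle Ys \<omega>" using Y by (auto simp: tail_def)
  have \<omega>d: "arr (Ys d) (Ys (d + 1)) (\<omega> d)" using angle_arr[OF Ya order_refl] by simp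
  obtain U \<upsilon> where U: "tail U \<upsilon> W \<epsilon>" "U 0 = V" "U (d + 1) = sO W"
    and UW: "\<And>i. i \<le> d + 1 \<Longrightarrow> U i \<in> \<W>"
    using extension_angle[OF ext V _ \<epsilon>(1)] W YW by metis
  have \<upsilon>d: "arr (U d) (Ys (d + 1)) (\<upsilon> d)"
    using U(1,3) angle_arr[of U \<upsilon> d] YW by (simp add: tail_def)
  have "\<not> split_epi M (U d) (Ys (d + 1)) (\<upsilon> d)"
    using not_split_epi_if_tail[OF U(1)] \<epsilon>(2) U(2,3) YW by simp
  moreover have "U d \<in> \<T>" using UW[of d] assms(3) by auto
  ultimately obtain \<theta> where "arr (U d) (Ys d) \<theta>" "\<upsilon> d = \<omega> d \<star> \<theta>"
    using ras \<upsilon>d \<omega>d unfolding right_almost_split_def arr_def by auto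
  then obtain t where "arr (U 0) (Ys 0) t" "t \<star> \<epsilon> = \<delta>"
    using tail_morphism[OF U(1) Y] by metis
  then show ?thesis using U(2) by blast
qed

text \<open>The first morphism of an extension angle over \<epsilon>: its target lies in
  \<open>\<W>\<close>, while it is a weak cokernel with respect to all of \<open>M\<close>.\<close>

lemma weak_cokernel_in:
  assumes ext: "closed_under_extensions d M \<W>" and "V \<in> \<W>" and "sO W \<in> \<W>" and \<epsilon>: "arr W V \<epsilon>"
  shows "\<exists>B v. B \<in> \<W> \<and> arr V B v \<and> v \<star> \<epsilon> = nul W B \<and>
    (\<forall>A g. arr V A g \<longrightarrow> g \<star> \<epsilon> = nul W A \<longrightarrow> (\<exists>h. arr B A h \<and> g = h \<star> v))"
proof -
  obtain U \<upsilon> where U: "tail U \<upsilon> W \<epsilon>" "U 0 = V" and UW: "\<And>i. i \<le> d + 1 \<Longrightarrow> U i \<in> \<W>"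
    using extension_angle[OF assms] by blast
  have \<upsilon>0: "arr V (U 1) (\<upsilon> 0)" using U angle_arr[of U \<upsilon> 0] by (simp add: tail_def)
  have "\<exists>h. arr (U 1) A h \<and> g = h \<star> \<upsilon> 0" if "arr V A g" "g \<star> \<epsilon> = nul W A" for A g
    using weak_cokernel[OF U(1), of A g] that U(2) by blast
  then show ?thesis
    using \<upsilon>0 UW[of 1] tail_cmp[OF U(1)] by (intro exI[of _ "U 1"] exI[of _ "\<upsilon> 0"]) simp
qed

section \<open>From an Auslander-Reiten angle in the subcategory to a cover\<close>

text \<open>Since \<open>\<omega> d\<close> is not a split epimorphism it factors through
  \<open>\<xi> d\<close>; the induced morphism of angles supplies \<phi> with
  \<open>\<phi> \<star> \<delta> = \<zeta>\<close>, and \<open>factor_through\<close> makes it a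
  precover.\<close>

lemma cover_if_AR_angle:
  assumes fin: "Hom_finite k M" and ext: "closed_under_extensions d M \<W>" and WM: "\<W> \<subseteq> Obj M"
    and W: "W \<in> \<W>" and X: "AR_angle d M (Obj M) Xs \<xi>" "Xs (d + 1) = W"
    and Y: "AR_angle d M \<W> Ys \<omega>" "Ys (d + 1) = W"
  shows "\<exists>\<phi>. is_cover M \<W> (Ys 0) (Xs 0) \<phi>"
proof -
  obtain W' where W': "W' \<in> Obj M" "sO W' = W" using sO_surj W WM by blast
  obtain \<zeta> where \<zeta>: "tail Xs \<xi> W' \<zeta>" using ex_tail X W' unfolding AR_angle_def by metis
  obtain \<delta> where \<delta>: "tail Ys \<omega> W' \<delta>" using ex_tail Y W' unfolding AR_angle_def by metis
  have \<zeta>a: "arr W' (Xs 0) \<zeta>" and \<delta>a: "arr W' (Ys 0) \<delta>" using \<zeta> \<delta> by (auto simp: tail_def)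
  have lasX: "left_almost_split M (Xs 0) (Xs 1) (\<xi> 0)"
    and rasX: "right_almost_split M (Xs d) (Xs (d + 1)) (\<xi> d)"
    using X(1) by (auto simp: AR_angle_def left_almost_split_def right_almost_split_def)
  have lasY: "left_almost_split (full_sub M \<W>) (Ys 0) (Ys 1) (\<omega> 0)"
    and rasY: "right_almost_split (full_sub M \<W>) (Ys d) (Ys (d + 1)) (\<omega> d)"
    and YW: "\<And>i. i \<le> d + 1 \<Longrightarrow> Ys i \<in> \<W>"
    using Y(1) by (auto simp: AR_angle_def)
  have Ya: "angle Ys \<omega>" and Xa: "angle Xs \<xi>" using X Y by (auto simp: AR_angle_def)
  have \<omega>d: "arr (Ys d) W (\<omega> d)" and \<xi>d: "arr (Xs d) W (\<xi> d)"
    using angle_arr[OF Ya order_refl] angle_arr[OF Xa order_refl] X(2) Y(2) by simp_all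
  have \<omega>0: "arr (Ys 0) (Ys 1) (\<omega> 0)" using angle_arr[OF Ya, of 0] by simp
  have Y0: "Ys 0 \<in> \<W>" "Ys 0 \<in> Obj M" using YW[of 0] WM by auto
  have \<zeta>_nz: "\<zeta> \<noteq> nul W' (Xs 0)"
    using tail_nonzero[OF \<zeta>] rasX by (simp add: right_almost_split_def)
  have "\<not> split_epi M (Ys d) W (\<omega> d)" using rasY Y(2) by (simp add: right_almost_split_def)
  then obtain \<theta> where "arr (Ys d) (Xs d) \<theta>" "\<omega> d = \<xi> d \<star> \<theta>"
    using rasX \<omega>d \<xi>d X(2) unfolding right_almost_split_def arr_def by auto
  then obtain \<phi> where \<phi>: "arr (Ys 0) (Xs 0) \<phi>" "\<phi> \<star> \<delta> = \<zeta>"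
    using tail_morphism[OF \<delta> \<zeta>] by metis
  have pre: "\<exists>h. arr V (Ys 0) h \<and> f = \<phi> \<star> h" if V: "V \<in> \<W>" and f: "arr V (Xs 0) f" for V f
  proof (rule factor_through[OF fin W'(1) V f _ \<phi>(1) \<delta>a \<phi>(2) \<zeta>_nz])
    fix A \<epsilon> assume A: "A \<in> \<W>" "arr W' A \<epsilon>"
    have "sO W' \<in> \<W>" using W W' by simp
    then show "\<exists>B v. B \<in> \<W> \<and> arr A B v \<and> v \<star> \<epsilon> = nul W' B \<and>
      (\<forall>g. arr A (Xs 0) g \<longrightarrow> g \<star> \<epsilon> = nul W' (Xs 0) \<longrightarrow> (\<exists>h. arr B (Xs 0) h \<and> g = h \<star> v))"
      using weak_cokernel_in[OF ext A(1) _ A(2)] by blast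
  next
    fix A g assume "arr A (Xs 0) g" "g \<noteq> nul A (Xs 0)"
    then show "\<exists>\<epsilon>. arr W' A \<epsilon> \<and> g \<star> \<epsilon> = \<zeta>" by (rule left_almost_split_reach[OF \<zeta> lasX])
  next
    fix A \<epsilon> assume A: "A \<in> \<W>" "arr W' A \<epsilon>" "\<epsilon> \<noteq> nul W' A"
    show "\<exists>h. arr A (Ys 0) h \<and> h \<star> \<epsilon> = \<delta>"
      by (rule right_almost_split_generates[OF \<delta> rasY order_refl ext _ A]) (use Y W in simp)
  qed
  \<comment> \<open>Such an \<open>x\<close> factors through the left almost split
    \<open>\<omega> 0\<close>, which kills \<delta>.\<close>
  have kill: "x \<star> \<delta> = nul W' (Ys 0)" if x: "arr (Ys 0) (Ys 0) x" "\<not> split_mono M (Ys 0) (Ys 0) x" for x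
  proof -
    obtain y where y: "arr (Ys 1) (Ys 0) y" "x = y \<star> \<omega> 0"
      using lasY x Y0 \<omega>0 unfolding left_almost_split_def arr_def by auto
    then show ?thesis
      using cmp_assoc[OF \<delta>a \<omega>0 y(1)] tail_cmp[OF \<delta>] cmp_nulr[OF y(1) W'(1)] by simp
  qed
  have min: "is_iso M (Ys 0) (Ys 0) h" if h: "arr (Ys 0) (Ys 0) h" "\<phi> \<star> h = \<phi>" for h
  proof -
    have \<delta>_nz: "\<delta> \<noteq> nul W' (Ys 0)" using \<phi> \<zeta>_nz cmp_nulr[OF \<phi>(1) W'(1)] by auto
    have "\<phi> \<star> h \<star> \<delta> = \<zeta>" using cmp_assoc[OF \<delta>a h(1) \<phi>(1)] h(2) \<phi>(2) by simp
    then have "h \<star> \<delta> \<noteq> nul W' (Ys 0)" using \<zeta>_nz cmp_nulr[OF \<phi>(1) W'(1)] by auto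
    then obtain r where r: "arr (Ys 0) (Ys 0) r" "r \<star> h = Idm M (Ys 0)"
      using kill[OF h(1)] split_mono_iff[OF h(1)] by blast
    have hr: "arr (Ys 0) (Ys 0) (h \<star> r)" using h r by blast
    have hrh: "(h \<star> r) \<star> h = h" using cmp_assoc[OF h(1) r(1) h(1)] r(2) h(1) by simp
    let ?x = "Idm M (Ys 0) \<ominus>\<^bsub>Hom M (Ys 0) (Ys 0)\<^esub> (h \<star> r)"
    have x: "arr (Ys 0) (Ys 0) ?x" using hr Y0 by simp
    have xh: "?x \<star> h = nul (Ys 0) (Ys 0)"
      using cmp_minusl[OF h(1) arr_id[OF Y0(2)] hr] hrh h(1) by simp
    \<comment> \<open>The complementary idempotents \<open>?x\<close> and \<open>h \<star> r\<close>
      add up to the identity, so they cannot both kill \<delta>; the one that does not is a split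
      monomorphism by \<open>kill\<close>.\<close>
    have "?x \<star> \<delta> \<noteq> nul W' (Ys 0) \<or> (h \<star> r) \<star> \<delta> \<noteq> nul W' (Ys 0)"
      using cmp_minusl[OF \<delta>a arr_id[OF Y0(2)] hr] \<delta>a \<delta>_nz minus_nul[OF \<delta>a] by auto
    then show ?thesis
    proof
      assume "?x \<star> \<delta> \<noteq> nul W' (Ys 0)"
      then obtain y where y: "arr (Ys 0) (Ys 0) y" "y \<star> ?x = Idm M (Ys 0)"
        using kill[OF x] split_mono_iff[OF x] by blast
      have "h = y \<star> ?x \<star> h" using cmp_assoc[OF h(1) x y(1)] y(2) h(1) by simp
      then have "h = nul (Ys 0) (Ys 0)" using xh cmp_nulr[OF y(1) Y0(2)] by simp
      then have False using \<open>h \<star> \<delta> \<noteq> nul W' (Ys 0)\<close> cmp_null[OF \<delta>a Y0(2)] by simp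
      then show ?thesis ..
    next
      assume "(h \<star> r) \<star> \<delta> \<noteq> nul W' (Ys 0)"
      then obtain y where y: "arr (Ys 0) (Ys 0) y" "y \<star> h \<star> r = Idm M (Ys 0)"
        using kill[OF hr] split_mono_iff[OF hr] by blast
      have yh: "arr (Ys 0) (Ys 0) (y \<star> h)" using y h by blast
      \<comment> \<open>With left inverse \<open>y\<close> of \<open>h \<star> r\<close> and left
        inverse \<open>r\<close> of \<open>h\<close>, it follows that
        \<open>y \<star> h = h\<close>, and then \<open>h \<star> r\<close> is the identity.\<close>
      have "y \<star> h = ((y \<star> h) \<star> r) \<star> h" using cmp_assoc[OF h(1) r(1) yh] r(2) yh by simp
      also have "\<dots> = h" using cmp_assoc[OF r(1) h(1) y(1)] y(2) h(1) by simp
      finally have "h \<star> r = Idm M (Ys 0)" using cmp_assoc[OF r(1) h(1) y(1)] y(2) by simp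
      then show ?thesis using is_isoI[OF h(1) r(1) r(2)] by blast
    qed
  qed
  have X0: "Xs 0 \<in> Obj M" using \<phi>(1) arrD by blast
  have "is_cover M \<W> (Ys 0) (Xs 0) \<phi>"
    unfolding is_cover_def
  proof (intro conjI ballI impI)
    show "\<exists>h\<in>Mor M V (Ys 0). f = \<phi> \<star> h" if "V \<in> \<W>" "f \<in> Mor M V (Xs 0)" for V f
      using pre[OF that(1), of f] that WM X0 by (auto simp: arr_def)
    show "is_iso M (Ys 0) (Ys 0) h" if "h \<in> Mor M (Ys 0) (Ys 0)" "\<phi> \<star> h = \<phi>" for h
      using min[of h] that Y0 by (auto simp: arr_def)
  qed (use \<phi> Y0 X0 in \<open>auto simp: arr_def\<close>)
  then show ?thesis by blast
qed

section \<open>From a cover to an Auslander-Reiten angle in the subcategory\<close>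

text \<open>Through \<gamma> some morphism from an object of \<open>\<W>\<close> to
  \<open>Xs 0\<close> reaches \<zeta>, and lifting it along the cover gives \<delta>. Making the
  inner morphisms of the angle over \<delta> radical changes neither its ends nor \<delta>, from
  which both almost split properties are derived.\<close>

lemma AR_angle_if_cover:
  assumes fin: "Hom_finite k M" and si: "split_idempotents M" and sub: "additive_subcategory M \<W>"
    and ext: "closed_under_extensions d M \<W>" and W: "W \<in> \<W>"
    and U0: "U0 \<in> \<W>" and \<gamma>: "\<gamma> \<in> Mor M W (sO U0)" "\<gamma> \<noteq> nul W (sO U0)"
    and X: "AR_angle d M (Obj M) Xs \<xi>" "Xs (d + 1) = W"
    and cov: "is_cover M \<W> W0 (Xs 0) \<phi>"
  shows "\<exists>Ys \<omega>. AR_angle d M \<W> Ys \<omega> \<and> Ys 0 = W0 \<and> Ys (d + 1) = W"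
proof -
  have WM: "\<W> \<subseteq> Obj M" using sub by (simp add: additive_subcategory_def)
  have W0: "W0 \<in> \<W>" "W0 \<in> Obj M" using cov WM by (auto simp: is_cover_def)
  have \<phi>: "arr W0 (Xs 0) \<phi>" using cov W0 by (auto simp: is_cover_def arr_def)
  have X0: "Xs 0 \<in> Obj M" using \<phi> arrD by blast
  have pre: "\<exists>h. arr V W0 h \<and> f = \<phi> \<star> h" if "V \<in> \<W>" "arr V (Xs 0) f" for V f
    using cov that W0 WM unfolding is_cover_def arr_def by blast
  have min: "is_iso M W0 W0 h" if "arr W0 W0 h" "\<phi> \<star> h = \<phi>" for h
    using cov that unfolding is_cover_def arr_def by blast
  obtain W' where W': "W' \<in> Obj M" "sO W' = W" using sO_surj W WM by blast
  obtain \<zeta> where \<zeta>: "tail Xs \<xi> W' \<zeta>" using ex_tail X W' unfolding AR_angle_def by metis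
  have \<zeta>a: "arr W' (Xs 0) \<zeta>" "sM \<zeta> = \<xi> (d + 1)" using \<zeta> by (auto simp: tail_def)
  have Xa: "angle Xs \<xi>" using X by (auto simp: AR_angle_def)
  have \<xi>d: "arr (Xs d) W (\<xi> d)" using angle_arr[OF Xa order_refl] X(2) by simp
  have \<xi>l: "arr W (sO (Xs 0)) (\<xi> (d + 1))" using angle_arr_last[OF Xa] X(2) by simp
  have full: "full_sub M (Obj M) = M" by (simp add: full_sub_def)
  have lasX: "left_almost_split M (Xs 0) (Xs 1) (\<xi> 0)"
    and rasX: "right_almost_split M (Xs d) (Xs (d + 1)) (\<xi> d)"
    using X(1) unfolding AR_angle_def full by auto
  have \<zeta>_nz: "\<zeta> \<noteq> nul W' (Xs 0)"
    using tail_nonzero[OF \<zeta>] rasX by (simp add: right_almost_split_def)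
  have U0O: "U0 \<in> Obj M" using U0 WM by blast
  have "arr (sO W') (sO U0) \<gamma>" using \<gamma>(1) W W' WM U0O by (auto simp: arr_def)
  then obtain \<gamma>' where \<gamma>': "arr W' U0 \<gamma>'" "sM \<gamma>' = \<gamma>"
    by (rule sM_surj[OF W'(1) U0O])
  have "\<gamma>' \<noteq> nul W' U0" using \<gamma>' \<gamma>(2) W' arrD by auto
  then obtain \<theta> where \<theta>: "arr U0 (Xs 0) \<theta>" "\<theta> \<star> \<gamma>' = \<zeta>"
    using right_almost_split_generates[OF \<zeta> _ WM ext _ U0 \<gamma>'(1)] rasX X(2) W full by auto
  obtain h where h: "arr U0 W0 h" "\<theta> = \<phi> \<star> h" using pre[OF U0 \<theta>(1)] by blast
  define \<delta> where "\<delta> = h \<star> \<gamma>'"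
  have \<delta>: "arr W' W0 \<delta>" using h \<gamma>' by (auto simp: \<delta>_def)
  have \<phi>\<delta>: "\<phi> \<star> \<delta> = \<zeta>" using cmp_assoc[OF \<gamma>'(1) h(1) \<phi>] h \<theta> by (simp add: \<delta>_def)
  have \<delta>_nz: "\<delta> \<noteq> nul W' W0" using \<phi>\<delta> \<zeta>_nz cmp_nulr[OF \<phi> W'(1)] by auto
  \<comment> \<open>If \<phi> kills \<eta>, it factors through a weak cokernel \<open>v\<close> of
    \<eta> in \<open>\<W>\<close>; lifting back along the precover gives
    \<open>\<phi> = \<phi> \<star> \<chi> \<star> v\<close>. By minimality
    \<open>\<chi> \<star> v\<close> is invertible, yet it kills \<eta>.\<close>
  have mono: "\<eta> = nul Y W0" if Y: "sO Y \<in> \<W>" and \<eta>: "arr Y W0 \<eta>" "\<phi> \<star> \<eta> = nul Y (Xs 0)" for Y \<eta>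
  proof -
    obtain B v where v: "B \<in> \<W>" "arr W0 B v" "v \<star> \<eta> = nul Y B"
      and fac: "\<And>A g. \<lbrakk> arr W0 A g; g \<star> \<eta> = nul Y A \<rbrakk> \<Longrightarrow> \<exists>h. arr B A h \<and> g = h \<star> v"
      using weak_cokernel_in[OF ext W0(1) Y \<eta>(1)] by blast
    obtain \<psi> where \<psi>: "arr B (Xs 0) \<psi>" "\<phi> = \<psi> \<star> v" using fac[OF \<phi> \<eta>(2)] by blast
    obtain \<chi> where \<chi>: "arr B W0 \<chi>" "\<psi> = \<phi> \<star> \<chi>" using pre[OF v(1) \<psi>(1)] by blast
    have \<chi>v: "arr W0 W0 (\<chi> \<star> v)" using \<chi> v by blast
    have "is_iso M W0 W0 (\<chi> \<star> v)"
      using min[OF \<chi>v] cmp_assoc[OF v(2) \<chi>(1) \<phi>] \<psi>(2) \<chi>(2) by metis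
    then obtain r where r: "arr W0 W0 r" "r \<star> \<chi> \<star> v = Idm M W0"
      using W0 by (auto simp: is_iso_def arr_def)
    have YO: "Y \<in> Obj M" using \<eta> arrD by blast
    have "\<eta> = r \<star> (\<chi> \<star> v) \<star> \<eta>" using cmp_assoc[OF \<eta>(1) \<chi>v r(1)] r(2) \<eta>(1) by simp
    also have "\<dots> = nul Y W0"
      using cmp_assoc[OF \<eta>(1) v(2) \<chi>(1)] v(3) cmp_nulr[OF \<chi>(1) YO] cmp_nulr[OF r(1) YO] by simp
    finally show ?thesis .
  qed
  obtain Z z where Z: "tail Z z W' \<delta>" "Z 0 = W0" "Z (d + 1) = W" "z (d + 1) = sM \<delta>"
    and ZW: "\<And>i. i \<le> d + 1 \<Longrightarrow> Z i \<in> \<W>"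
    using extension_angle[OF ext W0(1) _ \<delta>] W W' by metis
  have Za: "angle Z z" using Z(1) by (simp add: tail_def)
  obtain Ys \<omega> where Y: "angle Ys \<omega>" "\<And>i. i \<le> d + 1 \<Longrightarrow> Ys i \<in> \<W>" "Ys 0 = W0" "Ys (d + 1) = W"
    "\<omega> (d + 1) = sM \<delta>"
    and rad: "\<And>i. i \<in> {1..<d} \<Longrightarrow> \<omega> i \<in> radical (full_sub M \<W>) (Ys i) (Ys (i + 1))"
    using ex_radical_angle[OF fin si sub Za ZW] Z by metis
  have Yt: "tail Ys \<omega> W' \<delta>" using Y W' \<delta> by (simp add: tail_def)
  have \<omega>d: "arr (Ys d) W (\<omega> d)" using angle_arr[OF Y(1) order_refl] Y(4) by simp
  have \<omega>0: "arr W0 (Ys 1) (\<omega> 0)" using angle_arr[OF Y(1), of 0] Y(3) by simp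
  have ras: "right_almost_split (full_sub M \<W>) (Ys d) (Ys (d + 1)) (\<omega> d)"
    unfolding right_almost_split_def full_sub_simps full_sub_split Y(4)
  proof (intro conjI ballI impI)
    show "Ys d \<in> \<W>" "W \<in> \<W>" "\<omega> d \<in> Mor M (Ys d) W" using Y(2)[of d] W \<omega>d by (auto simp: arr_def)
    show "\<not> split_epi M (Ys d) W (\<omega> d)" using not_split_epi_if_tail[OF Yt] \<delta>_nz Y by simp
    fix V g assume V: "V \<in> \<W>" and "g \<in> Mor M V W" and ns: "\<not> split_epi M V W g"
    then have g: "arr V W g" using W WM by (auto simp: arr_def)
    have VO: "V \<in> Obj M" using V WM by blast
    obtain x where x: "arr V (Xs d) x" "g = \<xi> d \<star> x"
      using rasX g ns \<xi>d X(2) unfolding right_almost_split_def arr_def by auto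
    obtain V' where V': "V' \<in> Obj M" "sO V' = V" using sO_surj[OF VO] by blast
    obtain g' where g': "arr V' W' g'" "sM g' = g"
      using sM_surj[OF V'(1) W'(1), of g] g V' W' by auto
    have "\<xi> (d + 1) \<star> g = nul V (sO (Xs 0))"
      using cmp_assoc[OF x(1) \<xi>d \<xi>l] x(2) angle_cmp_d[OF Xa] cmp_null[OF x(1), of "sO (Xs 0)"] X0 by simp
    \<comment> \<open>Any \<open>g\<close> that factors through \<open>\<xi> d\<close> is killed by
      the connecting morphism of the first angle; \<open>mono\<close> carries this over to \<delta>,
      whose angle then has \<open>\<omega> d\<close> as weak kernel.\<close>
    then have "\<zeta> \<star> g' = nul V' (Xs 0)"
      using sM_cmp[OF g'(1) \<zeta>a(1)] g' \<zeta>a sM_eq_nul_iff[OF arr_cmp[OF g'(1) \<zeta>a(1)]] V' by simp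
    then have "\<phi> \<star> \<delta> \<star> g' = nul V' (Xs 0)" using cmp_assoc[OF g'(1) \<delta> \<phi>] \<phi>\<delta> by simp
    then have "\<delta> \<star> g' = nul V' W0" using mono[of V' "\<delta> \<star> g'"] V V' g' \<delta> by blast
    then have "\<omega> (d + 1) \<star> g = nul V (sO (Ys 0))"
      using sM_cmp[OF g'(1) \<delta>] g' Y V' W0 by simp
    then obtain y where "arr V (Ys d) y" "g = \<omega> d \<star> y"
      using weak_kernel_d[OF Y(1), of V g] g Y(4) by blast
    then show "\<exists>h\<in>Mor M V (Ys d). g = \<omega> d \<star> h" by (auto simp: arr_def)
  qed
  have las: "left_almost_split (full_sub M \<W>) (Ys 0) (Ys 1) (\<omega> 0)"
    unfolding left_almost_split_def full_sub_simps full_sub_split Y(3)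
  proof (intro conjI ballI impI)
    show "W0 \<in> \<W>" "Ys 1 \<in> \<W>" "\<omega> 0 \<in> Mor M W0 (Ys 1)"
      using Y(2)[of 1] W0 \<omega>0 by (auto simp: arr_def)
    show "\<not> split_mono M W0 (Ys 1) (\<omega> 0)" using tail_not_split_mono[OF Yt] \<delta>_nz Y by simp
    fix V f assume V: "V \<in> \<W>" and "f \<in> Mor M W0 V" and ns: "\<not> split_mono M W0 V f"
    then have f: "arr W0 V f" using W0 WM by (auto simp: arr_def)
    have f\<delta>: "arr W' V (f \<star> \<delta>)" using f \<delta> by blast
    \<comment> \<open>Vanishing suffices, as \<open>\<omega> 0\<close> is a weak cokernel of
      \<delta>. Otherwise some \<open>h \<star> f\<close> fixes \<delta>, so its complement
      \<open>b\<close> kills \<delta>, and Fitting's lemma is applied to \<open>b\<close>.\<close>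
    have "f \<star> \<delta> = nul W' V"
    proof (rule ccontr)
      assume "f \<star> \<delta> \<noteq> nul W' V"
      then obtain h where h: "arr V W0 h" "h \<star> f \<star> \<delta> = \<delta>"
        using right_almost_split_generates[OF Yt ras order_refl ext _ V f\<delta>] Y W by auto
      define b where "b = Idm M W0 \<ominus>\<^bsub>Hom M W0 W0\<^esub> (h \<star> f)"
      have hf: "arr W0 W0 (h \<star> f)" using h f by blast
      have b: "arr W0 W0 b" using hf W0 by (simp add: b_def)
      have b\<delta>: "b \<star> \<delta> = nul W' W0"
        using cmp_minusl[OF \<delta> arr_id[OF W0(2)] hf] cmp_assoc[OF \<delta> f h(1)] h(2) \<delta> by (simp add: b_def)
      obtain e c s where e: "arr W0 W0 e" "arr W0 W0 c" "arr W0 W0 s" "e \<star> e = e"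
        and ec: "Idm M W0 \<ominus>\<^bsub>Hom M W0 W0\<^esub> e = c \<star> b"
        and es: "e = s \<star> (Idm M W0 \<ominus>\<^bsub>Hom M W0 W0\<^esub> b)"
        by (rule end_fitting[OF fin b])
      have es': "e = s \<star> h \<star> f"
        using es minus_minus_self[OF arr_id[OF W0(2)] hf] by (simp add: b_def)
      define x where "x = Idm M W0 \<ominus>\<^bsub>Hom M W0 W0\<^esub> e"
      have x: "arr W0 W0 x" using e W0 by (simp add: x_def)
      have ex: "e \<star> x = nul W0 W0"
        using cmp_minusr[OF arr_id[OF W0(2)] e(1) e(1)] e by (simp add: x_def)
      have xx: "x \<star> x = x"
        using cmp_minusl[OF x arr_id[OF W0(2)] e(1)] ex x minus_nul[OF x] by (simp flip: x_def)
      have x\<delta>: "x \<star> \<delta> = nul W' W0"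
        using ec cmp_assoc[OF \<delta> b e(2)] b\<delta> cmp_nulr[OF e(2) W'(1)] by (simp add: x_def)
      \<comment> \<open>If not, some \<epsilon> satisfies
        \<open>\<phi> \<star> x \<star> \<epsilon> = \<zeta>\<close>, and injectivity of \<phi>
        gives \<open>x \<star> \<epsilon> = \<delta>\<close>. The idempotent \<open>x\<close> would
        then fix \<delta>, although it kills \<delta>.\<close>
      have \<phi>x: "\<phi> \<star> x = nul W0 (Xs 0)"
      proof (rule ccontr)
        assume nz: "\<phi> \<star> x \<noteq> nul W0 (Xs 0)"
        obtain \<epsilon> where \<epsilon>: "arr W' W0 \<epsilon>" "(\<phi> \<star> x) \<star> \<epsilon> = \<zeta>"
          using left_almost_split_reach[OF \<zeta> lasX arr_cmp[OF x \<phi>] nz] by blast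
        have x\<epsilon>: "arr W' W0 (x \<star> \<epsilon>)" using x \<epsilon> by blast
        have "\<phi> \<star> ((x \<star> \<epsilon>) \<ominus>\<^bsub>Hom M W' W0\<^esub> \<delta>) = nul W' (Xs 0)"
          using cmp_minusr[OF x\<epsilon> \<delta> \<phi>] cmp_assoc[OF \<epsilon>(1) x \<phi>] \<epsilon>(2) \<phi>\<delta> minus_self[OF \<zeta>a(1)] by simp
        then have "(x \<star> \<epsilon>) \<ominus>\<^bsub>Hom M W' W0\<^esub> \<delta> = nul W' W0"
          using mono[of W' "(x \<star> \<epsilon>) \<ominus>\<^bsub>Hom M W' W0\<^esub> \<delta>"] W W' x\<epsilon> \<delta> by simp
        then have "x \<star> \<epsilon> = \<delta>" using minus_eq_nul_iff[OF x\<epsilon> \<delta>] by simp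
        then have "x \<star> \<delta> = \<delta>" using cmp_assoc[OF \<epsilon>(1) x x] xx by simp
        then show False using x\<delta> \<delta>_nz by simp
      qed
      have "\<phi> \<star> e = \<phi>"
        using cmp_minusr[OF arr_id[OF W0(2)] e(1) \<phi>] \<phi>x minus_eq_nul_iff[OF \<phi> arr_cmp[OF e(1) \<phi>]] \<phi>
        by (simp add: x_def)
      then obtain r where r: "arr W0 W0 r" "r \<star> e = Idm M W0"
        using min[OF e(1)] W0 by (auto simp: is_iso_def arr_def)
      \<comment> \<open>An invertible idempotent is the identity, so \<open>s \<star> h\<close> is a
        retraction of \<open>f\<close>.\<close>
      have "e = r \<star> e \<star> e" using cmp_assoc[OF e(1) e(1) r(1)] r(2) e(1) by simp
      then have "(s \<star> h) \<star> f = Idm M W0" using e(4) r(2) es' cmp_assoc[OF f h(1) e(3)] by simp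
      then show False using ns split_mono_iff[OF f] arr_cmp[OF h(1) e(3)] by blast
    qed
    then obtain y where "arr (Ys 1) V y" "f = y \<star> \<omega> 0"
      using weak_cokernel[OF Yt, of V f] f Y(3) by metis
    then show "\<exists>h\<in>Mor M (Ys 1) V. f = h \<star> \<omega> 0" by (auto simp: arr_def)
  qed
  have "AR_angle d M \<W> Ys \<omega>"
    unfolding AR_angle_def using Y(1,2) las ras rad by blast
  then show ?thesis using Y by blast
qed

end

theorem theoremB:
  fixes k :: "('k, 'r) ring_scheme"
    and M :: "('o, 'm, 'k, 'x) ang_cat_scheme"
    and d :: nat
    and \<W> :: "'o set"
    and W W0 U0 :: 'o
    and \<gamma> :: 'm
    and Xs :: "nat \<Rightarrow> 'o" and \<xi> :: "nat \<Rightarrow> 'm"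
  assumes "algebraically_closed k"
    and "angulated_category k M d"
    and "skeletally_small M"
    and "Hom_finite k M"
    and "split_idempotents M"
    and "additive_subcategory M \<W>"
    and "closed_under_extensions d M \<W>"
    and "W \<in> \<W>"
    and "U0 \<in> \<W>" and "\<gamma> \<in> Mor M W (shO M U0)" and "\<gamma> \<noteq> \<zero>\<^bsub>Hom M W (shO M U0)\<^esub>"
    and "AR_angle d M (Obj M) Xs \<xi>" and "Xs (d + 1) = W"
    and "W0 \<in> \<W>"
  shows "(\<exists>\<phi>. is_cover M \<W> W0 (Xs 0) \<phi>) \<longleftrightarrow>
    (\<exists>Ys \<omega>. AR_angle d M \<W> Ys \<omega> \<and> Ys 0 = W0 \<and> Ys (d + 1) = W)"
proof -
  interpret angulated_category k M d by fact
  have "\<W> \<subseteq> Obj M" using assms(6) by (simp add: additive_subcategory_def)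
  then show ?thesis
    using AR_angle_if_cover[OF assms(4-13)] cover_if_AR_angle[OF assms(4,7) _ assms(8,12,13)] by blast
qed

end
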